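(* Let $\mathfrak g$ be a complex simple Lie algebra of type $D_l$ and let $I\subset\Pi$ be of cardinality $r$. Set $t=\sharp(\{\alpha_{l-1},\alpha_l\}\cap I)$. If $\alpha_1\in I$, then the cardinality of $\mathcal F_I^{ab}$ is: (i) $\displaystyle 2^{l-r}-2^{l-r-2}+\sum_{j=1}^{s}\left[2\binom{l-r-1}{l_j-1}-\binom{l-r-2}{l_j-1}\right]$, if $t=0$; (ii) $\displaystyle 2^{l-r-1}+\sum_{j=1}^{s}\binom{l-r-1}{l_j-1}$, if $t=1$; (iii) $\displaystyle 2^{l-r-1}+\sum_{j=1}^{s-1}\binom{l-r-1}{l_j-1}$, if $t=2$. If $\alpha_1\notin I$, then the cardinality of $\mathcal F_I^{ab}$ is: (iv) $\displaystyle 2^{l-r}+\sum_{j=1}^{s}2\binom{l-r-1}{l_j-1}$, if $t=0$; (v) $\displaystyle 2^{l-r-1}+2^{l-r-2}+\sum_{j=1}^{s}\binom{l-r-1}{l_j-1}+\sum_{j=1}^{s-1}\binom{l-r-2}{l_j-1}$, if $t=1$; (vi) $\displaystyle 2^{l-r}+2\sum_{j=1}^{s-1}\binom{l-r-1}{l_j-1}$, if $t=2$.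
   Context: $\Delta$ is the root system of $\mathfrak g$ with respect to a Cartan subalgebra $\mathfrak h$, $\Delta^+$ the positive roots, $\Pi=\{\alpha_1,\dots,\alpha_l\}$ the simple roots ($l\ge4$), numbered so that $\alpha_1,\dots,\alpha_{l-2}$ form a chain in the Dynkin diagram and $\alpha_{l-1},\alpha_l$ are both joined to $\alpha_{l-2}$; $\mathfrak g_\alpha$ are the root spaces. For $I\subset\Pi$, $\Delta_I=\mathbb ZI\cap\Delta$, $\mathfrak p_I=\mathfrak h\oplus\bigoplus_{\alpha\in\Delta_I\cup\Delta^+}\mathfrak g_\alpha$, $\mathcal F_I=\{\Phi\subset\Delta^+\setminus\Delta_I:\ \alpha\in\Phi,\ \beta\in\Delta^+\cup\Delta_I,\ \alpha+\beta\in\Delta^+\Rightarrow\alpha+\beta\in\Phi\}$ and, for $\Phi\in\mathcal F_I$, $\mathfrak i_\Phi=\bigoplus_{\alpha\in\Phi}\mathfrak g_\alpha$ (an ad-nilpotent ideal of $\mathfrak p_I$). $\mathcal F_I^{ab}=\{\Phi\in\mathcal F_I:\mathfrak i_\Phi\text{ is abelian}\}$. $I_1,\dots,I_s$ are the connected components of $I$ in the Dynkin diagram, $r_j=\sharp I_j$, $m_j=\min\{i:\alpha_i\in I_j\}$, ordered so that $m_1<\dots<m_s$ ($s=0$ if $I=\emptyset$). Set $l_j=m_j-\sum_{k=1}^{j-1}r_k$, except that if $I_s=\{\alpha_l\}$ then $l_s=m_s-\sum_{k=1}^{s-1}r_k-1$. As usual $\binom ab=0$ if $b>a\ge0$.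
   Formalization: In case (iii) with I = Π (r = l) the printed formula gives 2^{-1} = 1/2 although the cardinality is 1; there the power 2^{l-r-1} is read as 1. For every proper subset I the formulas are as printed. *)

theory Defs
  imports
    Complex_Main
    "HOL-Library.Function_Algebras"
    "HOL-Computational_Algebra.Group_Closure"
begin

locale complex_lie_algebra = finite_dimensional_vector_space scale Basis
  for scale :: "complex \<Rightarrow> 'g::ab_group_add \<Rightarrow> 'g" (infixr "*s" 75)
    and Basis :: "'g set" +
  fixes br :: "'g \<Rightarrow> 'g \<Rightarrow> 'g" ("[_,_]\<^sub>L")
  assumes br_add_left: "[x + y, z]\<^sub>L = [x, z]\<^sub>L + [y, z]\<^sub>L"
    and br_add_right: "[x, y + z]\<^sub>L = [x, y]\<^sub>L + [x, z]\<^sub>L"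
    and br_scale_left: "[c *s x, y]\<^sub>L = c *s [x, y]\<^sub>L"
    and br_scale_right: "[x, c *s y]\<^sub>L = c *s [x, y]\<^sub>L"
    and br_alternating: "[x, x]\<^sub>L = 0"
    and br_jacobi: "[x, [y, z]\<^sub>L]\<^sub>L + [y, [z, x]\<^sub>L]\<^sub>L + [z, [x, y]\<^sub>L]\<^sub>L = 0"
begin

definition abelian_on :: "'g set \<Rightarrow> bool" where
  "abelian_on S \<longleftrightarrow> (\<forall>x\<in>S. \<forall>y\<in>S. [x, y]\<^sub>L = 0)"

definition lie_ideal :: "'g set \<Rightarrow> bool" where
  "lie_ideal J \<longleftrightarrow> subspace J \<and> (\<forall>x. \<forall>y\<in>J. [x, y]\<^sub>L \<in> J)"

definition simple :: bool where
  "simple \<longleftrightarrow> \<not> abelian_on UNIV \<and> (\<forall>J. lie_ideal J \<longrightarrow> J = {0} \<or> J = UNIV)"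

definition diagonalizable :: "('g \<Rightarrow> 'g) \<Rightarrow> bool" where
  "diagonalizable f \<longleftrightarrow>
    (\<exists>B. independent B \<and> span B = UNIV \<and> (\<forall>b\<in>B. \<exists>c. f b = c *s b))"

text \<open>The usual definition for a (semi)simple complex Lie algebra, as in Hall's
  "Lie Groups, Lie Algebras, and Representations".\<close>

definition cartan_subalgebra :: "'g set \<Rightarrow> bool" where
  "cartan_subalgebra H \<longleftrightarrow> subspace H \<and> abelian_on H \<and>
    (\<forall>x. (\<forall>h\<in>H. [h, x]\<^sub>L = 0) \<longrightarrow> x \<in> H) \<and>
    (\<forall>h\<in>H. diagonalizable (\<lambda>x. [h, x]\<^sub>L))"

text \<open>A linear form on the subspace \<open>H\<close> is represented by a function on the whole type that
  vanishes outside \<open>H\<close>, so that distinct functions are distinct elements of the dual space.\<close>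

definition dual_space :: "'g set \<Rightarrow> ('g \<Rightarrow> complex) set" where
  "dual_space H = {\<beta>. (\<forall>x\<in>H. \<forall>y\<in>H. \<beta> (x + y) = \<beta> x + \<beta> y) \<and>
     (\<forall>c. \<forall>x\<in>H. \<beta> (c *s x) = c * \<beta> x) \<and> (\<forall>x. x \<notin> H \<longrightarrow> \<beta> x = 0)}"

definition root_space :: "'g set \<Rightarrow> ('g \<Rightarrow> complex) \<Rightarrow> 'g set" where
  "root_space H \<beta> = {x. \<forall>h\<in>H. [h, x]\<^sub>L = \<beta> h *s x}"

definition roots :: "'g set \<Rightarrow> ('g \<Rightarrow> complex) set" where
  "roots H = {\<beta> \<in> dual_space H. \<beta> \<noteq> 0 \<and> root_space H \<beta> \<noteq> {0}}"

definition root_base :: "'g set \<Rightarrow> ('g \<Rightarrow> complex) set \<Rightarrow> bool" where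
  "root_base H P \<longleftrightarrow> finite P \<and> P \<subseteq> roots H \<and>
    (\<forall>c :: ('g \<Rightarrow> complex) \<Rightarrow> complex. (\<lambda>x. \<Sum>\<gamma>\<in>P. c \<gamma> * \<gamma> x) = 0 \<longrightarrow> (\<forall>\<gamma>\<in>P. c \<gamma> = 0)) \<and>
    (\<forall>\<beta>\<in>roots H. \<exists>n :: ('g \<Rightarrow> complex) \<Rightarrow> nat.
       \<beta> = (\<lambda>x. \<Sum>\<gamma>\<in>P. of_nat (n \<gamma>) * \<gamma> x) \<or> \<beta> = - (\<lambda>x. \<Sum>\<gamma>\<in>P. of_nat (n \<gamma>) * \<gamma> x))"

definition pos_roots :: "'g set \<Rightarrow> ('g \<Rightarrow> complex) set \<Rightarrow> ('g \<Rightarrow> complex) set" where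
  "pos_roots H P = {\<beta> \<in> roots H. \<exists>n :: ('g \<Rightarrow> complex) \<Rightarrow> nat.
     \<beta> = (\<lambda>x. \<Sum>\<gamma>\<in>P. of_nat (n \<gamma>) * \<gamma> x)}"

definition endo_trace :: "('g \<Rightarrow> 'g) \<Rightarrow> complex" where
  "endo_trace f = (\<Sum>b\<in>Basis. representation Basis (f b) b)"

definition killing_form :: "'g \<Rightarrow> 'g \<Rightarrow> complex" where
  "killing_form x y = endo_trace (\<lambda>z. [x, [y, z]\<^sub>L]\<^sub>L)"

text \<open>The element of \<open>H\<close> representing a linear form, and the bilinear form on the dual of \<open>H\<close>,
  obtained by identifying \<open>H\<close> with its dual through the Killing form.\<close>

definition riesz :: "'g set \<Rightarrow> ('g \<Rightarrow> complex) \<Rightarrow> 'g" where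
  "riesz H \<beta> = (THE t. t \<in> H \<and> (\<forall>h\<in>H. killing_form t h = \<beta> h))"

definition root_form :: "'g set \<Rightarrow> ('g \<Rightarrow> complex) \<Rightarrow> ('g \<Rightarrow> complex) \<Rightarrow> complex" where
  "root_form H \<beta> \<gamma> = killing_form (riesz H \<beta>) (riesz H \<gamma>)"

definition cartan_integer :: "'g set \<Rightarrow> ('g \<Rightarrow> complex) \<Rightarrow> ('g \<Rightarrow> complex) \<Rightarrow> complex" where
  "cartan_integer H \<beta> \<gamma> = 2 * root_form H \<beta> \<gamma> / root_form H \<gamma> \<gamma>"

text \<open>Number of edges between two distinct nodes of the Dynkin diagram.\<close>

definition dynkin_bonds :: "'g set \<Rightarrow> ('g \<Rightarrow> complex) \<Rightarrow> ('g \<Rightarrow> complex) \<Rightarrow> complex" where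
  "dynkin_bonds H \<beta> \<gamma> = cartan_integer H \<beta> \<gamma> * cartan_integer H \<gamma> \<beta>"

definition dynkin_edges :: "'g set \<Rightarrow> (('g \<Rightarrow> complex) \<times> ('g \<Rightarrow> complex)) set" where
  "dynkin_edges H = {(\<beta>, \<gamma>). \<beta> \<noteq> \<gamma> \<and> dynkin_bonds H \<beta> \<gamma> \<noteq> 0}"

text \<open>\<open>\<alpha>\<close> numbers the simple roots \<open>P\<close> so that their Dynkin diagram is of type D: the nodes
  1, ..., l - 2 form a chain, and l - 1 and l are both joined to l - 2.\<close>

definition type_D :: "'g set \<Rightarrow> ('g \<Rightarrow> complex) set \<Rightarrow> (nat \<Rightarrow> 'g \<Rightarrow> complex) \<Rightarrow> nat \<Rightarrow> bool" where
  "type_D H P \<alpha> l \<longleftrightarrow> 4 \<le> l \<and> bij_betw \<alpha> {1..l} P \<and>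
    (\<forall>i\<in>{1..l}. \<forall>j\<in>{1..l}. i < j \<longrightarrow>
       dynkin_bonds H (\<alpha> i) (\<alpha> j) =
         (if (j = i + 1 \<and> j \<le> l - 1) \<or> (i = l - 2 \<and> j = l) then 1 else 0))"

definition dynkin_components :: "'g set \<Rightarrow> ('g \<Rightarrow> complex) set \<Rightarrow> ('g \<Rightarrow> complex) set set" where
  "dynkin_components H I = I // (Restr (dynkin_edges H) I)\<^sup>*"

definition sub_roots :: "'g set \<Rightarrow> ('g \<Rightarrow> complex) set \<Rightarrow> ('g \<Rightarrow> complex) set" where
  "sub_roots H I = group_closure I \<inter> roots H"

definition ideal_sets ::
  "'g set \<Rightarrow> ('g \<Rightarrow> complex) set \<Rightarrow> ('g \<Rightarrow> complex) set \<Rightarrow> ('g \<Rightarrow> complex) set set" where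
  "ideal_sets H P I = {\<Phi>. \<Phi> \<subseteq> pos_roots H P - sub_roots H I \<and>
     (\<forall>\<beta>\<in>\<Phi>. \<forall>\<gamma>\<in>pos_roots H P \<union> sub_roots H I.
        \<beta> + \<gamma> \<in> pos_roots H P \<longrightarrow> \<beta> + \<gamma> \<in> \<Phi>)}"

definition ideal_of :: "'g set \<Rightarrow> ('g \<Rightarrow> complex) set \<Rightarrow> 'g set" where
  "ideal_of H \<Phi> = span (\<Union>\<beta>\<in>\<Phi>. root_space H \<beta>)"

definition abelian_ideal_sets ::
  "'g set \<Rightarrow> ('g \<Rightarrow> complex) set \<Rightarrow> ('g \<Rightarrow> complex) set \<Rightarrow> ('g \<Rightarrow> complex) set set" where
  "abelian_ideal_sets H P I = {\<Phi> \<in> ideal_sets H P I. abelian_on (ideal_of H \<Phi>)}"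

end

definition min_index :: "(nat \<Rightarrow> 'r) \<Rightarrow> nat \<Rightarrow> 'r set \<Rightarrow> nat" where
  "min_index \<alpha> l J = Min {i \<in> {1..l}. \<alpha> i \<in> J}"

text \<open>The number \<open>l\<^sub>j\<close> attached to the \<open>j\<close>-th of the components \<open>C 1, \<dots>, C s\<close>, listed by
  increasing minimum. The subtractions do not truncate, and the value is at least 1: the components
  listed before \<open>C j\<close> consist of nodes numbered below the minimum of \<open>C j\<close>, and \<open>{\<alpha> l}\<close> is a
  component only if \<open>\<alpha> (l - 2)\<close> is not in \<open>I\<close>.\<close>

definition shifted_index :: "(nat \<Rightarrow> 'r) \<Rightarrow> nat \<Rightarrow> (nat \<Rightarrow> 'r set) \<Rightarrow> nat \<Rightarrow> nat \<Rightarrow> nat" where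
  "shifted_index \<alpha> l C s j =
    (if j = s \<and> C s = {\<alpha> l}
     then min_index \<alpha> l (C s) - (\<Sum>k\<in>{1..<s}. card (C k)) - 1
     else min_index \<alpha> l (C j) - (\<Sum>k\<in>{1..<j}. card (C k)))"

end

theory Submission
  imports Defs
begin

text \<open>Write the roots of \<open>D\<^sub>l\<close> as \<open>\<epsilon>\<^sub>x + \<epsilon>\<^sub>y\<close> for signed indices \<open>x\<close>, \<open>y\<close> with
  \<open>\<bar>x\<bar> \<noteq> \<bar>y\<bar>\<close>, where \<open>\<epsilon>\<^sub>-\<^sub>x = - \<epsilon>\<^sub>x\<close>. The simple roots outside \<open>I\<close> define a grading, and the
  degrees \<open>lam x\<close> of the \<open>\<epsilon>\<^sub>x\<close> decide everything: a root lies in \<open>\<Delta>\<^sup>+ \<union> \<Delta>\<^sub>I\<close> if its degree is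
  nonnegative and in \<open>\<Delta>\<^sup>+ - \<Delta>\<^sub>I\<close> if it is positive. An abelian ideal thus becomes a symmetric
  relation on the signed indices, closed under replacing an index by one of at least the same
  degree, in which no two pairs contain opposite indices, except in the harmless form \<open>(x, y)\<close>,
  \<open>(- y, \<plusminus> x)\<close> (\<open>bij_betw_abelian_ideals_relations\<close>).

  The first half of the text derives this dictionary from the abstract definitions. No structure
  theory of semisimple Lie algebras is presupposed, and the given base makes it short. Every root
  takes a nonzero integral value on the element \<open>h\<close> of \<open>H\<close> where all simple roots are 1. Hence
  \<open>\<kappa>(h, h)\<close> is a nonempty sum of nonzero squares of integers, and the radical of the Killing form, an ideal of
  a simple algebra, is 0 (\<open>killing_nondegenerate\<close>). A single computation with
  primitive vectors (\<open>primitive_vector\<close>) then gives that roots are not isotropic, that root spaces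
  are lines, that only \<open>\<plusminus> \<alpha>\<close> among the multiples of a root are roots, and the root string formula,
  including \<open>[\<gg>\<^sub>\<alpha>, \<gg>\<^sub>\<beta>] \<noteq> 0\<close> if \<open>\<alpha> + \<beta>\<close> is a root (\<open>bracket_nonzero\<close>); so \<open>\<ii>\<^sub>\<Phi>\<close> is abelian if and only
  if no two elements of \<open>\<Phi>\<close> add up to a root. Reflections preserve the inner product for which the
  \<open>\<epsilon>\<^sub>i\<close> are orthonormal, and they lower every positive root to a simple one. Therefore all roots
  are integral vectors of square length 2, and all such vectors \<open>\<plusminus> \<epsilon>\<^sub>i \<plusminus> \<epsilon>\<^sub>j\<close> occur.

  For the count, the diagram automorphism allows to assume that \<open>\<alpha>\<^sub>l \<in> I\<close> implies
  \<open>\<alpha>\<^sub>l\<^sub>-\<^sub>1 \<in> I\<close>; then \<open>lam\<close> is nonnegative and weakly decreasing on \<open>1, \<dots>, l\<close>. There are three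
  kinds of ideals: those consisting of roots \<open>\<epsilon>\<^sub>i + \<epsilon>\<^sub>j\<close> with \<open>i, j > 0\<close>, their mirror images under
  \<open>\<epsilon>\<^sub>l \<mapsto> - \<epsilon>\<^sub>l\<close>, and the rest, which exist only if \<open>\<alpha>\<^sub>1 \<notin> I\<close> and contain \<open>\<epsilon>\<^sub>1 - \<epsilon>\<^sub>b\<close> for the \<open>b\<close> in
  some final segment \<open>J\<close>. An ideal of the first kind is a graph on positive indices whose vertices are preordered by dominance,
  a threshold graph; an ideal of the third kind is determined by the threshold graph that it
  induces on the indices outside \<open>J\<close>, because \<open>J\<close> is recovered as the set of non-neighbours of 1
  (\<open>card_rel_ideals\<close>).

  Indices of equal degree form blocks. In a threshold graph on the blocks \<open>u, \<dots>, v\<close> with \<open>u < v\<close> either block \<open>u\<close> is joined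
  to everything or block \<open>v\<close> is isolated, and removing that block leaves an arbitrary threshold
  graph on the other blocks. A single block carries two graphs if it has at least two elements and one otherwise. Pascal's rule
  therefore gives \<open>2\<^sup>k\<^sup>-\<^sup>1\<close> plus the sum of \<open>k - 1\<close> over \<open>b - 1\<close> for the nontrivial blocks \<open>b \<le> k\<close>
  (\<open>card_threshold_graphs_blocks\<close>). The nontrivial blocks are the components of \<open>I\<close>, and the block
  number of the \<open>j\<close>-th component is \<open>l\<^sub>j\<close>.\<close>

section \<open>Eigenvectors and traces\<close>

context finite_dimensional_vector_space
begin

lemma eigenvectors_sum_zero:
  assumes f: "Vector_Spaces.linear scale scale f" and "finite L"
    and "\<And>c. c \<in> L \<Longrightarrow> f (y c) = scale c (y c)"
    and "(\<Sum>c\<in>L. y c) = 0"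
  shows "\<forall>c\<in>L. y c = 0"
  using assms(2-)
proof (induction L arbitrary: y rule: finite_induct)
  case empty
  then show ?case by simp
next
  case (insert c0 L)
  interpret f: Vector_Spaces.linear scale scale f by fact
  have s: "y c0 + (\<Sum>c\<in>L. y c) = 0" using insert by simp
  then have "f (y c0 + (\<Sum>c\<in>L. y c)) = 0" by (simp add: f.zero)
  then have fs: "scale c0 (y c0) + (\<Sum>c\<in>L. scale c (y c)) = 0"
    using insert.prems(1) by (simp add: f.add f.sum)
  have "scale c0 (y c0) + (\<Sum>c\<in>L. scale c0 (y c)) = 0"
    using arg_cong[OF s, of "scale c0"] by (simp add: scale_right_distrib scale_sum_right)
  with fs have "(\<Sum>c\<in>L. scale c (y c)) = (\<Sum>c\<in>L. scale c0 (y c))"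
    using add_left_imp_eq by metis
  then have "(\<Sum>c\<in>L. scale (c - c0) (y c)) = 0"
    unfolding scale_left_diff_distrib sum_subtractf by simp
  moreover have "f (scale (c - c0) (y c)) = scale c (scale (c - c0) (y c))" if "c \<in> L" for c
    using insert.prems(1)[of c] that by (simp add: f.scale mult.commute)
  ultimately have "\<forall>c\<in>L. scale (c - c0) (y c) = 0"
    by (intro insert.IH)
  then have z: "\<forall>c\<in>L. y c = 0" using insert.hyps(2) by auto
  then have "y c0 = 0" using s by simp
  with z show ?case by simp
qed

lemma sum_representation_Basis: "(\<Sum>b\<in>Basis. scale (representation Basis v b) b) = v"
  by (rule sum_representation_eq) (auto simp: independent_Basis span_Basis finite_Basis)

lemma linear_Basis_expansion:
  assumes "Vector_Spaces.linear scale scale f"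
  shows "f v = (\<Sum>b\<in>Basis. scale (representation Basis v b) (f b))"
proof -
  interpret f: Vector_Spaces.linear scale scale f by fact
  have "f v = f (\<Sum>b\<in>Basis. scale (representation Basis v b) b)"
    by (simp add: sum_representation_Basis)
  then show ?thesis by (simp add: f.sum f.scale)
qed

lemma representation_sum_scale:
  assumes "finite S"
  shows "representation Basis (\<Sum>i\<in>S. scale (g i) (w i)) b
    = (\<Sum>i\<in>S. g i * representation Basis (w i) b)"
  using assms
  by (simp add: representation_sum[OF independent_Basis] span_Basis
      representation_scale[OF independent_Basis])

end

context complex_lie_algebra
begin

lemma linear_ad: "Vector_Spaces.linear scale scale (\<lambda>x. [a, x]\<^sub>L)"
  by unfold_locales (simp_all add: br_add_right br_scale_right)

lemma linear_ad_left: "Vector_Spaces.linear scale scale (\<lambda>x. [x, a]\<^sub>L)"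
  by unfold_locales (simp_all add: br_add_left br_scale_left)

sublocale ad: Vector_Spaces.linear scale scale "\<lambda>x. [a, x]\<^sub>L" for a
  by (rule linear_ad)

sublocale adl: Vector_Spaces.linear scale scale "\<lambda>x. [x, a]\<^sub>L" for a
  by (rule linear_ad_left)

lemma br_antisym: "[x, y]\<^sub>L = - [y, x]\<^sub>L"
proof -
  have "[x + y, x + y]\<^sub>L = 0" by (rule br_alternating)
  then have "[x, y]\<^sub>L + [y, x]\<^sub>L = 0"
    unfolding br_add_left br_add_right by (simp add: br_alternating add.commute)
  then show ?thesis by (simp add: eq_neg_iff_add_eq_0)
qed

lemma br_leibniz: "[x, [y, z]\<^sub>L]\<^sub>L = [[x, y]\<^sub>L, z]\<^sub>L + [y, [x, z]\<^sub>L]\<^sub>L"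
proof -
  have "[[x, y]\<^sub>L, z]\<^sub>L = - [z, [x, y]\<^sub>L]\<^sub>L" by (rule br_antisym)
  moreover have "[y, [x, z]\<^sub>L]\<^sub>L = - [y, [z, x]\<^sub>L]\<^sub>L"
    by (subst br_antisym[of x z]) (rule ad.neg)
  ultimately show ?thesis using br_jacobi[of x y z]
    by (simp add: add_eq_0_iff2 eq_diff_eq)
qed

lemma endo_trace_add:
  "endo_trace (\<lambda>x. f x + g x) = endo_trace f + endo_trace g"
  unfolding endo_trace_def
  by (simp add: representation_add[OF independent_Basis] span_Basis sum.distrib)

lemma endo_trace_diff:
  "endo_trace (\<lambda>x. f x - g x) = endo_trace f - endo_trace g"
  unfolding endo_trace_def
  by (simp add: representation_diff[OF independent_Basis] span_Basis sum_subtractf)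

lemma endo_trace_scale:
  "endo_trace (\<lambda>x. c *s f x) = c * endo_trace f"
  unfolding endo_trace_def
  by (simp add: representation_scale[OF independent_Basis] span_Basis sum_distrib_left)

lemma endo_trace_sum:
  assumes "finite S"
  shows "endo_trace (\<lambda>x. \<Sum>i\<in>S. f i x) = (\<Sum>i\<in>S. endo_trace (f i))"
  using assms
  by (induction S rule: finite_induct)
    (simp_all add: endo_trace_add, simp add: endo_trace_def representation_zero)

lemma endo_trace_commute:
  assumes f: "Vector_Spaces.linear scale scale f" and g: "Vector_Spaces.linear scale scale g"
  shows "endo_trace (\<lambda>x. f (g x)) = endo_trace (\<lambda>x. g (f x))"
proof -
  have e: "endo_trace (\<lambda>x. f (g x)) =
      (\<Sum>b\<in>Basis. \<Sum>c\<in>Basis. representation Basis (g b) c * representation Basis (f c) b)"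
    if f: "Vector_Spaces.linear scale scale f" for f g
    unfolding endo_trace_def
    by (subst linear_Basis_expansion[OF f]) (simp add: representation_sum_scale finite_Basis)
  show ?thesis
    unfolding e[OF f] e[OF g]
    by (subst sum.swap) (simp add: mult.commute)
qed

lemma endo_trace_rank_one:
  assumes "\<And>x y. p (x + y) = p x + p y" "\<And>c x. p (c *s x) = c * p x"
  shows "endo_trace (\<lambda>x. p x *s v) = p v"
proof -
  have p0: "p 0 = 0" using assms(2)[of 0 0] by simp
  have ps: "p (\<Sum>b\<in>S. u b) = (\<Sum>b\<in>S. p (u b))" if "finite S" for S u
    using that by (induction S rule: finite_induct) (simp_all add: assms p0)
  have "endo_trace (\<lambda>x. p x *s v) = (\<Sum>b\<in>Basis. p (representation Basis v b *s b))"
    unfolding endo_trace_def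
    by (simp add: representation_scale[OF independent_Basis] span_Basis assms mult.commute)
  also have "\<dots> = p (\<Sum>b\<in>Basis. representation Basis v b *s b)"
    by (rule ps[OF finite_Basis, symmetric])
  finally show ?thesis by (simp add: sum_representation_Basis)
qed

text \<open>The trace is defined by one fixed basis. A diagonal operator is a sum of rank one operators, whose
  traces do not depend on any basis.\<close>

lemma endo_trace_eigenbasis:
  assumes f: "Vector_Spaces.linear scale scale f" and B: "independent B" "span B = UNIV"
    and e: "\<And>b. b \<in> B \<Longrightarrow> f b = c b *s b"
  shows "endo_trace f = (\<Sum>b\<in>B. c b)"
proof -
  interpret f: Vector_Spaces.linear scale scale f by fact
  have fin: "finite B" using B finiteI_independent by blast
  have x: "(\<Sum>b\<in>B. representation B x b *s b) = x" for x
    using B fin by (intro sum_representation_eq) auto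
  have "f x = (\<Sum>b\<in>B. representation B x b *s (c b *s b))" for x
  proof -
    have "f x = f (\<Sum>b\<in>B. representation B x b *s b)" by (simp add: x)
    also have "\<dots> = (\<Sum>b\<in>B. representation B x b *s (c b *s b))"
      by (simp add: f.sum f.scale e)
    finally show ?thesis .
  qed
  then have "endo_trace f = endo_trace (\<lambda>x. \<Sum>b\<in>B. representation B x b *s (c b *s b))"
    by presburger
  also have "\<dots> = (\<Sum>b\<in>B. endo_trace (\<lambda>x. representation B x b *s (c b *s b)))"
    by (rule endo_trace_sum[OF fin])
  also have "\<dots> = (\<Sum>b\<in>B. c b)"
  proof (rule sum.cong[OF refl])
    fix b assume b: "b \<in> B"
    have "endo_trace (\<lambda>x. representation B x b *s (c b *s b)) = representation B (c b *s b) b"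
      by (rule endo_trace_rank_one)
        (use B in \<open>simp_all add: representation_add representation_scale\<close>)
    also have "\<dots> = c b"
      using B b by (simp add: representation_scale representation_basis)
    finally show "endo_trace (\<lambda>x. representation B x b *s (c b *s b)) = c b" .
  qed
  finally show ?thesis .
qed

subsection \<open>The Killing form\<close>

lemma linear_ad_ad: "Vector_Spaces.linear scale scale (\<lambda>z. [x, [y, z]\<^sub>L]\<^sub>L)"
  by unfold_locales (simp_all add: br_add_right br_scale_right)

lemma killing_sym: "killing_form x y = killing_form y x"
  unfolding killing_form_def by (rule endo_trace_commute[OF linear_ad linear_ad])

lemma killing_add_left: "killing_form (x + y) z = killing_form x z + killing_form y z"
  unfolding killing_form_def by (simp add: br_add_left endo_trace_add)

lemma killing_scale_left: "killing_form (c *s x) z = c * killing_form x z"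
  unfolding killing_form_def by (simp add: br_scale_left endo_trace_scale)

lemma killing_add_right: "killing_form z (x + y) = killing_form z x + killing_form z y"
  by (metis killing_sym killing_add_left)

lemma killing_scale_right: "killing_form z (c *s x) = c * killing_form z x"
  by (metis killing_sym killing_scale_left)

lemma killing_zero [simp]: "killing_form 0 z = 0" "killing_form z 0 = 0"
  using killing_scale_left[of 0 0 z] killing_scale_right[of z 0 0] by simp_all

lemma killing_minus_left: "killing_form (- x) z = - killing_form x z"
  using killing_scale_left[of "-1" x z] by (simp add: scale_minus_left)

lemma killing_diff_left: "killing_form (x - y) z = killing_form x z - killing_form y z"
  using killing_add_left[of x "- y" z] by (simp add: killing_minus_left)

text \<open>Both sides expand into traces of products of three operators, two of which agree because the
  trace is invariant under cyclic permutation.\<close>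

lemma killing_invariant: "killing_form [x, y]\<^sub>L z = killing_form x [y, z]\<^sub>L"
proof -
  have 1: "[[x, y]\<^sub>L, [z, w]\<^sub>L]\<^sub>L = [x, [y, [z, w]\<^sub>L]\<^sub>L]\<^sub>L - [y, [x, [z, w]\<^sub>L]\<^sub>L]\<^sub>L" for x y z w
    using br_leibniz[of x y "[z, w]\<^sub>L"] by simp
  have 2: "[x, [[y, z]\<^sub>L, w]\<^sub>L]\<^sub>L = [x, [y, [z, w]\<^sub>L]\<^sub>L]\<^sub>L - [x, [z, [y, w]\<^sub>L]\<^sub>L]\<^sub>L" for x y z w
    using br_leibniz[of y z w] by (simp add: ad.add)
  have "endo_trace (\<lambda>w. [y, [x, [z, w]\<^sub>L]\<^sub>L]\<^sub>L) = endo_trace (\<lambda>w. [x, [z, [y, w]\<^sub>L]\<^sub>L]\<^sub>L)"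
    by (rule endo_trace_commute[OF linear_ad linear_ad_ad])
  then show ?thesis
    unfolding killing_form_def 1 2 endo_trace_diff by simp
qed

end

section \<open>Root spaces\<close>

locale simple_lie_algebra_with_base = complex_lie_algebra +
  fixes H :: "'a set" and P :: "('a \<Rightarrow> complex) set"
  assumes is_simple: "simple"
    and is_cartan: "cartan_subalgebra H"
    and is_base: "root_base H P"
begin

lemma subspace_H: "subspace H"
  and H_commute: "h \<in> H \<Longrightarrow> h' \<in> H \<Longrightarrow> [h, h']\<^sub>L = 0"
  and H_self_centralizing: "(\<And>h. h \<in> H \<Longrightarrow> [h, x]\<^sub>L = 0) \<Longrightarrow> x \<in> H"
  and H_diagonalizable: "h \<in> H \<Longrightarrow> diagonalizable (\<lambda>x. [h, x]\<^sub>L)"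
  using is_cartan unfolding cartan_subalgebra_def abelian_on_def by auto

lemmas H_closed [intro] =
  subspace_add[OF subspace_H] subspace_scale[OF subspace_H] subspace_0[OF subspace_H]
  subspace_diff[OF subspace_H] subspace_neg[OF subspace_H] subspace_sum[OF subspace_H]

subsection \<open>Linear forms on the Cartan subalgebra\<close>

lemma dual_add: "\<beta> \<in> dual_space H \<Longrightarrow> x \<in> H \<Longrightarrow> y \<in> H \<Longrightarrow> \<beta> (x + y) = \<beta> x + \<beta> y"
  and dual_scale: "\<beta> \<in> dual_space H \<Longrightarrow> x \<in> H \<Longrightarrow> \<beta> (c *s x) = c * \<beta> x"
  and dual_outside: "\<beta> \<in> dual_space H \<Longrightarrow> x \<notin> H \<Longrightarrow> \<beta> x = 0"
  unfolding dual_space_def by auto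

lemma dual_zero: "\<beta> \<in> dual_space H \<Longrightarrow> \<beta> 0 = 0"
  using dual_scale[of \<beta> 0 0] subspace_0[OF subspace_H] by simp

lemma dual_minus: "\<beta> \<in> dual_space H \<Longrightarrow> x \<in> H \<Longrightarrow> \<beta> (- x) = - \<beta> x"
  using dual_scale[of \<beta> x "-1"] by (simp add: scale_minus_left)

lemma dual_diff: "\<beta> \<in> dual_space H \<Longrightarrow> x \<in> H \<Longrightarrow> y \<in> H \<Longrightarrow> \<beta> (x - y) = \<beta> x - \<beta> y"
  using dual_add[of \<beta> x "- y"] dual_minus[of \<beta> y] subspace_neg[OF subspace_H] by simp

lemma dual_sum:
  assumes "\<beta> \<in> dual_space H" "\<And>i. i \<in> S \<Longrightarrow> g i \<in> H"
  shows "\<beta> (\<Sum>i\<in>S. g i) = (\<Sum>i\<in>S. \<beta> (g i))"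
proof (cases "finite S")
  case True
  then show ?thesis using assms(2)
    by (induction S rule: finite_induct)
      (simp_all add: dual_zero dual_add assms(1) H_closed(6))
next
  case False
  then show ?thesis using dual_zero assms(1) by simp
qed

text \<open>Linear independence only says that no combination of the forms vanishes on \<open>H\<close>; a dual basis is
  built by adding one form at a time.\<close>

lemma dual_basis_exists:
  assumes "finite Q" "Q \<subseteq> dual_space H"
    and "\<And>c :: ('a \<Rightarrow> complex) \<Rightarrow> complex. (\<forall>h\<in>H. (\<Sum>\<gamma>\<in>Q. c \<gamma> * \<gamma> h) = 0) \<Longrightarrow> \<forall>\<gamma>\<in>Q. c \<gamma> = 0"
  shows "\<exists>d. \<forall>\<gamma>\<in>Q. d \<gamma> \<in> H \<and> (\<forall>\<delta>\<in>Q. \<delta> (d \<gamma>) = (if \<delta> = \<gamma> then 1 else 0))"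
  using assms
proof (induction Q rule: finite_induct)
  case empty
  then show ?case by simp
next
  case (insert \<gamma>0 Q)
  have dQ: "\<gamma> \<in> dual_space H" if "\<gamma> \<in> Q" for \<gamma> using insert.prems(1) that by auto
  have d0: "\<gamma>0 \<in> dual_space H" using insert.prems(1) by auto
  have "\<forall>\<gamma>\<in>Q. c \<gamma> = 0" if "\<forall>h\<in>H. (\<Sum>\<gamma>\<in>Q. c \<gamma> * \<gamma> h) = 0" for c :: "('a \<Rightarrow> complex) \<Rightarrow> complex"
  proof -
    let ?c = "c(\<gamma>0 := 0)"
    have e: "(\<Sum>\<gamma>\<in>insert \<gamma>0 Q. ?c \<gamma> * \<gamma> h) = (\<Sum>\<gamma>\<in>Q. c \<gamma> * \<gamma> h)" for h
    proof -
      have "(\<Sum>\<gamma>\<in>insert \<gamma>0 Q. ?c \<gamma> * \<gamma> h) = (\<Sum>\<gamma>\<in>Q. ?c \<gamma> * \<gamma> h)"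
        using insert.hyps by simp
      also have "\<dots> = (\<Sum>\<gamma>\<in>Q. c \<gamma> * \<gamma> h)"
        using insert.hyps(2) by (intro sum.cong) auto
      finally show ?thesis .
    qed
    have "\<forall>\<gamma>\<in>insert \<gamma>0 Q. ?c \<gamma> = 0"
    proof (rule insert.prems(2))
      show "\<forall>h\<in>H. (\<Sum>\<gamma>\<in>insert \<gamma>0 Q. ?c \<gamma> * \<gamma> h) = 0"
        using that by (simp only: e)
    qed
    then show ?thesis using insert.hyps(2) by (auto split: if_splits)
  qed
  moreover have "Q \<subseteq> dual_space H" using dQ by blast
  ultimately have "\<exists>d. \<forall>\<gamma>\<in>Q. d \<gamma> \<in> H \<and> (\<forall>\<delta>\<in>Q. \<delta> (d \<gamma>) = (if \<delta> = \<gamma> then 1 else 0))"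
    by (rule insert.IH[rotated])
  then obtain d where d: "\<And>\<gamma>. \<gamma> \<in> Q \<Longrightarrow> d \<gamma> \<in> H"
    "\<And>\<gamma> \<delta>. \<gamma> \<in> Q \<Longrightarrow> \<delta> \<in> Q \<Longrightarrow> \<delta> (d \<gamma>) = (if \<delta> = \<gamma> then 1 else 0)"
    by blast
  let ?c = "\<lambda>\<gamma>. if \<gamma> = \<gamma>0 then 1 else - \<gamma>0 (d \<gamma>)"
  have "\<exists>h\<in>H. (\<Sum>\<gamma>\<in>insert \<gamma>0 Q. ?c \<gamma> * \<gamma> h) \<noteq> 0"
  proof (rule ccontr)
    assume "\<not> ?thesis"
    then have "\<forall>\<gamma>\<in>insert \<gamma>0 Q. ?c \<gamma> = 0" by (intro insert.prems(2)) blast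
    then show False by simp
  qed
  moreover have "(\<Sum>\<gamma>\<in>insert \<gamma>0 Q. ?c \<gamma> * \<gamma> h) = \<gamma>0 h - (\<Sum>\<gamma>\<in>Q. \<gamma>0 (d \<gamma>) * \<gamma> h)" for h
  proof -
    have "(\<Sum>\<gamma>\<in>Q. ?c \<gamma> * \<gamma> h) = (\<Sum>\<gamma>\<in>Q. - (\<gamma>0 (d \<gamma>) * \<gamma> h))"
      using insert.hyps by (intro sum.cong) auto
    then show ?thesis using insert.hyps by (simp add: sum_negf)
  qed
  ultimately obtain h where h: "h \<in> H" "\<gamma>0 h - (\<Sum>\<gamma>\<in>Q. \<gamma>0 (d \<gamma>) * \<gamma> h) \<noteq> 0" by auto
  \<comment> \<open>Subtracting the projection to the span of the \<open>d \<gamma>\<close> kills \<open>Q\<close> but not \<open>\<gamma>0\<close>.\<close>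
  define h' where "h' = h - (\<Sum>\<gamma>\<in>Q. \<gamma> h *s d \<gamma>)"
  have sH: "(\<Sum>\<gamma>\<in>Q. \<gamma> h *s d \<gamma>) \<in> H" using d(1) by (intro H_closed(6) H_closed(2)) auto
  have h'H: "h' \<in> H" unfolding h'_def using h(1) sH by (rule H_closed(4))
  have eval: "\<delta> h' = \<delta> h - (\<Sum>\<gamma>\<in>Q. \<gamma> h * \<delta> (d \<gamma>))" if "\<delta> \<in> dual_space H" for \<delta>
    unfolding h'_def using that h(1) sH d(1)
    by (simp add: dual_diff dual_sum dual_scale H_closed(2))
  have "\<delta> h' = 0" if "\<delta> \<in> Q" for \<delta>
  proof -
    have "(\<Sum>\<gamma>\<in>Q. \<gamma> h * \<delta> (d \<gamma>)) = (\<Sum>\<gamma>\<in>Q. if \<gamma> = \<delta> then \<gamma> h else 0)"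
      by (intro sum.cong) (auto simp: d(2)[OF _ that])
    then show ?thesis using eval[OF dQ[OF that]] insert.hyps(1) that by simp
  qed
  moreover have ne: "\<gamma>0 h' \<noteq> 0" using h(2) eval[OF d0] by (simp add: mult.commute)
  moreover define e where "e = inverse (\<gamma>0 h') *s h'"
  moreover have "e \<in> H" unfolding e_def using h'H by auto
  ultimately have e: "e \<in> H" "\<gamma>0 e = 1" "\<And>\<delta>. \<delta> \<in> Q \<Longrightarrow> \<delta> e = 0"
    using h'H d0 dQ by (simp_all add: dual_scale)
  define d' where "d' = (\<lambda>\<gamma>. if \<gamma> = \<gamma>0 then e else d \<gamma> - \<gamma>0 (d \<gamma>) *s e)"
  have "d' \<gamma> \<in> H" if "\<gamma> \<in> insert \<gamma>0 Q" for \<gamma>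
    using that d(1) e(1) by (auto simp: d'_def intro!: H_closed(4) H_closed(2))
  moreover have "\<delta> (d' \<gamma>) = (if \<delta> = \<gamma> then 1 else 0)"
    if "\<gamma> \<in> insert \<gamma>0 Q" "\<delta> \<in> insert \<gamma>0 Q" for \<gamma> \<delta>
  proof -
    have \<delta>: "\<delta> \<in> dual_space H" using that(2) insert.prems(1) by blast
    have "\<delta> (d' \<gamma>) = (if \<gamma> = \<gamma>0 then \<delta> e else \<delta> (d \<gamma>) - \<gamma>0 (d \<gamma>) * \<delta> e)"
      using that(1) d(1)[of \<gamma>] e(1) \<delta>
      by (auto simp: d'_def dual_diff dual_scale H_closed(2))
    then show ?thesis
      using that e(2) e(3)[of \<delta>] d(2)[of \<gamma> \<delta>] insert.hyps(2) by (cases "\<delta> = \<gamma>0") auto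
  qed
  ultimately show ?case by blast
qed

subsection \<open>Weight decomposition\<close>

lemma root_space_0: "root_space H 0 = H"
  using H_commute H_self_centralizing by (auto simp: root_space_def)

lemma root_spaceD: "x \<in> root_space H \<beta> \<Longrightarrow> h \<in> H \<Longrightarrow> [h, x]\<^sub>L = \<beta> h *s x"
  by (simp add: root_space_def)

lemma root_spaceD2: "x \<in> root_space H \<beta> \<Longrightarrow> h \<in> H \<Longrightarrow> [x, h]\<^sub>L = - (\<beta> h *s x)"
  using br_antisym[of x h] by (simp add: root_space_def)

lemma subspace_root_space: "subspace (root_space H \<beta>)"
  by (auto simp: subspace_def root_space_def ad.add ad.zero ad.scale scale_right_distrib mult.commute)

lemma root_space_br:
  assumes "x \<in> root_space H \<beta>" "y \<in> root_space H \<gamma>"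
  shows "[x, y]\<^sub>L \<in> root_space H (\<beta> + \<gamma>)"
  using assms
  by (auto simp: root_space_def br_leibniz[of _ x y] br_scale_left br_scale_right
      scale_left_distrib plus_fun_apply)

lemma eigen_decomposition:
  assumes "h \<in> H"
  obtains L where "finite L"
    "\<And>x. \<exists>y. x = (\<Sum>c\<in>L. y c) \<and> (\<forall>c\<in>L. [h, y c]\<^sub>L = c *s y c)"
proof -
  obtain B where B: "independent B" "span B = UNIV" "\<forall>b\<in>B. \<exists>c. [h, b]\<^sub>L = c *s b"
    using H_diagonalizable[OF assms] unfolding diagonalizable_def by blast
  then obtain k where k: "\<And>b. b \<in> B \<Longrightarrow> [h, b]\<^sub>L = k b *s b" by metis
  have fin: "finite B" using B finiteI_independent by blast
  show thesis
  proof (rule that[of "k ` B"])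
    show "finite (k ` B)" using fin by simp
    fix x
    let ?y = "\<lambda>c. \<Sum>b | b \<in> B \<and> k b = c. representation B x b *s b"
    have "x = (\<Sum>b\<in>B. representation B x b *s b)"
      using B fin by (intro sum_representation_eq[symmetric]) auto
    then have "x = (\<Sum>c\<in>k ` B. ?y c)"
      using sum.image_gen[OF fin, of "\<lambda>b. representation B x b *s b" k] by simp
    moreover have "[h, ?y c]\<^sub>L = c *s ?y c" for c
      by (auto simp: ad.sum ad.scale k scale_sum_right mult.commute intro!: sum.cong)
    ultimately show "\<exists>y. x = (\<Sum>c\<in>k ` B. y c) \<and> (\<forall>c\<in>k ` B. [h, y c]\<^sub>L = c *s y c)"
      by blast
  qed
qed

lemma finite_eigenvalues:
  assumes "h \<in> H"
  shows "finite {c. \<exists>v. v \<noteq> 0 \<and> [h, v]\<^sub>L = c *s v}"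
proof -
  obtain L where L: "finite L"
    "\<And>x. \<exists>y. x = (\<Sum>c\<in>L. y c) \<and> (\<forall>c\<in>L. [h, y c]\<^sub>L = c *s y c)"
    using eigen_decomposition[OF assms] by blast
  have "c \<in> L" if v: "v \<noteq> 0" "[h, v]\<^sub>L = c *s v" for c v
  proof (rule ccontr)
    assume c: "c \<notin> L"
    obtain y where y: "v = (\<Sum>c\<in>L. y c)" "\<forall>c\<in>L. [h, y c]\<^sub>L = c *s y c" using L(2) by blast
    let ?y = "y(c := - v)"
    have "(\<Sum>d\<in>L. ?y d) = (\<Sum>d\<in>L. y d)" using c by (intro sum.cong) auto
    then have "(\<Sum>d\<in>insert c L. ?y d) = 0" using c L(1) y(1) by simp
    moreover have "[h, ?y d]\<^sub>L = d *s ?y d" if "d \<in> insert c L" for d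
      using that y(2) v(2) by (auto simp: ad.neg)
    ultimately have "\<forall>d\<in>insert c L. ?y d = 0"
      using L(1) by (intro eigenvectors_sum_zero[OF linear_ad[of h]]) auto
    then show False using v(1) by simp
  qed
  then have "{c. \<exists>v. v \<noteq> 0 \<and> [h, v]\<^sub>L = c *s v} \<subseteq> L" by auto
  then show ?thesis using L(1) finite_subset by blast
qed

text \<open>If \<open>x\<close> is an eigenvector of \<open>ad g\<close>, so are its components with respect to a commuting \<open>ad h\<close>: the
  failure of \<open>ad g\<close> to scale each component correctly is a relation between eigenvectors of \<open>ad h\<close>
  to different eigenvalues. This allows to treat the elements of a finite set one by one.\<close>

lemma span_joint_eigenvectors:
  assumes "finite F" "F \<subseteq> H"
  shows "span {x. \<forall>h\<in>F. \<exists>c. [h, x]\<^sub>L = c *s x} = UNIV"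
  using assms
proof (induction F rule: finite_induct)
  case empty
  then show ?case by simp
next
  case (insert h F)
  let ?V = "\<lambda>F. {x. \<forall>h\<in>F. \<exists>c. [h, x]\<^sub>L = c *s x}"
  obtain L where L: "finite L"
    "\<And>x. \<exists>y. x = (\<Sum>c\<in>L. y c) \<and> (\<forall>c\<in>L. [h, y c]\<^sub>L = c *s y c)"
    using eigen_decomposition[of h] insert.prems by blast
  have "x \<in> span (?V (insert h F))" if x: "x \<in> ?V F" for x
  proof -
    obtain y where y: "x = (\<Sum>c\<in>L. y c)" "\<And>c. c \<in> L \<Longrightarrow> [h, y c]\<^sub>L = c *s y c"
      using L(2)[of x] by blast
    have "\<exists>m. [g, y c]\<^sub>L = m *s y c" if g: "g \<in> F" and c: "c \<in> L" for g c
    proof -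
      obtain m where m: "[g, x]\<^sub>L = m *s x" using x g by blast
      let ?z = "\<lambda>c. [g, y c]\<^sub>L - m *s y c"
      have "[h, ?z d]\<^sub>L = d *s ?z d" if "d \<in> L" for d
      proof -
        have "[h, [g, y d]\<^sub>L]\<^sub>L = d *s [g, y d]\<^sub>L"
          using br_leibniz[of h g "y d"] H_commute[of h g] insert.prems g y(2)[OF that]
          by (auto simp: adl.zero ad.scale)
        then show ?thesis
          using y(2)[OF that]
          by (simp add: ad.diff ad.scale scale_right_diff_distrib mult.commute)
      qed
      moreover have "(\<Sum>c\<in>L. ?z c) = 0"
        using m y(1) by (simp add: sum_subtractf ad.sum scale_sum_right)
      ultimately have "\<forall>c\<in>L. ?z c = 0"
        using L(1) by (intro eigenvectors_sum_zero[OF linear_ad[of h]])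
      then show ?thesis using c by auto
    qed
    then have "y c \<in> ?V (insert h F)" if "c \<in> L" for c using that y(2) by auto
    then show ?thesis unfolding y(1) by (intro span_sum span_base)
  qed
  then have "span (?V F) \<subseteq> span (?V (insert h F))"
    by (intro span_minimal subspace_span) auto
  then show ?case using insert by auto
qed

text \<open>An eigenvalue depends linearly on the operator as long as the eigenvector is nonzero.\<close>

lemma joint_eigenvector_weight:
  assumes "\<forall>h\<in>H. \<exists>c. [h, x]\<^sub>L = c *s x"
  shows "\<exists>\<mu>\<in>dual_space H. x \<in> root_space H \<mu>"
proof (cases "x = 0")
  case True
  have "0 \<in> dual_space H" by (simp add: dual_space_def)
  then show ?thesis using True subspace_0[OF subspace_root_space] by blast
next
  case False
  obtain m where m: "\<And>h. h \<in> H \<Longrightarrow> [h, x]\<^sub>L = m h *s x" using assms by metis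
  let ?m = "\<lambda>h. if h \<in> H then m h else 0"
  have "m (h + h') = m h + m h'" if "h \<in> H" "h' \<in> H" for h h'
  proof -
    have "m (h + h') *s x = (m h + m h') *s x"
      using m[of h] m[of h'] m[of "h + h'"] that
      by (simp add: H_closed(1) br_add_left scale_left_distrib)
    then show ?thesis using False by (simp only: scale_cancel_right) simp
  qed
  moreover have "m (c *s h) = c * m h" if "h \<in> H" for h c
  proof -
    have "m (c *s h) *s x = (c * m h) *s x"
      using m[of h] m[of "c *s h", symmetric] that by (simp add: H_closed(2) br_scale_left)
    then show ?thesis using False by (simp only: scale_cancel_right) simp
  qed
  ultimately have "?m \<in> dual_space H"
    by (auto simp: dual_space_def H_closed(1,2))
  moreover have "x \<in> root_space H ?m" using m by (simp add: root_space_def)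
  ultimately show ?thesis by blast
qed

definition weight_vectors :: "'a set" where
  "weight_vectors = H \<union> (\<Union>\<beta>\<in>roots H. root_space H \<beta>)"

lemma span_weight_vectors: "span weight_vectors = UNIV"
proof -
  obtain F where F: "F \<subseteq> H" "independent F" "H \<subseteq> span F"
    using maximal_independent_subset by blast
  have "x \<in> weight_vectors" if x: "\<forall>h\<in>F. \<exists>c. [h, x]\<^sub>L = c *s x" for x
  proof -
    have "subspace {h. \<exists>c. [h, x]\<^sub>L = c *s x}"
    proof (rule subspaceI)
      show "0 \<in> {h. \<exists>c. [h, x]\<^sub>L = c *s x}" by (auto simp: adl.zero intro: exI[of _ 0])
    next
      fix u v assume "u \<in> {h. \<exists>c. [h, x]\<^sub>L = c *s x}" "v \<in> {h. \<exists>c. [h, x]\<^sub>L = c *s x}"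
      then obtain a b where "[u, x]\<^sub>L = a *s x" "[v, x]\<^sub>L = b *s x" by blast
      then have "[u + v, x]\<^sub>L = (a + b) *s x" by (simp add: br_add_left scale_left_distrib)
      then show "u + v \<in> {h. \<exists>c. [h, x]\<^sub>L = c *s x}" by blast
    next
      fix k u assume "u \<in> {h. \<exists>c. [h, x]\<^sub>L = c *s x}"
      then obtain a where "[u, x]\<^sub>L = a *s x" by blast
      then have "[k *s u, x]\<^sub>L = (k * a) *s x" by (simp add: br_scale_left)
      then show "k *s u \<in> {h. \<exists>c. [h, x]\<^sub>L = c *s x}" by blast
    qed
    then have "span F \<subseteq> {h. \<exists>c. [h, x]\<^sub>L = c *s x}"
      using x by (intro span_minimal) auto
    then have "\<forall>h\<in>H. \<exists>c. [h, x]\<^sub>L = c *s x" using F(3) by auto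
    then obtain \<mu> where \<mu>: "\<mu> \<in> dual_space H" "x \<in> root_space H \<mu>"
      using joint_eigenvector_weight by blast
    show ?thesis
    proof (cases "\<mu> = 0 \<or> x = 0")
      case True
      then show ?thesis
        using \<mu>(2) root_space_0 subspace_0[OF subspace_H] by (auto simp: weight_vectors_def)
    next
      case False
      then have "\<mu> \<in> roots H" using \<mu> by (auto simp: roots_def)
      then show ?thesis using \<mu>(2) by (auto simp: weight_vectors_def)
    qed
  qed
  then have "{x. \<forall>h\<in>F. \<exists>c. [h, x]\<^sub>L = c *s x} \<subseteq> weight_vectors" by blast
  then have "span {x. \<forall>h\<in>F. \<exists>c. [h, x]\<^sub>L = c *s x} \<subseteq> span weight_vectors"
    by (rule span_mono)
  moreover have "span {x. \<forall>h\<in>F. \<exists>c. [h, x]\<^sub>L = c *s x} = UNIV"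
    by (rule span_joint_eigenvectors[OF finiteI_independent[OF F(2)] F(1)])
  ultimately show ?thesis by auto
qed

lemma weight_vector_induct [consumes 0, case_names subspace H root]:
  assumes "subspace {x. Q x}" "\<And>h. h \<in> H \<Longrightarrow> Q h"
    "\<And>\<beta> x. \<beta> \<in> roots H \<Longrightarrow> x \<in> root_space H \<beta> \<Longrightarrow> Q x"
  shows "Q x"
proof -
  have "span weight_vectors \<subseteq> {x. Q x}"
    using assms by (intro span_minimal) (auto simp: weight_vectors_def)
  then show ?thesis by (auto simp: span_weight_vectors)
qed

lemma roots_dual: "\<beta> \<in> roots H \<Longrightarrow> \<beta> \<in> dual_space H"
  by (simp add: roots_def)

lemma roots_nonzero: "\<beta> \<in> roots H \<Longrightarrow> \<exists>h\<in>H. \<beta> h \<noteq> 0"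
  using dual_outside[of \<beta>] by (fastforce simp: roots_def)

lemma root_space_nontrivial:
  assumes "\<beta> \<in> roots H"
  obtains x where "x \<in> root_space H \<beta>" "x \<noteq> 0"
  using assms subspace_0[OF subspace_root_space[of \<beta>]] unfolding roots_def by auto

subsection \<open>The base and the nondegeneracy of the Killing form\<close>

lemma finite_P: "finite P"
  and P_roots: "P \<subseteq> roots H"
  using is_base unfolding root_base_def by blast+

lemma P_independent: "(\<lambda>x. \<Sum>\<gamma>\<in>P. c \<gamma> * \<gamma> x) = 0 \<Longrightarrow> \<gamma> \<in> P \<Longrightarrow> c \<gamma> = 0"
  using is_base[unfolded root_base_def, THEN conjunct2, THEN conjunct2, THEN conjunct1]
  by (elim allE[of _ c]) blast

lemma P_base: "\<beta> \<in> roots H \<Longrightarrow> \<exists>n :: ('a \<Rightarrow> complex) \<Rightarrow> nat.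
       \<beta> = (\<lambda>x. \<Sum>\<gamma>\<in>P. of_nat (n \<gamma>) * \<gamma> x) \<or> \<beta> = - (\<lambda>x. \<Sum>\<gamma>\<in>P. of_nat (n \<gamma>) * \<gamma> x)"
  by (rule is_base[unfolded root_base_def, THEN conjunct2, THEN conjunct2, THEN conjunct2, THEN bspec])

lemma prescribe_base_values:
  fixes f :: "('a \<Rightarrow> complex) \<Rightarrow> complex"
  obtains h where "h \<in> H" "\<And>\<gamma>. \<gamma> \<in> P \<Longrightarrow> \<gamma> h = f \<gamma>"
proof -
  have PD: "P \<subseteq> dual_space H" using P_roots roots_dual by auto
  have "\<forall>\<gamma>\<in>P. c \<gamma> = 0" if "\<forall>h\<in>H. (\<Sum>\<gamma>\<in>P. c \<gamma> * \<gamma> h) = 0"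
    for c :: "('a \<Rightarrow> complex) \<Rightarrow> complex"
  proof -
    have "(\<Sum>\<gamma>\<in>P. c \<gamma> * \<gamma> h) = 0" for h
    proof (cases "h \<in> H")
      case False
      then show ?thesis using dual_outside PD by (intro sum.neutral) auto
    qed (use that in blast)
    then have "(\<lambda>h. \<Sum>\<gamma>\<in>P. c \<gamma> * \<gamma> h) = 0" by (simp add: fun_eq_iff)
    then show ?thesis using P_independent by blast
  qed
  from dual_basis_exists[OF finite_P PD this] obtain d where
    d: "\<And>\<gamma>. \<gamma> \<in> P \<Longrightarrow> d \<gamma> \<in> H"
      "\<And>\<gamma> \<delta>. \<gamma> \<in> P \<Longrightarrow> \<delta> \<in> P \<Longrightarrow> \<delta> (d \<gamma>) = (if \<delta> = \<gamma> then 1 else 0)"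
    by blast
  show thesis
  proof
    show "(\<Sum>\<gamma>\<in>P. f \<gamma> *s d \<gamma>) \<in> H" using d(1) by (intro H_closed(6) H_closed(2))
    fix \<delta> assume \<delta>: "\<delta> \<in> P"
    have "\<delta> (\<Sum>\<gamma>\<in>P. f \<gamma> *s d \<gamma>) = (\<Sum>\<gamma>\<in>P. f \<gamma> * \<delta> (d \<gamma>))"
      using d(1) PD \<delta> by (simp add: dual_sum dual_scale subset_iff H_closed(2))
    also have "\<dots> = (\<Sum>\<gamma>\<in>P. if \<gamma> = \<delta> then f \<gamma> else 0)"
      by (intro sum.cong) (auto simp: d(2)[OF _ \<delta>])
    finally show "\<delta> (\<Sum>\<gamma>\<in>P. f \<gamma> *s d \<gamma>) = f \<delta>" using \<delta> finite_P by simp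
  qed
qed

definition height_element :: 'a where
  "height_element = (SOME h. h \<in> H \<and> (\<forall>\<gamma>\<in>P. \<gamma> h = 1))"

lemma height_element: "height_element \<in> H" "\<And>\<gamma>. \<gamma> \<in> P \<Longrightarrow> \<gamma> height_element = 1"
proof -
  have "\<exists>h. h \<in> H \<and> (\<forall>\<gamma>\<in>P. \<gamma> h = 1)"
    by (rule prescribe_base_values[of "\<lambda>_. 1"]) blast
  then have *: "height_element \<in> H \<and> (\<forall>\<gamma>\<in>P. \<gamma> height_element = 1)"
    unfolding height_element_def by (rule someI_ex)
  show "height_element \<in> H" using * by (rule conjunct1)
  show "\<gamma> height_element = 1" if "\<gamma> \<in> P" for \<gamma> using *[THEN conjunct2] that by (rule bspec)
qed

lemma root_height_integer:
  assumes "\<beta> \<in> roots H"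
  obtains m :: int where "\<beta> height_element = of_int m" "m \<noteq> 0"
proof -
  obtain n :: "('a \<Rightarrow> complex) \<Rightarrow> nat" where
    n: "\<beta> = (\<lambda>x. \<Sum>\<gamma>\<in>P. of_nat (n \<gamma>) * \<gamma> x) \<or> \<beta> = - (\<lambda>x. \<Sum>\<gamma>\<in>P. of_nat (n \<gamma>) * \<gamma> x)"
    using P_base[OF assms] by blast
  let ?s = "\<Sum>\<gamma>\<in>P. n \<gamma>"
  have s: "(\<Sum>\<gamma>\<in>P. of_nat (n \<gamma>) * \<gamma> height_element) = of_nat ?s"
    by (simp add: height_element(2))
  have "?s \<noteq> 0"
  proof
    assume "?s = 0"
    then have "\<forall>\<gamma>\<in>P. n \<gamma> = 0" using finite_P by simp
    then have "\<beta> = 0" using n by (auto simp: fun_eq_iff)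
    then show False using assms by (simp add: roots_def)
  qed
  from n show thesis
  proof
    assume "\<beta> = (\<lambda>x. \<Sum>\<gamma>\<in>P. of_nat (n \<gamma>) * \<gamma> x)"
    then show thesis using that[of "int ?s"] s \<open>?s \<noteq> 0\<close> by (simp del: of_nat_sum sum_eq_0_iff)
  next
    assume "\<beta> = - (\<lambda>x. \<Sum>\<gamma>\<in>P. of_nat (n \<gamma>) * \<gamma> x)"
    then show thesis using that[of "- int ?s"] s \<open>?s \<noteq> 0\<close> by (simp del: of_nat_sum sum_eq_0_iff)
  qed
qed

text \<open>This replaces Cartan's criterion: the eigenvalues of the height element are integers, so that their
  squares cannot cancel, and they cannot all vanish because \<open>H\<close> is not the whole algebra.\<close>

lemma killing_height_element: "killing_form height_element height_element \<noteq> 0"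
proof
  assume zero: "killing_form height_element height_element = 0"
  let ?h = height_element
  obtain B where B: "B \<subseteq> weight_vectors" "independent B" "weight_vectors \<subseteq> span B"
    using maximal_independent_subset by blast
  have spanB: "span B = UNIV"
    using span_minimal[OF B(3) subspace_span] span_weight_vectors by auto
  have "\<exists>m::int. [?h, b]\<^sub>L = of_int m *s b \<and> (m = 0 \<longrightarrow> b \<in> H)" if b: "b \<in> B" for b
  proof (cases "b \<in> H")
    case True
    then show ?thesis using H_commute[OF height_element(1)] by (auto intro: exI[of _ 0])
  next
    case False
    then obtain \<beta> where \<beta>: "\<beta> \<in> roots H" "b \<in> root_space H \<beta>"
      using b B(1) unfolding weight_vectors_def by blast
    obtain m :: int where "\<beta> ?h = of_int m" "m \<noteq> 0" using root_height_integer[OF \<beta>(1)] .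
    then show ?thesis using root_spaceD[OF \<beta>(2) height_element(1)] by auto
  qed
  then obtain m :: "'a \<Rightarrow> int" where
    m: "\<And>b. b \<in> B \<Longrightarrow> [?h, b]\<^sub>L = of_int (m b) *s b" "\<And>b. b \<in> B \<Longrightarrow> m b = 0 \<Longrightarrow> b \<in> H"
    by metis
  have "killing_form ?h ?h = (\<Sum>b\<in>B. of_int (m b) * of_int (m b))"
    unfolding killing_form_def
    by (rule endo_trace_eigenbasis[OF linear_ad_ad B(2) spanB]) (simp add: m(1) ad.scale)
  also have "\<dots> = of_int (\<Sum>b\<in>B. m b * m b)" by simp
  finally have "(\<Sum>b\<in>B. m b * m b) = 0"
    unfolding zero by (metis of_int_eq_0_iff)
  then have "\<forall>b\<in>B. m b * m b = 0"
    using sum_nonneg_eq_0_iff[OF finiteI_independent[OF B(2)], of "\<lambda>b. m b * m b"] by simp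
  then have "B \<subseteq> H" using m(2) by auto
  then have "span B \<subseteq> H" by (rule span_minimal[OF _ subspace_H])
  then have "H = UNIV" using spanB by auto
  then have "abelian_on UNIV" using H_commute by (simp add: abelian_on_def)
  then show False using is_simple by (simp add: simple_def)
qed

text \<open>The radical is an ideal, and it is not everything by the preceding computation.\<close>

lemma killing_nondegenerate:
  assumes "\<And>y. killing_form x y = 0"
  shows "x = 0"
proof -
  let ?J = "{x. \<forall>y. killing_form x y = 0}"
  have "lie_ideal ?J"
    unfolding lie_ideal_def
  proof (intro conjI allI ballI)
    show "subspace ?J" by (rule subspaceI) (auto simp: killing_add_left killing_scale_left)
    fix x y assume "y \<in> ?J"
    then have "killing_form [y, x]\<^sub>L z = 0" for z by (simp add: killing_invariant)
    then show "[x, y]\<^sub>L \<in> ?J" using br_antisym[of x y] by (simp add: killing_minus_left)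
  qed
  then have "?J = {0} \<or> ?J = UNIV" using is_simple by (simp add: simple_def)
  then show ?thesis using killing_height_element assms by blast
qed

lemma killing_root_spaces:
  assumes x: "x \<in> root_space H \<beta>" and y: "y \<in> root_space H \<gamma>"
    and h: "h \<in> H" "\<beta> h + \<gamma> h \<noteq> 0"
  shows "killing_form x y = 0"
proof -
  have "killing_form [x, h]\<^sub>L y = killing_form x [h, y]\<^sub>L" by (rule killing_invariant)
  then have "- (\<beta> h * killing_form x y) = \<gamma> h * killing_form x y"
    using root_spaceD2[OF x h(1)] root_spaceD[OF y h(1)]
    by (simp add: killing_minus_left killing_scale_left killing_scale_right)
  then have "(\<beta> h + \<gamma> h) * killing_form x y = 0" by algebra
  then show ?thesis using h(2) by simp
qed

lemma killing_nondegenerate_H: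
  assumes "h \<in> H" "\<And>h'. h' \<in> H \<Longrightarrow> killing_form h h' = 0"
  shows "h = 0"
proof (rule killing_nondegenerate)
  fix y
  show "killing_form h y = 0"
  proof (induction rule: weight_vector_induct)
    case subspace
    then show ?case by (rule subspaceI) (auto simp: killing_add_right killing_scale_right)
  next
    case (H h)
    then show ?case using assms by blast
  next
    case (root \<beta> x)
    obtain h' where "h' \<in> H" "\<beta> h' \<noteq> 0" using roots_nonzero[OF root(1)] by blast
    then show ?case
      using killing_root_spaces[of h 0 x \<beta> h'] root assms(1) root_space_0 by simp
  qed
qed

text \<open>A root vector is orthogonal to all weight spaces except the opposite one.\<close>

lemma root_pairing:
  assumes "\<beta> \<in> roots H" "x \<in> root_space H \<beta>" "x \<noteq> 0"
  obtains y where "y \<in> root_space H (- \<beta>)" "killing_form x y = 1"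
proof -
  have "\<exists>y\<in>root_space H (- \<beta>). killing_form x y \<noteq> 0"
  proof (rule ccontr)
    assume none: "\<not> ?thesis"
    have "killing_form x y = 0" for y
    proof (induction rule: weight_vector_induct)
      case subspace
      then show ?case by (rule subspaceI) (auto simp: killing_add_right killing_scale_right)
    next
      case (H h)
      obtain h' where "h' \<in> H" "\<beta> h' \<noteq> 0" using roots_nonzero[OF assms(1)] by blast
      then show ?case
        using killing_root_spaces[of x \<beta> h 0 h'] H assms(2) root_space_0 by simp
    next
      case (root \<gamma> y)
      show ?case
      proof (cases "\<gamma> = - \<beta>")
        case True
        then show ?thesis using none root(2) by blast
      next
        case False
        then obtain h where h: "\<gamma> h \<noteq> - \<beta> h" by (auto simp: fun_eq_iff)
        have "h \<in> H"
        proof (rule ccontr)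
          assume "h \<notin> H"
          then have "\<beta> h = 0" "\<gamma> h = 0"
            using dual_outside roots_dual assms(1) root(1) by blast+
          then show False using h by simp
        qed
        moreover have "\<beta> h + \<gamma> h \<noteq> 0" using h by (simp add: add_eq_0_iff)
        ultimately show ?thesis using killing_root_spaces assms(2) root(2) by blast
      qed
    qed
    then show False using killing_nondegenerate assms(3) by blast
  qed
  then obtain y where y: "y \<in> root_space H (- \<beta>)" "killing_form x y \<noteq> 0" by blast
  have "inverse (killing_form x y) *s y \<in> root_space H (- \<beta>)"
    using y(1) subspace_scale[OF subspace_root_space] by blast
  moreover have "killing_form x (inverse (killing_form x y) *s y) = 1"
    using y(2) by (simp add: killing_scale_right)
  ultimately show thesis using that by blast
qed

lemma dual_neg: "\<beta> \<in> dual_space H \<Longrightarrow> - \<beta> \<in> dual_space H"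
  by (auto simp: dual_space_def)

lemma roots_neg: "\<beta> \<in> roots H \<Longrightarrow> - \<beta> \<in> roots H"
proof -
  assume \<beta>: "\<beta> \<in> roots H"
  obtain x where x: "x \<in> root_space H \<beta>" "x \<noteq> 0" using root_space_nontrivial[OF \<beta>] .
  obtain y where y: "y \<in> root_space H (- \<beta>)" "killing_form x y = 1"
    using root_pairing[OF \<beta> x] .
  then have "y \<noteq> 0" by auto
  then show ?thesis using y(1) \<beta> dual_neg by (auto simp: roots_def)
qed

lemma br_opposite:
  assumes "x \<in> root_space H \<beta>" "y \<in> root_space H (- \<beta>)"
  shows "[x, y]\<^sub>L \<in> H" and "h \<in> H \<Longrightarrow> killing_form [x, y]\<^sub>L h = \<beta> h * killing_form x y"
proof -
  show "[x, y]\<^sub>L \<in> H" using root_space_br[OF assms] root_space_0 by simp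
  assume h: "h \<in> H"
  have "[y, h]\<^sub>L = \<beta> h *s y" using root_spaceD2[OF assms(2) h] by simp
  then show "killing_form [x, y]\<^sub>L h = \<beta> h * killing_form x y"
    by (simp add: killing_invariant killing_scale_right)
qed

text \<open>The existence half of the Riesz representation of a root is explicit: a
  normalized bracket of opposite root vectors represents it.\<close>

lemma riesz_root:
  assumes "\<beta> \<in> roots H" "x \<in> root_space H \<beta>" "y \<in> root_space H (- \<beta>)" "killing_form x y = 1"
  shows "riesz H \<beta> = [x, y]\<^sub>L"
  unfolding riesz_def
proof (rule the_equality)
  show "[x, y]\<^sub>L \<in> H \<and> (\<forall>h\<in>H. killing_form [x, y]\<^sub>L h = \<beta> h)"
    using br_opposite[OF assms(2,3)] assms(4) by simp
  fix t assume t: "t \<in> H \<and> (\<forall>h\<in>H. killing_form t h = \<beta> h)"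
  have "t - [x, y]\<^sub>L = 0"
  proof (rule killing_nondegenerate_H)
    show "t - [x, y]\<^sub>L \<in> H" using t br_opposite(1)[OF assms(2,3)] by auto
    show "killing_form (t - [x, y]\<^sub>L) h = 0" if "h \<in> H" for h
      using t that br_opposite(2)[OF assms(2,3) that] assms(4) by (simp add: killing_diff_left)
  qed
  then show "t = [x, y]\<^sub>L" by simp
qed

lemma riesz_props:
  assumes "\<beta> \<in> roots H"
  shows "riesz H \<beta> \<in> H" and "h \<in> H \<Longrightarrow> killing_form (riesz H \<beta>) h = \<beta> h"
proof -
  obtain x where x: "x \<in> root_space H \<beta>" "x \<noteq> 0" using root_space_nontrivial[OF assms] .
  obtain y where y: "y \<in> root_space H (- \<beta>)" "killing_form x y = 1"
    using root_pairing[OF assms x] .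
  show "riesz H \<beta> \<in> H" "h \<in> H \<Longrightarrow> killing_form (riesz H \<beta>) h = \<beta> h"
    using br_opposite[OF x(1) y(1)] y(2) riesz_root[OF assms x(1) y] by simp_all
qed

lemma root_form_eq:
  assumes "\<beta> \<in> roots H" "\<gamma> \<in> roots H"
  shows "root_form H \<beta> \<gamma> = \<beta> (riesz H \<gamma>)"
  using riesz_props[OF assms(1)] riesz_props(1)[OF assms(2)] by (simp add: root_form_def)

lemma root_form_sym: "root_form H \<beta> \<gamma> = root_form H \<gamma> \<beta>"
  by (simp add: root_form_def killing_sym)

end

section \<open>Primitive vectors and root strings\<close>

context simple_lie_algebra_with_base
begin

definition ray :: "('a \<Rightarrow> complex) \<Rightarrow> ('a \<Rightarrow> complex) \<Rightarrow> int \<Rightarrow> 'a \<Rightarrow> complex" where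
  "ray \<mu> \<alpha> k = (\<lambda>h. \<mu> h + of_int k * \<alpha> h)"

lemma ray_0 [simp]: "ray \<mu> \<alpha> 0 = \<mu>"
  by (simp add: ray_def)

lemma ray_add: "\<alpha> + ray \<mu> \<alpha> k = ray \<mu> \<alpha> (k + 1)"
  by (simp add: ray_def fun_eq_iff algebra_simps)

lemma ray_sub: "- \<alpha> + ray \<mu> \<alpha> k = ray \<mu> \<alpha> (k - 1)"
  by (simp add: ray_def fun_eq_iff algebra_simps)

lemma ray_ray: "ray (ray \<mu> \<alpha> j) \<alpha> k = ray \<mu> \<alpha> (j + k)"
  by (simp add: ray_def fun_eq_iff algebra_simps)

lemma ray_neg: "ray \<mu> (- \<alpha>) k = ray \<mu> \<alpha> (- k)"
  by (simp add: ray_def fun_eq_iff)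

lemma ray_1: "ray \<mu> \<alpha> 1 = \<mu> + \<alpha>"
  by (simp add: ray_def fun_eq_iff)

lemma ray_minus_1: "ray \<mu> \<alpha> (- 1) = \<mu> - \<alpha>"
  by (simp add: ray_def fun_eq_iff)

lemma ray_dual: "\<mu> \<in> dual_space H \<Longrightarrow> \<alpha> \<in> dual_space H \<Longrightarrow> ray \<mu> \<alpha> k \<in> dual_space H"
  by (auto simp: ray_def dual_space_def algebra_simps)

lemma finite_ray:
  assumes "\<alpha> \<in> roots H"
  shows "finite {k. root_space H (ray \<mu> \<alpha> k) \<noteq> {0}}"
proof -
  obtain h where h: "h \<in> H" "\<alpha> h \<noteq> 0" using roots_nonzero[OF assms] by blast
  let ?K = "{k. root_space H (ray \<mu> \<alpha> k) \<noteq> {0}}"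
  have "ray \<mu> \<alpha> k h \<in> {c. \<exists>v. v \<noteq> 0 \<and> [h, v]\<^sub>L = c *s v}" if k: "k \<in> ?K" for k
  proof -
    have "\<exists>v\<in>root_space H (ray \<mu> \<alpha> k). v \<noteq> 0"
      using k subspace_0[OF subspace_root_space[of "ray \<mu> \<alpha> k"]] by auto
    then show ?thesis using root_spaceD h(1) by blast
  qed
  then have "(\<lambda>k. ray \<mu> \<alpha> k h) ` ?K \<subseteq> {c. \<exists>v. v \<noteq> 0 \<and> [h, v]\<^sub>L = c *s v}" by blast
  then have "finite ((\<lambda>k. ray \<mu> \<alpha> k h) ` ?K)"
    using finite_eigenvalues[OF h(1)] by (rule finite_subset)
  moreover have "inj_on (\<lambda>k. ray \<mu> \<alpha> k h) ?K"
    using h(2) by (auto simp: inj_on_def ray_def)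
  ultimately show ?thesis by (rule finite_imageD)
qed

lemma ray_eventually_trivial:
  assumes "\<alpha> \<in> roots H"
  shows "\<exists>n::nat. root_space H (ray \<mu> \<alpha> (int n)) = {0}"
    and "\<exists>n::nat. root_space H (ray \<mu> \<alpha> (- int n)) = {0}"
proof -
  have K: "finite {k. root_space H (ray \<mu> \<alpha> k) \<noteq> {0}}" by (rule finite_ray[OF assms])
  have "\<not> range int \<subseteq> {k. root_space H (ray \<mu> \<alpha> k) \<noteq> {0}}"
    using K finite_subset[of "range int"] by (auto simp: finite_image_iff)
  then show "\<exists>n::nat. root_space H (ray \<mu> \<alpha> (int n)) = {0}" by auto
  have "infinite (range (\<lambda>n. - int n))"
    by (simp add: finite_image_iff inj_on_def)
  then have "\<not> range (\<lambda>n. - int n) \<subseteq> {k. root_space H (ray \<mu> \<alpha> k) \<noteq> {0}}"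
    using K finite_subset by blast
  then show "\<exists>n::nat. root_space H (ray \<mu> \<alpha> (- int n)) = {0}" by auto
qed

lemma ad_power_weight:
  assumes "x \<in> root_space H \<alpha>" "v \<in> root_space H \<mu>"
  shows "((\<lambda>z. [x, z]\<^sub>L) ^^ k) v \<in> root_space H (ray \<mu> \<alpha> (int k))"
proof (induction k)
  case 0
  then show ?case using assms(2) by simp
next
  case (Suc k)
  then show ?case using root_space_br[OF assms(1) Suc.IH] by (simp add: ray_add add.commute)
qed

lemma climb:
  assumes \<alpha>: "\<alpha> \<in> roots H" and x: "x \<in> root_space H \<alpha>"
    and v: "v \<in> root_space H \<mu>" "v \<noteq> 0"
  obtains k :: nat where "((\<lambda>z. [x, z]\<^sub>L) ^^ Suc k) v = 0"
    "\<And>j. j \<le> k \<Longrightarrow> ((\<lambda>z. [x, z]\<^sub>L) ^^ j) v \<noteq> 0"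
proof -
  let ?w = "\<lambda>k. ((\<lambda>z. [x, z]\<^sub>L) ^^ k) v"
  obtain n where "root_space H (ray \<mu> \<alpha> (int n)) = {0}"
    using ray_eventually_trivial(1)[OF \<alpha>] by blast
  then have n: "?w n = 0" using ad_power_weight[OF x v(1), of n] by simp
  define m where "m = (LEAST k. ?w k = 0)"
  have m: "?w m = 0" unfolding m_def using n by (rule LeastI)
  have less: "?w k \<noteq> 0" if "k < m" for k using that not_less_Least unfolding m_def by blast
  have "m \<noteq> 0" using m v(2) by (metis funpow_0)
  then obtain k where "m = Suc k" using not0_implies_Suc by blast
  then show thesis using that[of k] m less by simp
qed

text \<open>The representation theory of \<open>sl\<^sub>2\<close> in the form used below: pushing a primitive vector
  down by \<open>y\<close>, the operator \<open>ad x\<close> multiplies by explicit scalars on the way back, and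
  since only finitely many weights occur one of these scalars has to vanish.\<close>

lemma primitive_vector:
  assumes \<alpha>: "\<alpha> \<in> roots H" and x: "x \<in> root_space H \<alpha>" and y: "y \<in> root_space H (- \<alpha>)"
    and v: "v \<in> root_space H \<mu>" "v \<noteq> 0" "[x, v]\<^sub>L = 0"
  obtains n :: nat where "2 * \<mu> [x, y]\<^sub>L = of_nat n * \<alpha> [x, y]\<^sub>L"
    "\<And>k. k \<le> n \<Longrightarrow> ((\<lambda>z. [y, z]\<^sub>L) ^^ k) v \<noteq> 0"
proof -
  let ?h = "[x, y]\<^sub>L"
  let ?w = "\<lambda>k. ((\<lambda>z. [y, z]\<^sub>L) ^^ k) v"
  have hH: "?h \<in> H" by (rule br_opposite(1)[OF x y])
  define c where "c k = (of_nat (k + 1) * \<mu> ?h - of_nat (k * (k + 1)) / 2 * \<alpha> ?h)" for k :: nat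
  have w: "[?h, ?w k]\<^sub>L = (\<mu> ?h - of_nat k * \<alpha> ?h) *s ?w k" for k
    using root_spaceD[OF ad_power_weight[OF y v(1)] hH] by (simp add: ray_def)
  have up: "[x, ?w (Suc k)]\<^sub>L = c k *s ?w k" for k
  proof (induction k)
    case 0
    have "[x, ?w (Suc 0)]\<^sub>L = [?h, v]\<^sub>L + [y, [x, v]\<^sub>L]\<^sub>L" using br_leibniz[of x y v] by simp
    then show ?case using w[of 0] v(3) by (simp add: ad.zero c_def)
  next
    case (Suc k)
    have "[x, ?w (Suc (Suc k))]\<^sub>L = [?h, ?w (Suc k)]\<^sub>L + [y, [x, ?w (Suc k)]\<^sub>L]\<^sub>L"
      using br_leibniz[of x y "?w (Suc k)"] by simp
    also have "[y, [x, ?w (Suc k)]\<^sub>L]\<^sub>L = c k *s ?w (Suc k)"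
      unfolding Suc.IH by (simp add: ad.scale)
    also have "[?h, ?w (Suc k)]\<^sub>L + c k *s ?w (Suc k) =
        (\<mu> ?h - of_nat (Suc k) * \<alpha> ?h + c k) *s ?w (Suc k)"
      unfolding w by (simp only: scale_left_distrib)
    also have "\<mu> ?h - of_nat (Suc k) * \<alpha> ?h + c k = c (Suc k)"
      by (simp add: c_def field_simps)
    finally show ?case .
  qed
  have \<alpha>': "- \<alpha> \<in> roots H" by (rule roots_neg[OF \<alpha>])
  obtain n where n: "?w (Suc n) = 0" "\<And>k. k \<le> n \<Longrightarrow> ?w k \<noteq> 0"
    using climb[OF \<alpha>' y v(1,2)] by blast
  have "c n *s ?w n = 0" using up[of n] n(1) ad.zero[of x] by simp
  then have "c n = 0" using n(2)[of n] by simp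
  then have "of_nat (n + 1) * (2 * \<mu> ?h - of_nat n * \<alpha> ?h) = 0"
    by (simp add: c_def field_simps)
  then have "2 * \<mu> ?h = of_nat n * \<alpha> ?h"
    unfolding mult_eq_0_iff of_nat_eq_0_iff by simp
  then show thesis using that n(2) by blast
qed

subsection \<open>Roots have nonzero length, one-dimensional root spaces and no proper multiples\<close>

lemma root_triple:
  assumes "\<beta> \<in> roots H" "x \<in> root_space H \<beta>" "x \<noteq> 0"
  obtains y where "y \<in> root_space H (- \<beta>)" "killing_form x y = 1" "[x, y]\<^sub>L = riesz H \<beta>"
  using root_pairing[OF assms] riesz_root[OF assms(1,2)] by metis

text \<open>If \<open>\<alpha>\<close> were isotropic, every root would vanish on the element representing \<open>\<alpha>\<close>, which
  would therefore be central.\<close>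

lemma root_norm_nonzero:
  assumes \<alpha>: "\<alpha> \<in> roots H"
  shows "\<alpha> (riesz H \<alpha>) \<noteq> 0"
proof
  let ?t = "riesz H \<alpha>"
  assume zero: "\<alpha> ?t = 0"
  obtain x where x: "x \<in> root_space H \<alpha>" "x \<noteq> 0" using root_space_nontrivial[OF \<alpha>] .
  obtain y where y: "y \<in> root_space H (- \<alpha>)" "[x, y]\<^sub>L = ?t" using root_triple[OF \<alpha> x] by metis
  have tH: "?t \<in> H" by (rule riesz_props(1)[OF \<alpha>])
  have "\<beta> ?t = 0" if \<beta>: "\<beta> \<in> roots H" for \<beta>
  proof -
    obtain v where v: "v \<in> root_space H \<beta>" "v \<noteq> 0" using root_space_nontrivial[OF \<beta>] .
    obtain k where k: "((\<lambda>z. [x, z]\<^sub>L) ^^ Suc k) v = 0" "((\<lambda>z. [x, z]\<^sub>L) ^^ k) v \<noteq> 0"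
      using climb[OF \<alpha> x(1) v] by (metis order_refl)
    obtain n where "2 * ray \<beta> \<alpha> (int k) [x, y]\<^sub>L = of_nat n * \<alpha> [x, y]\<^sub>L"
      using primitive_vector[OF \<alpha> x(1) y(1) ad_power_weight[OF x(1) v(1)] k(2)] k(1) by auto
    then show ?thesis using zero y(2) by (simp add: ray_def)
  qed
  then have central: "[?t, z]\<^sub>L = 0" if "\<beta> \<in> roots H" "z \<in> root_space H \<beta>" for \<beta> z
    using root_spaceD[OF that(2) tH] that(1) by simp
  have "[?t, z]\<^sub>L = 0" for z
  proof (induction rule: weight_vector_induct[where Q = "\<lambda>z. [?t, z]\<^sub>L = 0"])
    case subspace
    then show ?case by (rule subspaceI) (auto simp: ad.zero ad.add ad.scale)
  next
    case (H h)
    then show ?case using H_commute tH by blast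
  next
    case (root \<beta> x)
    then show ?case using central by blast
  qed
  then have "killing_form ?t z = 0" for z
    using ad.zero by (simp add: killing_sym[of ?t] killing_form_def endo_trace_def representation_zero)
  then have "\<alpha> h = 0" if "h \<in> H" for h using riesz_props(2)[OF \<alpha> that] by simp
  then show False using roots_nonzero[OF \<alpha>] by blast
qed

text \<open>Here \<open>z\<close> would be a primitive vector of weight \<open>- \<alpha>\<close>, but the weight of a primitive vector is
  a nonnegative half-integral multiple of \<open>\<alpha>\<close> on \<open>[x, y]\<close>.\<close>

lemma orthogonal_in_opposite_root_space:
  assumes \<alpha>: "\<alpha> \<in> roots H" and x: "x \<in> root_space H \<alpha>" "x \<noteq> 0"
    and z: "z \<in> root_space H (- \<alpha>)" "killing_form x z = 0"
  shows "z = 0"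
proof (rule ccontr)
  assume "z \<noteq> 0"
  obtain y where y: "y \<in> root_space H (- \<alpha>)" "[x, y]\<^sub>L = riesz H \<alpha>"
    using root_triple[OF \<alpha> x] by metis
  have "[x, z]\<^sub>L = 0"
    using br_opposite[OF x(1) z(1)] z(2) by (intro killing_nondegenerate_H) auto
  then obtain n where "2 * (- \<alpha>) [x, y]\<^sub>L = of_nat n * \<alpha> [x, y]\<^sub>L"
    using primitive_vector[OF \<alpha> x(1) y(1) z(1) \<open>z \<noteq> 0\<close>] by metis
  then have "2 * - \<alpha> (riesz H \<alpha>) = of_nat n * \<alpha> (riesz H \<alpha>)" using y(2) by simp
  then have "(of_nat n + 2) * \<alpha> (riesz H \<alpha>) = 0" by algebra
  then have "of_nat (n + 2) * \<alpha> (riesz H \<alpha>) = 0" by (simp add: add.commute)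
  then show False using root_norm_nonzero[OF \<alpha>] unfolding mult_eq_0_iff of_nat_eq_0_iff by simp
qed

lemma root_space_line:
  assumes \<alpha>: "\<alpha> \<in> roots H" and x: "x \<in> root_space H \<alpha>" "x \<noteq> 0" and x': "x' \<in> root_space H \<alpha>"
  shows "\<exists>c. x' = c *s x"
proof -
  obtain y where y: "y \<in> root_space H (- \<alpha>)" "killing_form x y = 1"
    using root_pairing[OF \<alpha> x] .
  have "y \<noteq> 0" using y(2) by auto
  let ?z = "x' - killing_form x' y *s x"
  have "?z \<in> root_space H (- (- \<alpha>))"
    using x x' subspace_diff[OF subspace_root_space] subspace_scale[OF subspace_root_space] by simp
  moreover have "killing_form y ?z = 0"
    using y(2) by (simp add: killing_sym[of y] killing_diff_left killing_scale_left)
  ultimately have "?z = 0"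
    using orthogonal_in_opposite_root_space[OF roots_neg[OF \<alpha>] y(1) \<open>y \<noteq> 0\<close>] by blast
  then show ?thesis by auto
qed

text \<open>By induction \<open>[x, z] = 0\<close>, since \<open>[x, z]\<close> is either of a weight excluded before or, for \<open>m = 2\<close>, in a line
  on which the Killing form with \<open>x\<close> is injective. So \<open>z\<close> would be primitive of negative weight.\<close>

lemma no_multiple_root_space:
  assumes \<alpha>: "\<alpha> \<in> roots H" and "2 \<le> m"
  shows "root_space H (ray 0 \<alpha> (- int m)) = {0}"
  using \<open>2 \<le> m\<close>
proof (induction m rule: dec_induct)
  let ?t = "riesz H \<alpha>"
  obtain x where x: "x \<in> root_space H \<alpha>" "x \<noteq> 0" using root_space_nontrivial[OF \<alpha>] .
  obtain y where y: "y \<in> root_space H (- \<alpha>)" "[x, y]\<^sub>L = ?t" using root_triple[OF \<alpha> x] by metis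
  have key: "root_space H (ray 0 \<alpha> (- int m)) = {0}"
    if "\<And>z. z \<in> root_space H (ray 0 \<alpha> (- int m)) \<Longrightarrow> [x, z]\<^sub>L = 0" "m \<ge> 2" for m
  proof -
    have "z = 0" if z: "z \<in> root_space H (ray 0 \<alpha> (- int m))" for z
    proof (rule ccontr)
      assume "z \<noteq> 0"
      then obtain n where "2 * ray 0 \<alpha> (- int m) [x, y]\<^sub>L = of_nat n * \<alpha> [x, y]\<^sub>L"
        using primitive_vector[OF \<alpha> x(1) y(1) z] \<open>\<And>z. z \<in> root_space H (ray 0 \<alpha> (- int m)) \<Longrightarrow> [x, z]\<^sub>L = 0\<close> z
        by metis
      then have "2 * (- of_nat m * \<alpha> ?t) = of_nat n * \<alpha> ?t" using y(2) by (simp add: ray_def)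
      then have "(of_nat n + 2 * of_nat m) * \<alpha> ?t = 0" by algebra
      then have "of_nat (n + 2 * m) * \<alpha> ?t = 0" by (simp add: add.commute)
      then show False
        using root_norm_nonzero[OF \<alpha>] \<open>m \<ge> 2\<close> unfolding mult_eq_0_iff of_nat_eq_0_iff by simp
    qed
    then show ?thesis using subspace_0[OF subspace_root_space] by blast
  qed
  {
    case base
    show ?case
    proof (rule key)
      fix z assume z: "z \<in> root_space H (ray 0 \<alpha> (- int 2))"
      have "\<alpha> + ray 0 \<alpha> (- int 2) = - \<alpha>" by (simp add: ray_def fun_eq_iff)
      then have "[x, z]\<^sub>L \<in> root_space H (- \<alpha>)" using root_space_br[OF x(1) z] by (simp only:)
      moreover have "killing_form x [x, z]\<^sub>L = 0"
        using killing_invariant[of x x z] by (simp add: br_alternating)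
      ultimately show "[x, z]\<^sub>L = 0" by (rule orthogonal_in_opposite_root_space[OF \<alpha> x])
    qed simp
  next
    case (step m)
    show ?case
    proof (rule key)
      fix z assume z: "z \<in> root_space H (ray 0 \<alpha> (- int (Suc m)))"
      have "[x, z]\<^sub>L \<in> root_space H (ray 0 \<alpha> (- int m))"
        using root_space_br[OF x(1) z] unfolding ray_add by simp
      then show "[x, z]\<^sub>L = 0" using step.IH by simp
    qed (use step in simp)
  }
qed

lemma multiple_root:
  assumes \<alpha>: "\<alpha> \<in> roots H" and k: "ray 0 \<alpha> k \<in> roots H"
  shows "k = 1 \<or> k = - 1"
proof (rule ccontr)
  assume *: "\<not> ?thesis"
  have "k \<noteq> 0" using k by (auto simp: roots_def)
  show False
  proof (cases "k < 0")
    case True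
    then have "root_space H (ray 0 \<alpha> (- int (nat (- k)))) = {0}"
      using * by (intro no_multiple_root_space[OF \<alpha>]) auto
    then show False using True k by (simp add: roots_def)
  next
    case False
    then have "root_space H (ray 0 (- \<alpha>) (- int (nat k))) = {0}"
      using * \<open>k \<noteq> 0\<close> by (intro no_multiple_root_space roots_neg[OF \<alpha>]) auto
    then show False using False k by (simp add: roots_def ray_neg)
  qed
qed

subsection \<open>Root strings\<close>

lemma ray_root_iff:
  assumes \<alpha>: "\<alpha> \<in> roots H" and \<beta>: "\<beta> \<in> roots H" and ne: "\<beta> \<noteq> \<alpha>" "\<beta> \<noteq> - \<alpha>"
  shows "ray \<beta> \<alpha> k \<in> roots H \<longleftrightarrow> root_space H (ray \<beta> \<alpha> k) \<noteq> {0}"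
proof -
  have "ray \<beta> \<alpha> k \<noteq> 0"
  proof
    assume "ray \<beta> \<alpha> k = 0"
    then have e: "\<beta> = ray 0 \<alpha> (- k)" by (auto simp: ray_def fun_eq_iff add_eq_0_iff2)
    then have "- k = 1 \<or> - k = - 1" using multiple_root[OF \<alpha>] \<beta> by metis
    then show False using e ne by (auto simp: ray_def fun_eq_iff)
  qed
  moreover have "ray \<beta> \<alpha> k \<in> dual_space H" by (intro ray_dual roots_dual \<alpha> \<beta>)
  ultimately show ?thesis unfolding roots_def by blast
qed

text \<open>Let \<open>p\<close> and \<open>q\<close> be the lengths of the unbroken string below and above \<open>\<beta>\<close>. A top vector is primitive
  for \<open>x\<close> and a bottom vector for \<open>y\<close>; the two nonnegative integers attached to them by
  \<open>primitive_vector\<close> are at most \<open>p + q\<close> and add up to \<open>2 (p + q)\<close>, so both are equal to \<open>p + q\<close>. This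
  gives the Cartan integer, and it also shows that \<open>ad x\<close> moves the bottom vector through the
  whole string.\<close>

lemma root_string:
  assumes \<alpha>: "\<alpha> \<in> roots H" and \<beta>: "\<beta> \<in> roots H" and ne: "\<beta> \<noteq> \<alpha>" "\<beta> \<noteq> - \<alpha>"
  obtains p q :: nat where
    "cartan_integer H \<beta> \<alpha> = of_int (int p - int q)"
    "\<And>k. - int p \<le> k \<Longrightarrow> k \<le> int q \<Longrightarrow> ray \<beta> \<alpha> k \<in> roots H"
    "\<beta> + \<alpha> \<in> roots H \<Longrightarrow> q \<noteq> 0" "\<beta> - \<alpha> \<in> roots H \<Longrightarrow> p \<noteq> 0"
    "\<And>x u. x \<in> root_space H \<alpha> \<Longrightarrow> x \<noteq> 0 \<Longrightarrow> u \<in> root_space H \<beta> \<Longrightarrow> u \<noteq> 0 \<Longrightarrow>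
       q \<noteq> 0 \<Longrightarrow> [x, u]\<^sub>L \<noteq> 0"
proof -
  let ?t = "riesz H \<alpha>"
  note iff = ray_root_iff[OF \<alpha> \<beta> ne]
  define q where "q = (LEAST n::nat. ray \<beta> \<alpha> (int (Suc n)) \<notin> roots H)"
  define p where "p = (LEAST n::nat. ray \<beta> \<alpha> (- int (Suc n)) \<notin> roots H)"
  have "\<exists>n::nat. ray \<beta> \<alpha> (int (Suc n)) \<notin> roots H"
  proof -
    obtain n where "root_space H (ray \<beta> \<alpha> (int n)) = {0}"
      using ray_eventually_trivial(1)[OF \<alpha>] by blast
    then have "ray \<beta> \<alpha> (int n) \<notin> roots H" using iff by simp
    moreover from this have "n \<noteq> 0" using \<beta> by (intro notI) simp
    ultimately show ?thesis by (metis not0_implies_Suc)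
  qed
  then have q: "ray \<beta> \<alpha> (int (Suc q)) \<notin> roots H" unfolding q_def by (rule LeastI_ex)
  have "\<exists>n::nat. ray \<beta> \<alpha> (- int (Suc n)) \<notin> roots H"
  proof -
    obtain n where "root_space H (ray \<beta> \<alpha> (- int n)) = {0}"
      using ray_eventually_trivial(2)[OF \<alpha>] by blast
    then have "ray \<beta> \<alpha> (- int n) \<notin> roots H" using iff by simp
    moreover from this have "n \<noteq> 0" using \<beta> by (intro notI) simp
    ultimately show ?thesis by (metis not0_implies_Suc)
  qed
  then have p: "ray \<beta> \<alpha> (- int (Suc p)) \<notin> roots H" unfolding p_def by (rule LeastI_ex)
  have string: "ray \<beta> \<alpha> k \<in> roots H" if k: "- int p \<le> k" "k \<le> int q" for k
  proof -
    consider "k = 0" | n where "k = int (Suc n)" "n < q" | n where "k = - int (Suc n)" "n < p"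
    proof (cases k rule: int_cases3)
      case (pos n)
      then show ?thesis using that(2)[of "n - 1"] k by simp
    next
      case (neg n)
      then show ?thesis using that(3)[of "n - 1"] k by simp
    qed (use that in blast)
    then show ?thesis
    proof cases
      case 1
      then show ?thesis using \<beta> by simp
    next
      case 2
      then show ?thesis using not_less_Least unfolding q_def by blast
    next
      case 3
      then show ?thesis using not_less_Least unfolding p_def by blast
    qed
  qed
  have main: "cartan_integer H \<beta> \<alpha> = of_int (int p - int q) \<and>
      (q \<noteq> 0 \<longrightarrow> (\<forall>u\<in>root_space H \<beta>. u \<noteq> 0 \<longrightarrow> [x, u]\<^sub>L \<noteq> 0))"
    if x: "x \<in> root_space H \<alpha>" "x \<noteq> 0" for x
  proof -
    obtain y where y: "y \<in> root_space H (- \<alpha>)" "[x, y]\<^sub>L = ?t" using root_triple[OF \<alpha> x] by metis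
    have yx: "[y, x]\<^sub>L = - ?t" using y(2) br_antisym[of y x] by simp
    have x': "x \<in> root_space H (- (- \<alpha>))" using x(1) by simp
    have \<alpha>t: "\<alpha> ?t \<noteq> 0" by (rule root_norm_nonzero[OF \<alpha>])
    have tH: "?t \<in> H" by (rule riesz_props(1)[OF \<alpha>])
    \<comment> \<open>A vector at the top of the string is primitive, hence at most \<open>p + q\<close> steps lead down.\<close>
    have rq: "ray \<beta> \<alpha> (int q) \<in> roots H" by (rule string) auto
    obtain w where w: "w \<in> root_space H (ray \<beta> \<alpha> (int q))" "w \<noteq> 0"
      using root_space_nontrivial[OF rq] .
    have "[x, w]\<^sub>L \<in> root_space H (ray \<beta> \<alpha> (int (Suc q)))"
      using root_space_br[OF x(1) w(1)] by (simp add: ray_add add.commute)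
    then have "[x, w]\<^sub>L = 0" using q iff by blast
    then obtain n where n: "2 * ray \<beta> \<alpha> (int q) ?t = of_nat n * \<alpha> ?t"
      "\<And>k. k \<le> n \<Longrightarrow> ((\<lambda>z. [y, z]\<^sub>L) ^^ k) w \<noteq> 0"
      using primitive_vector[OF \<alpha> x(1) y(1) w] y(2) by metis
    have "n \<le> p + q"
    proof (rule ccontr)
      assume "\<not> ?thesis"
      then have "((\<lambda>z. [y, z]\<^sub>L) ^^ (Suc (p + q))) w \<noteq> 0" by (intro n(2)) simp
      moreover have "((\<lambda>z. [y, z]\<^sub>L) ^^ (Suc (p + q))) w \<in> root_space H (ray \<beta> \<alpha> (- int (Suc p)))"
        using ad_power_weight[OF y(1) w(1), of "Suc (p + q)"]
        by (simp add: ray_neg ray_ray algebra_simps del: funpow.simps)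
      ultimately show False using p iff by blast
    qed
    \<comment> \<open>The same from the bottom, with the roles of \<open>x\<close> and \<open>y\<close> exchanged.\<close>
    have rp: "ray \<beta> \<alpha> (- int p) \<in> roots H" by (rule string) auto
    obtain v where v: "v \<in> root_space H (ray \<beta> \<alpha> (- int p))" "v \<noteq> 0"
      using root_space_nontrivial[OF rp] .
    have "- int p - 1 = - int (Suc p)" by simp
    then have "[y, v]\<^sub>L \<in> root_space H (ray \<beta> \<alpha> (- int (Suc p)))"
      using root_space_br[OF y(1) v(1)] by (simp only: ray_sub)
    then have "[y, v]\<^sub>L = 0" using p iff by blast
    then obtain m where m: "2 * ray \<beta> \<alpha> (- int p) (- ?t) = of_nat m * (- \<alpha>) (- ?t)"
      "\<And>k. k \<le> m \<Longrightarrow> ((\<lambda>z. [x, z]\<^sub>L) ^^ k) v \<noteq> 0"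
      using primitive_vector[OF roots_neg[OF \<alpha>] y(1) x' v] yx by metis
    have "m \<le> p + q"
    proof (rule ccontr)
      assume "\<not> ?thesis"
      then have "((\<lambda>z. [x, z]\<^sub>L) ^^ (Suc (p + q))) v \<noteq> 0" by (intro m(2)) simp
      moreover have "((\<lambda>z. [x, z]\<^sub>L) ^^ (Suc (p + q))) v \<in> root_space H (ray \<beta> \<alpha> (int (Suc q)))"
        using ad_power_weight[OF x(1) v(1), of "Suc (p + q)"]
        by (simp add: ray_ray algebra_simps del: funpow.simps)
      ultimately show False using q iff by blast
    qed
    have n': "2 * \<beta> ?t + 2 * of_nat q * \<alpha> ?t = of_nat n * \<alpha> ?t"
      using n(1) by (simp add: ray_def algebra_simps)
    have m': "2 * of_nat p * \<alpha> ?t - 2 * \<beta> ?t = of_nat m * \<alpha> ?t"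
      using m(1) tH \<alpha> \<beta> roots_dual by (simp add: ray_def dual_minus algebra_simps)
    have "of_nat (2 * (p + q)) * \<alpha> ?t = of_nat (n + m) * \<alpha> ?t"
      using n' m' by simp algebra
    then have "2 * (p + q) = n + m" using \<alpha>t by (simp only: mult_cancel_right of_nat_eq_iff) simp
    with \<open>n \<le> p + q\<close> \<open>m \<le> p + q\<close> have nm: "n = p + q" "m = p + q" by simp_all
    have "2 * \<beta> ?t = (of_nat p - of_nat q) * \<alpha> ?t"
      using n' unfolding nm(1) of_nat_add by algebra
    then have "cartan_integer H \<beta> \<alpha> = of_nat p - of_nat q"
      using \<alpha>t by (simp add: cartan_integer_def root_form_eq \<alpha> \<beta>)
    moreover have "[x, u]\<^sub>L \<noteq> 0" if q0: "q \<noteq> 0" and u: "u \<in> root_space H \<beta>" "u \<noteq> 0" for u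
    proof
      assume xu: "[x, u]\<^sub>L = 0"
      have "((\<lambda>z. [x, z]\<^sub>L) ^^ p) v \<in> root_space H \<beta>"
        using ad_power_weight[OF x(1) v(1), of p] by (simp add: ray_ray)
      then obtain c where "((\<lambda>z. [x, z]\<^sub>L) ^^ p) v = c *s u"
        using root_space_line[OF \<beta> u] by blast
      then have "((\<lambda>z. [x, z]\<^sub>L) ^^ Suc p) v = 0" using xu by (simp add: ad.scale)
      then show False using m(2)[of "Suc p"] nm(2) q0 by simp
    qed
    ultimately show ?thesis by simp
  qed
  obtain x where "x \<in> root_space H \<alpha>" "x \<noteq> 0" using root_space_nontrivial[OF \<alpha>] .
  then have "cartan_integer H \<beta> \<alpha> = of_int (int p - int q)" using main by blast
  moreover have "q \<noteq> 0" if "\<beta> + \<alpha> \<in> roots H" using q that by (intro notI) (simp add: ray_1)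
  moreover have "p \<noteq> 0" if "\<beta> - \<alpha> \<in> roots H" using p that by (intro notI) (simp add: ray_minus_1)
  ultimately show thesis using that[of p q] string main by blast
qed

lemma zero_not_root: "0 \<notin> roots H"
  by (simp add: roots_def)

lemma double_not_root: "\<alpha> \<in> roots H \<Longrightarrow> \<alpha> + \<alpha> \<notin> roots H"
proof
  assume \<alpha>: "\<alpha> \<in> roots H" and "\<alpha> + \<alpha> \<in> roots H"
  moreover have "\<alpha> + \<alpha> = ray 0 \<alpha> 2" by (intro ext) (simp add: ray_def)
  ultimately have "ray 0 \<alpha> 2 \<in> roots H" by (simp only:)
  from multiple_root[OF \<alpha> this] show False by simp
qed

lemma bracket_nonzero:
  assumes "\<alpha> \<in> roots H" "\<beta> \<in> roots H" "\<alpha> + \<beta> \<in> roots H"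
    and x: "x \<in> root_space H \<alpha>" "x \<noteq> 0" and u: "u \<in> root_space H \<beta>" "u \<noteq> 0"
  shows "[x, u]\<^sub>L \<noteq> 0"
proof -
  have s: "\<beta> + \<alpha> \<in> roots H" using assms(3) by (simp only: add.commute)
  have "\<beta> \<noteq> - \<alpha>"
  proof
    assume "\<beta> = - \<alpha>"
    then have "\<beta> + \<alpha> = 0" by (simp only: left_minus)
    then show False using s zero_not_root by (simp only:)
  qed
  moreover have "\<beta> \<noteq> \<alpha>" using s double_not_root[OF assms(1)] by blast
  ultimately show ?thesis using root_string[OF assms(1,2)] s x u by metis
qed

lemma cartan_integer_self: "\<alpha> \<in> roots H \<Longrightarrow> cartan_integer H \<alpha> \<alpha> = 2"
  using root_norm_nonzero by (simp add: cartan_integer_def root_form_eq)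

lemma cartan_integer_integer:
  assumes "\<alpha> \<in> roots H" "\<beta> \<in> roots H"
  obtains m :: int where "cartan_integer H \<beta> \<alpha> = of_int m" "ray \<beta> \<alpha> (- m) \<in> roots H"
proof (cases "\<beta> = \<alpha> \<or> \<beta> = - \<alpha>")
  case True
  then show thesis
  proof
    assume e: "\<beta> = \<alpha>"
    have "ray \<alpha> \<alpha> (- 2) = - \<alpha>" by (intro ext) (simp add: ray_def)
    then show thesis
      using that[of 2] e cartan_integer_self[OF assms(1)] roots_neg[OF assms(1)] by simp
  next
    assume e: "\<beta> = - \<alpha>"
    have "ray (- \<alpha>) \<alpha> 2 = \<alpha>" by (intro ext) (simp add: ray_def)
    moreover have "cartan_integer H (- \<alpha>) \<alpha> = - 2"
      using root_norm_nonzero[OF assms(1)] root_form_eq[of "- \<alpha>" \<alpha>] assms(1) roots_neg[OF assms(1)]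
      by (simp add: cartan_integer_def root_form_eq)
    ultimately show thesis using that[of "-2"] e assms(1) by simp
  qed
next
  case False
  then obtain p q :: nat where pq: "cartan_integer H \<beta> \<alpha> = of_int (int p - int q)"
    "\<And>k. - int p \<le> k \<Longrightarrow> k \<le> int q \<Longrightarrow> ray \<beta> \<alpha> k \<in> roots H"
    using root_string[OF assms] by metis
  show thesis by (rule that[OF pq(1)]) (rule pq(2), auto)
qed

end

section \<open>The root system of type D in coordinates\<close>

lemma type_D_gram_matrix:
  fixes i k l :: nat
  assumes "i \<in> {1..l}" "k \<in> {1..l}" "4 \<le> l"
  defines "a \<equiv> \<lambda>k j. (if k < l then of_bool (j = k) - of_bool (j = k + 1)
     else of_bool (j = l - 1) + of_bool (j = l)) :: int"
  shows "(if i < l then a k i - a k (i + 1) else a k (l - 1) + a k l) = (if i = k then 2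
    else if (k = i + 1 \<and> k \<le> l - 1) \<or> (i = l - 2 \<and> k = l) \<or>
            (i = k + 1 \<and> i \<le> l - 1) \<or> (k = l - 2 \<and> i = l) then - 1 else 0)"
proof -
  have ik: "i \<le> l" "k \<le> l" using assms by auto
  consider "i < l" "k < l" | "i = l" "k = l" | "i = l" "k < l" | "k = l" "i < l"
    using ik by linarith
  then show ?thesis
  proof cases
    case 1
    consider "i = k" | "i = k + 1" | "k = i + 1" | "i \<noteq> k" "i \<noteq> k + 1" "k \<noteq> i + 1"
      by linarith
    then show ?thesis by cases (use 1 assms(3) in \<open>simp_all add: a_def\<close>)
  next
    case 2
    then show ?thesis using assms(3) by (simp add: a_def)
  next
    case 3
    consider "l = k + 1" | "l = k + 2" | "l - 1 \<noteq> k + 1" "k \<noteq> l - 2" "l - 1 \<noteq> k" "l \<noteq> k + 1"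
      using 3 by linarith
    then show ?thesis by cases (use 3 assms(3) in \<open>simp_all add: a_def\<close>)
  next
    case 4
    consider "l = i + 1" | "l = i + 2" | "l - 1 \<noteq> i + 1" "i \<noteq> l - 2" "l - 1 \<noteq> i" "l \<noteq> i + 1"
      using 4 by linarith
    then show ?thesis by cases (use 4 assms(3) in \<open>simp_all add: a_def\<close>)
  qed
qed

locale simple_lie_algebra_type_D = simple_lie_algebra_with_base +
  fixes \<alpha> :: "nat \<Rightarrow> 'a \<Rightarrow> complex" and l :: nat
  assumes is_type_D: "type_D H P \<alpha> l"
begin

lemma l_ge_4: "4 \<le> l"
  and bij_alpha: "bij_betw \<alpha> {1..l} P"
  and bonds: "i \<in> {1..l} \<Longrightarrow> j \<in> {1..l} \<Longrightarrow> i < j \<Longrightarrow> dynkin_bonds H (\<alpha> i) (\<alpha> j) =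
         (if (j = i + 1 \<and> j \<le> l - 1) \<or> (i = l - 2 \<and> j = l) then 1 else 0)"
  using is_type_D unfolding type_D_def by blast+

lemma alpha_P: "i \<in> {1..l} \<Longrightarrow> \<alpha> i \<in> P"
  using bij_alpha by (auto simp: bij_betw_def)

lemma alpha_root: "i \<in> {1..l} \<Longrightarrow> \<alpha> i \<in> roots H"
  using alpha_P P_roots by blast

lemma P_alpha: "P = \<alpha> ` {1..l}"
  using bij_alpha by (simp add: bij_betw_def)

subsection \<open>Coefficients with respect to the simple roots\<close>

definition comb :: "(nat \<Rightarrow> int) \<Rightarrow> 'a \<Rightarrow> complex" where
  "comb n = (\<lambda>h. \<Sum>i\<in>{1..l}. of_int (n i) * \<alpha> i h)"

lemma prescribe_alpha: "\<exists>h. h \<in> H \<and> (\<forall>i\<in>{1..l}. \<alpha> i h = f i)"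
proof -
  have "\<exists>h. h \<in> H \<and> (\<forall>\<gamma>\<in>P. \<gamma> h = f (inv_into {1..l} \<alpha> \<gamma>))"
    by (rule prescribe_base_values[of "\<lambda>\<gamma>. f (inv_into {1..l} \<alpha> \<gamma>)"]) blast
  then obtain h where h: "h \<in> H" "\<forall>\<gamma>\<in>P. \<gamma> h = f (inv_into {1..l} \<alpha> \<gamma>)" by blast
  have "\<forall>i\<in>{1..l}. \<alpha> i h = f i"
  proof
    fix i assume i: "i \<in> {1..l}"
    show "\<alpha> i h = f i"
      using bspec[OF h(2) alpha_P[OF i]] unfolding bij_betw_inv_into_left[OF bij_alpha i] .
  qed
  with h(1) show ?thesis by (intro exI conjI)
qed

lemma comb_coefficient:
  assumes "i \<in> {1..l}"
  obtains h where "h \<in> H" "\<And>n. comb n h = of_int (n i)"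
proof -
  obtain h where h: "h \<in> H" "\<forall>j\<in>{1..l}. \<alpha> j h = (if j = i then 1 else 0)"
    using prescribe_alpha[of "\<lambda>j. if j = i then 1 else 0"] by (elim exE conjE)
  have "comb n h = of_int (n i)" for n
  proof -
    have "comb n h = (\<Sum>j\<in>{1..l}. if j = i then of_int (n i) else 0)"
      unfolding comb_def by (intro sum.cong) (auto simp: h(2))
    then show ?thesis using assms by simp
  qed
  then show thesis using that h(1) by blast
qed

lemma comb_inj:
  assumes "comb n = comb m" "i \<in> {1..l}"
  shows "n i = m i"
proof -
  obtain h where h: "\<And>n. comb n h = of_int (n i)" using comb_coefficient[OF assms(2)] by blast
  have "comb n h = comb m h" using assms(1) by (rule fun_cong)
  then show ?thesis unfolding h by simp
qed

lemma alpha_comb: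
  assumes "i \<in> {1..l}"
  shows "\<alpha> i = comb (\<lambda>j. of_bool (j = i))"
proof (rule ext)
  fix h
  have "comb (\<lambda>j. of_bool (j = i)) h = (\<Sum>j\<in>{1..l}. if j = i then \<alpha> i h else 0)"
    unfolding comb_def by (intro sum.cong) auto
  then show "\<alpha> i h = comb (\<lambda>j. of_bool (j = i)) h" using assms by simp
qed

lemma P_sum: "(\<Sum>\<gamma>\<in>P. of_nat (n \<gamma>) * \<gamma> h) = comb (\<lambda>i. int (n (\<alpha> i))) h"
  unfolding comb_def by (subst sum.reindex_bij_betw[OF bij_alpha, symmetric]) simp

lemma root_comb:
  assumes "\<beta> \<in> roots H"
  obtains n where "\<beta> = comb n" "(\<forall>i\<in>{1..l}. 0 \<le> n i) \<or> (\<forall>i\<in>{1..l}. n i \<le> 0)"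
proof -
  obtain n :: "('a \<Rightarrow> complex) \<Rightarrow> nat" where
    "\<beta> = (\<lambda>x. \<Sum>\<gamma>\<in>P. of_nat (n \<gamma>) * \<gamma> x) \<or> \<beta> = - (\<lambda>x. \<Sum>\<gamma>\<in>P. of_nat (n \<gamma>) * \<gamma> x)"
    using P_base[OF assms] by blast
  then show thesis
  proof
    assume "\<beta> = (\<lambda>x. \<Sum>\<gamma>\<in>P. of_nat (n \<gamma>) * \<gamma> x)"
    then have "\<beta> = comb (\<lambda>i. int (n (\<alpha> i)))" unfolding P_sum .
    then show thesis by (rule that) simp
  next
    assume "\<beta> = - (\<lambda>x. \<Sum>\<gamma>\<in>P. of_nat (n \<gamma>) * \<gamma> x)"
    then have "\<beta> = comb (\<lambda>i. - int (n (\<alpha> i)))"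
      unfolding P_sum by (intro ext) (simp add: comb_def sum_negf)
    then show thesis by (rule that) simp
  qed
qed

lemma pos_root_iff:
  "\<beta> \<in> pos_roots H P \<longleftrightarrow> \<beta> \<in> roots H \<and> (\<exists>n. \<beta> = comb n \<and> (\<forall>i\<in>{1..l}. 0 \<le> n i))"
proof
  assume \<beta>: "\<beta> \<in> pos_roots H P"
  then obtain n :: "('a \<Rightarrow> complex) \<Rightarrow> nat" where "\<beta> = (\<lambda>x. \<Sum>\<gamma>\<in>P. of_nat (n \<gamma>) * \<gamma> x)"
    unfolding pos_roots_def by blast
  then have "\<beta> = comb (\<lambda>i. int (n (\<alpha> i)))" unfolding P_sum .
  moreover have "\<beta> \<in> roots H" using \<beta> unfolding pos_roots_def by simp
  ultimately show "\<beta> \<in> roots H \<and> (\<exists>n. \<beta> = comb n \<and> (\<forall>i\<in>{1..l}. 0 \<le> n i))"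
    by (intro conjI exI[of _ "\<lambda>i. int (n (\<alpha> i))"]) simp_all
next
  assume "\<beta> \<in> roots H \<and> (\<exists>n. \<beta> = comb n \<and> (\<forall>i\<in>{1..l}. 0 \<le> n i))"
  then obtain n where n: "\<beta> \<in> roots H" "\<beta> = comb n" "\<forall>i\<in>{1..l}. 0 \<le> n i" by blast
  let ?m = "\<lambda>\<gamma>. nat (n (inv_into {1..l} \<alpha> \<gamma>))"
  have "\<beta> = (\<lambda>x. \<Sum>\<gamma>\<in>P. of_nat (?m \<gamma>) * \<gamma> x)"
    unfolding P_sum n(2) comb_def
    using n(3) bij_betw_inv_into_left[OF bij_alpha]
    by (intro ext sum.cong refl) (simp del: One_nat_def)
  with n(1) show "\<beta> \<in> pos_roots H P"
    unfolding pos_roots_def by (intro CollectI conjI exI[of _ ?m])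
qed

subsection \<open>The Cartan matrix\<close>

text \<open>With \<open>\<alpha>\<^sub>k = \<epsilon>\<^sub>k - \<epsilon>\<^sub>k\<^sub>+\<^sub>1\<close> for \<open>k < l\<close> and \<open>\<alpha>\<^sub>l = \<epsilon>\<^sub>l\<^sub>-\<^sub>1 + \<epsilon>\<^sub>l\<close>, the number
  \<open>simple_coord k j\<close> is the \<open>j\<close>-th coordinate of \<open>\<alpha>\<^sub>k\<close> and \<open>dot k v\<close> the standard inner
  product of \<open>\<alpha>\<^sub>k\<close> with the vector \<open>v\<close>.\<close>

definition simple_coord :: "nat \<Rightarrow> nat \<Rightarrow> int" where
  "simple_coord k j = (if k < l then of_bool (j = k) - of_bool (j = k + 1)
     else of_bool (j = l - 1) + of_bool (j = l))"

definition dot :: "nat \<Rightarrow> (nat \<Rightarrow> int) \<Rightarrow> int" where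
  "dot k v = (if k < l then v k - v (k + 1) else v (l - 1) + v l)"

lemma sum_simple_coord:
  fixes f :: "nat \<Rightarrow> 'c::comm_ring_1"
  assumes "k \<in> {1..l}"
  shows "(\<Sum>j\<in>{1..l}. of_int (simple_coord k j) * f j) =
    (if k < l then f k - f (k + 1) else f (l - 1) + f l)"
proof -
  have d: "(\<Sum>j\<in>{1..l}. of_bool (j = m) * f j) = (if m \<in> {1..l} then f m else 0)" for m
  proof -
    have "(\<Sum>j\<in>{1..l}. of_bool (j = m) * f j) = (\<Sum>j\<in>{1..l}. if j = m then f j else 0)"
      by (intro sum.cong) auto
    then show ?thesis by simp
  qed
  show ?thesis
  proof (cases "k < l")
    case True
    then have "(\<Sum>j\<in>{1..l}. of_int (simple_coord k j) * f j) =
        (\<Sum>j\<in>{1..l}. of_bool (j = k) * f j) - (\<Sum>j\<in>{1..l}. of_bool (j = k + 1) * f j)"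
      by (simp add: simple_coord_def left_diff_distrib sum_subtractf)
    then show ?thesis unfolding d using True assms by auto
  next
    case False
    then have "(\<Sum>j\<in>{1..l}. of_int (simple_coord k j) * f j) =
        (\<Sum>j\<in>{1..l}. of_bool (j = l - 1) * f j) + (\<Sum>j\<in>{1..l}. of_bool (j = l) * f j)"
      by (simp add: simple_coord_def distrib_right sum.distrib)
    then show ?thesis unfolding d using False assms l_ge_4 by auto
  qed
qed

lemma dot_sum: "k \<in> {1..l} \<Longrightarrow> dot k v = (\<Sum>j\<in>{1..l}. simple_coord k j * v j)"
  using sum_simple_coord[of k v] by (simp add: dot_def)

lemma dot_linear: "dot i (\<lambda>j. \<Sum>k\<in>S. c k * v k j) = (\<Sum>k\<in>S. c k * dot i (v k))"
  by (simp add: dot_def sum_subtractf sum.distrib right_diff_distrib distrib_left)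

lemma dot_simple_coord:
  assumes "i \<in> {1..l}" "k \<in> {1..l}"
  shows "dot i (simple_coord k) = (if i = k then 2
    else if (k = i + 1 \<and> k \<le> l - 1) \<or> (i = l - 2 \<and> k = l) \<or>
            (i = k + 1 \<and> i \<le> l - 1) \<or> (k = l - 2 \<and> i = l) then - 1 else 0)"
  unfolding dot_def simple_coord_def by (rule type_D_gram_matrix[OF assms l_ge_4])

lemma cartan_integer_eval:
  assumes "\<beta> \<in> roots H" "\<gamma> \<in> roots H"
  shows "cartan_integer H \<beta> \<gamma> = 2 * \<beta> (riesz H \<gamma>) / \<gamma> (riesz H \<gamma>)"
  by (simp add: cartan_integer_def root_form_eq assms)

lemma simple_diff_not_root:
  assumes "i \<in> {1..l}" "j \<in> {1..l}" "i \<noteq> j"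
  shows "\<alpha> i - \<alpha> j \<notin> roots H"
proof
  assume "\<alpha> i - \<alpha> j \<in> roots H"
  then obtain n where n: "\<alpha> i - \<alpha> j = comb n" "(\<forall>i\<in>{1..l}. 0 \<le> n i) \<or> (\<forall>i\<in>{1..l}. n i \<le> 0)"
    by (rule root_comb)
  have "comb n = comb (\<lambda>k. of_bool (k = i) - of_bool (k = j))"
  proof (rule ext)
    fix h
    have "comb n h = \<alpha> i h - \<alpha> j h" using fun_cong[OF n(1), of h] by simp
    also have "\<dots> = comb (\<lambda>k. of_bool (k = i)) h - comb (\<lambda>k. of_bool (k = j)) h"
      using alpha_comb[OF assms(1)] alpha_comb[OF assms(2)] by simp
    also have "\<dots> = comb (\<lambda>k. of_bool (k = i) - of_bool (k = j)) h"
      unfolding comb_def sum_subtractf[symmetric] by (intro sum.cong) (simp_all add: algebra_simps)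
    finally show "comb n h = comb (\<lambda>k. of_bool (k = i) - of_bool (k = j)) h" .
  qed
  then have "n i = 1" "n j = - 1" using comb_inj assms by fastforce+
  then show False using n(2) assms(1,2) by fastforce
qed

lemma simple_cartan_nonpos:
  assumes "i \<in> {1..l}" "j \<in> {1..l}" "i \<noteq> j"
  obtains q :: nat where "cartan_integer H (\<alpha> i) (\<alpha> j) = - of_nat q"
proof -
  have "\<alpha> i \<noteq> \<alpha> j" using assms inj_onD[OF bij_betw_imp_inj_on[OF bij_alpha]] by blast
  moreover have "\<alpha> i \<noteq> - \<alpha> j"
  proof
    assume e: "\<alpha> i = - \<alpha> j"
    obtain h where h: "\<forall>k\<in>{1..l}. \<alpha> k h = 1"
      using prescribe_alpha[of "\<lambda>_. 1"] by (elim exE conjE)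
    have "\<alpha> i h = - \<alpha> j h" using fun_cong[OF e, of h] by simp
    then show False using h assms by simp
  qed
  ultimately obtain p q :: nat where pq: "cartan_integer H (\<alpha> i) (\<alpha> j) = of_int (int p - int q)"
    "\<And>k. - int p \<le> k \<Longrightarrow> k \<le> int q \<Longrightarrow> ray (\<alpha> i) (\<alpha> j) k \<in> roots H"
    using root_string[OF alpha_root[OF assms(2)] alpha_root[OF assms(1)]] by metis
  have "p = 0"
  proof (rule ccontr)
    assume "p \<noteq> 0"
    then have "ray (\<alpha> i) (\<alpha> j) (- 1) \<in> roots H" by (intro pq(2)) auto
    then show False using simple_diff_not_root[OF assms] unfolding ray_minus_1 by blast
  qed
  then show thesis using that[of q] pq(1) by simp
qed

lemma simple_cartan_zero:
  assumes "i \<in> {1..l}" "j \<in> {1..l}" "cartan_integer H (\<alpha> i) (\<alpha> j) = 0"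
  shows "cartan_integer H (\<alpha> j) (\<alpha> i) = 0"
proof -
  have "root_form H (\<alpha> j) (\<alpha> j) \<noteq> 0"
    using root_norm_nonzero[OF alpha_root[OF assms(2)]] root_form_eq alpha_root[OF assms(2)] by simp
  then have "root_form H (\<alpha> i) (\<alpha> j) = 0" using assms(3) by (simp add: cartan_integer_def)
  then show ?thesis by (simp add: cartan_integer_def root_form_sym[of "\<alpha> j"])
qed

text \<open>The off-diagonal Cartan integers are nonpositive integers, because differences of simple roots are not
  roots, so two of them with product 1 must both be \<open>- 1\<close>.\<close>

lemma cartan_matrix:
  assumes "i \<in> {1..l}" "k \<in> {1..l}"
  shows "cartan_integer H (\<alpha> k) (\<alpha> i) = of_int (dot i (simple_coord k))"
proof (cases "i = k")
  case True
  then show ?thesis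
    using cartan_integer_self[OF alpha_root[OF assms(1)]] dot_simple_coord[OF assms] by simp
next
  case False
  obtain p where p: "cartan_integer H (\<alpha> k) (\<alpha> i) = - of_nat p"
    using simple_cartan_nonpos[OF assms(2,1)] False by metis
  obtain q where q: "cartan_integer H (\<alpha> i) (\<alpha> k) = - of_nat q"
    using simple_cartan_nonpos[OF assms] False by metis
  define adj where "adj = ((k = i + 1 \<and> k \<le> l - 1) \<or> (i = l - 2 \<and> k = l) \<or>
            (i = k + 1 \<and> i \<le> l - 1) \<or> (k = l - 2 \<and> i = l))"
  have "of_nat (p * q) = (if adj then 1 else 0 :: complex)"
  proof (cases "i < k")
    case True
    then show ?thesis using bonds[OF assms] p q l_ge_4
      by (auto simp: dynkin_bonds_def adj_def mult.commute)
  next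
    case False
    then show ?thesis using bonds[OF assms(2,1)] p q \<open>i \<noteq> k\<close> l_ge_4
      by (auto simp: dynkin_bonds_def adj_def)
  qed
  then have pq: "p * q = (if adj then 1 else 0)"
    by (metis of_nat_eq_iff of_nat_1 of_nat_0)
  show ?thesis
  proof (cases adj)
    case True
    then have "p = 1" using pq by simp
    then show ?thesis using True \<open>i \<noteq> k\<close> p dot_simple_coord[OF assms]
      unfolding adj_def by (simp only: if_False if_True) simp
  next
    case False
    then have "p = 0 \<or> q = 0" using pq by simp
    then have "p = 0" using simple_cartan_zero[OF assms] p q by auto
    then show ?thesis using False \<open>i \<noteq> k\<close> p dot_simple_coord[OF assms]
      unfolding adj_def by (simp only: if_False if_True) simp
  qed
qed

subsection \<open>Coordinates of roots\<close>

definition coord_element :: "nat \<Rightarrow> 'a" where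
  "coord_element j = (SOME h. h \<in> H \<and> (\<forall>k\<in>{1..l}. \<alpha> k h = of_int (simple_coord k j)))"

lemma coord_element:
  "coord_element j \<in> H" "k \<in> {1..l} \<Longrightarrow> \<alpha> k (coord_element j) = of_int (simple_coord k j)"
proof -
  have "\<exists>h. h \<in> H \<and> (\<forall>k\<in>{1..l}. \<alpha> k h = of_int (simple_coord k j))"
    by (rule prescribe_alpha)
  then have *: "coord_element j \<in> H \<and>
      (\<forall>k\<in>{1..l}. \<alpha> k (coord_element j) = of_int (simple_coord k j))"
    unfolding coord_element_def by (rule someI_ex)
  then show "coord_element j \<in> H" by blast
  show "k \<in> {1..l} \<Longrightarrow> \<alpha> k (coord_element j) = of_int (simple_coord k j)" using * by blast
qed

definition coord :: "(nat \<Rightarrow> int) \<Rightarrow> nat \<Rightarrow> int" where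
  "coord n j = (\<Sum>k\<in>{1..l}. n k * simple_coord k j)"

lemma comb_coord_element: "comb n (coord_element j) = of_int (coord n j)"
  unfolding comb_def coord_def by (simp add: coord_element)

lemma cartan_integer_comb:
  assumes "comb n \<in> roots H" "i \<in> {1..l}"
  shows "cartan_integer H (comb n) (\<alpha> i) = of_int (dot i (coord n))"
proof -
  let ?t = "riesz H (\<alpha> i)"
  have "cartan_integer H (comb n) (\<alpha> i) =
      (\<Sum>k\<in>{1..l}. of_int (n k) * (2 * \<alpha> k ?t / \<alpha> i ?t))"
    unfolding cartan_integer_eval[OF assms(1) alpha_root[OF assms(2)]]
    by (simp add: comb_def sum_distrib_left sum_divide_distrib mult.left_commute)
  also have "\<dots> = (\<Sum>k\<in>{1..l}. of_int (n k) * of_int (dot i (simple_coord k)))"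
    using assms(2)
    by (intro sum.cong refl) (simp add: cartan_matrix[symmetric] cartan_integer_eval alpha_root)
  also have "\<dots> = of_int (dot i (coord n))"
    unfolding coord_def dot_linear by simp
  finally show ?thesis .
qed

lemma comb_update:
  assumes "i \<in> {1..l}"
  shows "comb (n(i := n i + m)) h = comb n h + of_int m * \<alpha> i h"
proof -
  have "comb (n(i := n i + m)) h =
      (\<Sum>j\<in>{1..l}. of_int (n j) * \<alpha> j h + (if j = i then of_int m * \<alpha> i h else 0))"
    unfolding comb_def by (intro sum.cong) (auto simp: algebra_simps)
  also have "\<dots> = comb n h + of_int m * \<alpha> i h"
    using assms by (simp add: comb_def sum.distrib)
  finally show ?thesis .
qed

lemma coord_update:
  assumes "i \<in> {1..l}"
  shows "coord (n(i := n i + m)) j = coord n j + m * simple_coord i j"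
proof -
  have "coord (n(i := n i + m)) j =
      (\<Sum>k\<in>{1..l}. n k * simple_coord k j + (if k = i then m * simple_coord i j else 0))"
    unfolding coord_def by (intro sum.cong) (auto simp: algebra_simps)
  also have "\<dots> = coord n j + m * simple_coord i j"
    using assms by (simp add: coord_def sum.distrib)
  finally show ?thesis .
qed

lemma reflection:
  assumes "comb n \<in> roots H" "i \<in> {1..l}"
  shows "comb (n(i := n i - dot i (coord n))) \<in> roots H"
proof -
  obtain m where m: "cartan_integer H (comb n) (\<alpha> i) = of_int m" "ray (comb n) (\<alpha> i) (- m) \<in> roots H"
    using cartan_integer_integer[OF alpha_root[OF assms(2)] assms(1)] .
  then have "m = dot i (coord n)" using cartan_integer_comb[OF assms] by simp
  moreover have "ray (comb n) (\<alpha> i) (- m) = comb (n(i := n i + (- m)))"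
    unfolding comb_update[OF assms(2)] ray_def by (intro ext) (simp only: comb_update[OF assms(2)])
  ultimately show ?thesis using m(2) by simp
qed

text \<open>Reflecting in a simple root of positive inner product lowers the height of a positive
  root until it is simple, and reflections preserve the inner product.\<close>

lemma positive_root_norm:
  assumes "comb n \<in> roots H" "\<forall>i\<in>{1..l}. 0 \<le> n i"
  shows "(\<Sum>j\<in>{1..l}. (coord n j)\<^sup>2) = 2"
  using assms
proof (induction "nat (\<Sum>i\<in>{1..l}. n i)" arbitrary: n rule: less_induct)
  case less
  let ?v = "coord n"
  have "(\<Sum>i\<in>{1..l}. n i * dot i ?v) = (\<Sum>i\<in>{1..l}. \<Sum>j\<in>{1..l}. ?v j * (n i * simple_coord i j))"
    by (intro sum.cong) (auto simp: dot_sum sum_distrib_left algebra_simps)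
  also have "\<dots> = (\<Sum>j\<in>{1..l}. \<Sum>i\<in>{1..l}. ?v j * (n i * simple_coord i j))"
    by (rule sum.swap)
  also have "\<dots> = (\<Sum>j\<in>{1..l}. (?v j)\<^sup>2)"
    by (simp add: coord_def sum_distrib_left power2_eq_square)
  finally have norm: "(\<Sum>i\<in>{1..l}. n i * dot i ?v) = (\<Sum>j\<in>{1..l}. (?v j)\<^sup>2)" .
  have "\<exists>i\<in>{1..l}. n i \<noteq> 0 \<and> 0 < dot i ?v"
  proof (rule ccontr)
    assume "\<not> ?thesis"
    then have np: "n i * dot i ?v \<le> 0" if "i \<in> {1..l}" for i
      using that less.prems(2) by (cases "n i = 0") (auto simp: mult_nonneg_nonpos not_less)
    then have "(\<Sum>i\<in>{1..l}. n i * dot i ?v) \<le> 0" by (rule sum_nonpos)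
    moreover have "0 \<le> (\<Sum>j\<in>{1..l}. (?v j)\<^sup>2)" by (intro sum_nonneg) simp
    ultimately have "(\<Sum>j\<in>{1..l}. (?v j)\<^sup>2) = 0" using norm by linarith
    then have "\<forall>j\<in>{1..l}. (?v j)\<^sup>2 = 0" by (subst (asm) sum_nonneg_eq_0_iff) auto
    then have z: "?v j = 0" if "j \<in> {1..l}" for j using that by auto
    have dz: "dot i ?v = 0" if "i \<in> {1..l}" for i using z that by (simp add: dot_sum)
    \<comment> \<open>A root orthogonal to all simple roots is orthogonal to itself.\<close>
    have "(comb n) (riesz H (comb n)) = 0"
    proof -
      have "(\<alpha> i) (riesz H (comb n)) = 0" if i: "i \<in> {1..l}" for i
      proof -
        have "cartan_integer H (comb n) (\<alpha> i) = 0"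
          using cartan_integer_comb[OF less.prems(1) i] dz[OF i] by simp
        then have "root_form H (comb n) (\<alpha> i) = 0"
          using root_norm_nonzero[OF alpha_root[OF i]] root_form_eq[OF alpha_root[OF i] alpha_root[OF i]]
          by (simp add: cartan_integer_def)
        then show ?thesis
          using root_form_sym[of "comb n" "\<alpha> i"] root_form_eq[OF alpha_root[OF i] less.prems(1)]
          by simp
      qed
      then show ?thesis by (simp add: comb_def)
    qed
    then show False using root_norm_nonzero[OF less.prems(1)] by simp
  qed
  then obtain i where i: "i \<in> {1..l}" "n i \<noteq> 0" "0 < dot i ?v" by blast
  show ?case
  proof (cases "\<forall>k\<in>{1..l}. k \<noteq> i \<longrightarrow> n k = 0")
    case True
    have "comb n = ray 0 (\<alpha> i) (n i)"
    proof (rule ext)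
      fix h
      have "comb n h = (\<Sum>k\<in>{1..l}. if k = i then of_int (n i) * \<alpha> i h else 0)"
        unfolding comb_def using True by (intro sum.cong) auto
      then show "comb n h = ray 0 (\<alpha> i) (n i) h" using i(1) by (simp add: ray_def)
    qed
    then have "n i = 1 \<or> n i = - 1" using multiple_root[OF alpha_root[OF i(1)]] less.prems(1) by metis
    then have ni: "n i = 1" using less.prems(2) i(1) by fastforce
    have v: "?v j = simple_coord i j" for j
    proof -
      have "?v j = (\<Sum>k\<in>{1..l}. if k = i then simple_coord i j else 0)"
        unfolding coord_def using True ni by (intro sum.cong) auto
      then show ?thesis using i(1) by simp
    qed
    have "(\<Sum>j\<in>{1..l}. (?v j)\<^sup>2) = dot i (simple_coord i)"
      unfolding v dot_sum[OF i(1)] by (simp add: power2_eq_square)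
    then show ?thesis using dot_simple_coord[OF i(1) i(1)] by simp
  next
    case False
    then obtain k where k: "k \<in> {1..l}" "k \<noteq> i" "n k \<noteq> 0" by blast
    let ?c = "dot i ?v"
    define n' where "n' = n(i := n i - ?c)"
    have r: "comb n' \<in> roots H" unfolding n'_def by (rule reflection[OF less.prems(1) i(1)])
    obtain m where m: "comb n' = comb m" "(\<forall>i\<in>{1..l}. 0 \<le> m i) \<or> (\<forall>i\<in>{1..l}. m i \<le> 0)"
      using root_comb[OF r] by metis
    have "n' j = m j" if "j \<in> {1..l}" for j using comb_inj[OF m(1) that] .
    moreover have "0 < n' k" using k less.prems(2) by (force simp: n'_def)
    ultimately have nonneg: "\<forall>i\<in>{1..l}. 0 \<le> n' i" using m(2) k(1) by (metis not_less)
    have "(\<Sum>j\<in>{1..l}. n' j) < (\<Sum>j\<in>{1..l}. n j)"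
      by (rule sum_strict_mono_ex1) (use i in \<open>auto simp: n'_def\<close>)
    moreover have "0 \<le> (\<Sum>j\<in>{1..l}. n' j)" using nonneg by (intro sum_nonneg) auto
    ultimately have "nat (\<Sum>j\<in>{1..l}. n' j) < nat (\<Sum>j\<in>{1..l}. n j)" by simp
    then have IH: "(\<Sum>j\<in>{1..l}. (coord n' j)\<^sup>2) = 2" using less.hyps r nonneg by blast
    have n'_add: "n' = n(i := n i + (- ?c))" by (simp add: n'_def)
    have "(\<Sum>j\<in>{1..l}. (coord n' j)\<^sup>2) =
        (\<Sum>j\<in>{1..l}. (?v j)\<^sup>2 + (?c * ?c * (simple_coord i j * simple_coord i j)
          - 2 * ?c * (simple_coord i j * ?v j)))"
      unfolding n'_add coord_update[OF i(1)]
      by (intro sum.cong) (auto simp: power2_eq_square algebra_simps)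
    also have "\<dots> = (\<Sum>j\<in>{1..l}. (?v j)\<^sup>2) + (?c * ?c * dot i (simple_coord i) - 2 * ?c * ?c)"
      by (simp add: sum.distrib sum_subtractf dot_sum[OF i(1)] sum_distrib_left)
    also have "\<dots> = (\<Sum>j\<in>{1..l}. (?v j)\<^sup>2)"
      by (simp add: dot_simple_coord[OF i(1) i(1)])
    finally show ?thesis using IH by simp
  qed
qed

lemma coord_uminus: "coord (\<lambda>i. - n i) j = - coord n j"
  by (simp add: coord_def sum_negf)

lemma root_norm:
  assumes "comb n \<in> roots H"
  shows "(\<Sum>j\<in>{1..l}. (coord n j)\<^sup>2) = 2"
proof -
  obtain m where m: "comb n = comb m" "(\<forall>i\<in>{1..l}. 0 \<le> m i) \<or> (\<forall>i\<in>{1..l}. m i \<le> 0)"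
    using root_comb[OF assms] by metis
  have e: "n j = m j" if "j \<in> {1..l}" for j using comb_inj[OF m(1) that] .
  show ?thesis
  proof (cases "\<forall>i\<in>{1..l}. 0 \<le> n i")
    case True
    then show ?thesis using positive_root_norm assms by blast
  next
    case False
    then have "\<forall>i\<in>{1..l}. n i \<le> 0" using m(2) e by auto
    moreover have "comb (\<lambda>i. - n i) = - comb n" by (intro ext) (simp add: comb_def sum_negf)
    then have "comb (\<lambda>i. - n i) \<in> roots H" using roots_neg[OF assms] by (simp only:)
    ultimately have "(\<Sum>j\<in>{1..l}. (coord (\<lambda>i. - n i) j)\<^sup>2) = 2"
      by (intro positive_root_norm) auto
    then show ?thesis by (simp add: coord_uminus)
  qed
qed

end

subsection \<open>Roots as pairs of signed indices\<close>

text \<open>The roots of type D are the \<open>\<epsilon>\<^sub>x + \<epsilon>\<^sub>y\<close> for signed indices \<open>x\<close>, \<open>y\<close> of different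
  absolute value, where \<open>\<epsilon>\<^sub>-\<^sub>x = - \<epsilon>\<^sub>x\<close>.\<close>

definition signed_indices :: "nat \<Rightarrow> int set" where
  "signed_indices l = {x. 1 \<le> \<bar>x\<bar> \<and> \<bar>x\<bar> \<le> int l}"

text \<open>An abelian ideal, seen as a symmetric relation on signed indices. The function \<open>lam\<close> is
  the grading by the simple roots outside \<open>I\<close>: adding \<open>\<epsilon>\<^sub>z - \<epsilon>\<^sub>y\<close> is allowed if it has
  nonnegative degree.\<close>

definition rel_ideals :: "nat \<Rightarrow> (int \<Rightarrow> int) \<Rightarrow> (int \<times> int) set set" where
  "rel_ideals l lam = {M.
    M \<subseteq> {(x, y). x \<in> signed_indices l \<and> y \<in> signed_indices l \<and> \<bar>x\<bar> \<noteq> \<bar>y\<bar> \<and> 0 < lam x + lam y} \<and>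
    sym M \<and>
    (\<forall>x y z. (x, y) \<in> M \<longrightarrow> z \<in> signed_indices l \<longrightarrow> lam y \<le> lam z \<longrightarrow>
       \<bar>z\<bar> \<noteq> \<bar>x\<bar> \<longrightarrow> \<bar>z\<bar> \<noteq> \<bar>y\<bar> \<longrightarrow> (x, z) \<in> M) \<and>
    (\<forall>x y z. (x, y) \<in> M \<longrightarrow> (- y, z) \<in> M \<longrightarrow> \<bar>x\<bar> = \<bar>z\<bar>)}"

text \<open>The value of \<open>\<epsilon>\<^sub>x\<close> in the grading that gives degree 0 to the simple roots with index in
  \<open>A\<close> and degree 2 to the others.\<close>

definition level :: "nat \<Rightarrow> nat set \<Rightarrow> int \<Rightarrow> int" where
  "level l A x = sgn x * ((\<Sum>k\<in>{nat \<bar>x\<bar>..<l}. if k \<in> A then 0 else 2)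
     + (if l \<in> A then 0 else 1) - (if l - 1 \<in> A then 0 else 1))"

lemma sum_squares_eq_2:
  fixes v :: "'b \<Rightarrow> int"
  assumes "finite S" "(\<Sum>j\<in>S. (v j)\<^sup>2) = 2"
  obtains a b where "a \<in> S" "b \<in> S" "a \<noteq> b" "\<bar>v a\<bar> = 1" "\<bar>v b\<bar> = 1"
    "\<And>j. j \<in> S \<Longrightarrow> j \<noteq> a \<Longrightarrow> j \<noteq> b \<Longrightarrow> v j = 0"
proof -
  have sq: "\<bar>m\<bar> = 1" if "m \<noteq> 0" "m\<^sup>2 \<le> 2" for m :: int
  proof (rule ccontr)
    assume "\<bar>m\<bar> \<noteq> 1"
    then have "2 \<le> \<bar>m\<bar>" using that(1) by simp
    then have "2\<^sup>2 \<le> \<bar>m\<bar>\<^sup>2" by (rule power_mono) simp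
    then show False using that(2) by simp
  qed
  have ex: "\<exists>a\<in>T. v a \<noteq> 0 \<and> (v a)\<^sup>2 \<le> (\<Sum>j\<in>T. (v j)\<^sup>2)"
    if T: "finite T" "(\<Sum>j\<in>T. (v j)\<^sup>2) \<noteq> 0" for T
  proof -
    obtain a where "a \<in> T" "v a \<noteq> 0" 
      using sum.not_neutral_contains_not_neutral[OF T(2)] by auto
    moreover have "(v a)\<^sup>2 \<le> (\<Sum>j\<in>T. (v j)\<^sup>2)"
      by (rule member_le_sum[OF \<open>a \<in> T\<close> _ T(1)]) simp
    ultimately show ?thesis by blast
  qed
  obtain a where a: "a \<in> S" "v a \<noteq> 0" "(v a)\<^sup>2 \<le> 2" using ex[OF assms(1)] assms(2) by auto
  then have a1: "\<bar>v a\<bar> = 1" using sq by blast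
  then have "(v a)\<^sup>2 = 1" by (metis power2_abs one_power2)
  then have s1: "(\<Sum>j\<in>S - {a}. (v j)\<^sup>2) = 1"
    using sum.remove[OF assms(1) a(1), of "\<lambda>j. (v j)\<^sup>2"] assms(2) by simp
  obtain b where b: "b \<in> S - {a}" "v b \<noteq> 0" "(v b)\<^sup>2 \<le> 1" using ex[of "S - {a}"] s1 assms(1) by auto
  then have b1: "\<bar>v b\<bar> = 1" using sq by simp
  then have "(v b)\<^sup>2 = 1" by (metis power2_abs one_power2)
  then have "(\<Sum>j\<in>S - {a} - {b}. (v j)\<^sup>2) = 0"
    using sum.remove[OF _ b(1), of "\<lambda>j. (v j)\<^sup>2"] assms(1) s1 by simp
  then have "\<forall>j\<in>S - {a} - {b}. (v j)\<^sup>2 = 0"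
    using assms(1) by (subst (asm) sum_nonneg_eq_0_iff) auto
  then show thesis using that[of a b] a(1) b(1) a1 b1 by auto
qed

context simple_lie_algebra_type_D
begin

abbreviation "S \<equiv> signed_indices l"

definition eps :: "nat \<Rightarrow> 'a \<Rightarrow> complex" where
  "eps j h = (\<Sum>k\<in>{j..<l}. \<alpha> k h) + (\<alpha> l h - \<alpha> (l - 1) h) / 2"

lemma eps_rec: "j < l \<Longrightarrow> eps j h = \<alpha> j h + eps (Suc j) h"
  by (simp add: eps_def sum.atLeast_Suc_lessThan)

lemma eps_last: "eps l h = (\<alpha> l h - \<alpha> (l - 1) h) / 2"
  by (simp add: eps_def)

lemma alpha_eps: "i < l \<Longrightarrow> \<alpha> i h = eps i h - eps (i + 1) h"
  by (simp add: eps_rec)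

lemma alpha_eps_last: "\<alpha> l h = eps (l - 1) h + eps l h"
proof -
  have "l - 1 < l" "Suc (l - 1) = l" using l_ge_4 by auto
  then have "eps (l - 1) h = \<alpha> (l - 1) h + eps l h" using eps_rec[of "l - 1" h] by (simp only:)
  then show ?thesis by (simp add: eps_last field_simps)
qed

lemma alpha_simple_coord:
  assumes "i \<in> {1..l}"
  shows "\<alpha> i h = (\<Sum>j\<in>{1..l}. of_int (simple_coord i j) * eps j h)"
proof (cases "i < l")
  case True
  then show ?thesis unfolding sum_simple_coord[OF assms] using alpha_eps by simp
next
  case False
  then have "i = l" using assms by simp
  then show ?thesis unfolding sum_simple_coord[OF assms] using alpha_eps_last by simp
qed

lemma comb_eps: "comb n h = (\<Sum>j\<in>{1..l}. of_int (coord n j) * eps j h)"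
proof -
  have "comb n h = (\<Sum>i\<in>{1..l}. \<Sum>j\<in>{1..l}. of_int (n i * simple_coord i j) * eps j h)"
    unfolding comb_def
    by (intro sum.cong refl) (simp add: alpha_simple_coord sum_distrib_left mult.assoc del: One_nat_def)
  also have "\<dots> = (\<Sum>j\<in>{1..l}. \<Sum>i\<in>{1..l}. of_int (n i * simple_coord i j) * eps j h)"
    by (rule sum.swap)
  finally show ?thesis by (simp add: coord_def sum_distrib_right)
qed

lemma eps_coord_element:
  assumes "1 \<le> i" "i \<le> l" "j \<in> {1..l}"
  shows "eps i (coord_element j) = of_bool (i = j)"
  using assms(2,1)
proof (induction i rule: inc_induct)
  case base
  have l: "l \<in> {1..l}" "l - 1 \<in> {1..l}" "l - 1 < l" "Suc (l - 1) = l" using l_ge_4 by auto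
  show ?case
    unfolding eps_last coord_element(2)[OF l(1)] coord_element(2)[OF l(2)]
    using l(3,4) l_ge_4 by (simp add: simple_coord_def)
next
  case (step i)
  then have i: "i < l" "i \<in> {1..l}" by auto
  have "eps i (coord_element j) = of_int (simple_coord i j) + of_bool (Suc i = j)"
    unfolding eps_rec[OF i(1)] coord_element(2)[OF i(2)] using step by simp
  then show ?case using i by (auto simp: simple_coord_def)
qed

definition seps :: "int \<Rightarrow> 'a \<Rightarrow> complex" where
  "seps x h = of_int (sgn x) * eps (nat \<bar>x\<bar>) h"

definition scoord :: "int \<Rightarrow> nat \<Rightarrow> int" where
  "scoord x j = sgn x * of_bool (nat \<bar>x\<bar> = j)"

definition pairing :: "int \<Rightarrow> int \<Rightarrow> int" where
  "pairing x y = of_bool (x = y) - of_bool (x = - y)"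

lemma seps_minus: "seps (- x) = - seps x"
  by (intro ext) (simp add: seps_def sgn_minus)

lemma S_minus [simp]: "- x \<in> S \<longleftrightarrow> x \<in> S"
  by (simp add: signed_indices_def)

lemma seps_coord_element:
  assumes "x \<in> S" "j \<in> {1..l}"
  shows "seps x (coord_element j) = of_int (scoord x j)"
proof -
  have "1 \<le> nat \<bar>x\<bar>" "nat \<bar>x\<bar> \<le> l" using assms(1) by (auto simp: signed_indices_def)
  then show ?thesis using eps_coord_element[OF _ _ assms(2)] by (simp add: seps_def scoord_def)
qed

lemma scoord_pairing:
  assumes "x \<in> S" "y \<in> S"
  shows "(\<Sum>j\<in>{1..l}. scoord x j * scoord y j) = pairing x y"
proof -
  have x: "nat \<bar>x\<bar> \<in> {1..l}" using assms by (auto simp: signed_indices_def)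
  have "(\<Sum>j\<in>{1..l}. scoord x j * scoord y j) =
      (\<Sum>j\<in>{1..l}. if j = nat \<bar>x\<bar> then sgn x * scoord y (nat \<bar>x\<bar>) else 0)"
    by (intro sum.cong) (auto simp: scoord_def)
  also have "\<dots> = sgn x * scoord y (nat \<bar>x\<bar>)" using x by simp
  also have "\<dots> = pairing x y"
    using assms by (auto simp: scoord_def pairing_def sgn_if signed_indices_def abs_if split: if_splits)
  finally show ?thesis .
qed

lemma root_coord_norm:
  assumes "\<beta> \<in> roots H" "\<And>j. j \<in> {1..l} \<Longrightarrow> \<beta> (coord_element j) = of_int (v j)"
  shows "(\<Sum>j\<in>{1..l}. (v j)\<^sup>2) = 2"
proof -
  obtain n where n: "\<beta> = comb n" using root_comb[OF assms(1)] by metis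
  have "coord n j = v j" if "j \<in> {1..l}" for j
    using assms(2)[OF that] comb_coord_element[of n j] n by simp
  then show ?thesis using root_norm[of n] assms(1) n by simp
qed

lemma root_pairing_2:
  assumes "x \<in> S" "y \<in> S" "seps x + seps y \<in> roots H"
  shows "pairing x y = 0"
proof -
  have "(\<Sum>j\<in>{1..l}. (scoord x j + scoord y j)\<^sup>2) = 2"
    using assms by (intro root_coord_norm[OF assms(3)]) (simp add: seps_coord_element)
  then have "pairing x x + pairing y y + 2 * pairing x y = 2"
    using assms(1,2)
    by (simp add: scoord_pairing[symmetric] power2_eq_square algebra_simps sum.distrib sum_distrib_left)
  moreover have "pairing x x = 1" "pairing y y = 1"
    using assms by (auto simp: pairing_def signed_indices_def)
  ultimately show ?thesis by simp
qed

lemma pairing_eq_0: "x \<in> S \<Longrightarrow> pairing x y = 0 \<longleftrightarrow> \<bar>x\<bar> \<noteq> \<bar>y\<bar>"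
  by (auto simp: pairing_def signed_indices_def of_bool_def abs_if split: if_splits)

text \<open>If no index cancelled, all inner products between the two roots would be nonnegative and the sum would
  have square length at least 4.\<close>

lemma root_sum_cancels:
  assumes "x \<in> S" "y \<in> S" "z \<in> S" "w \<in> S" "\<bar>x\<bar> \<noteq> \<bar>y\<bar>" "\<bar>z\<bar> \<noteq> \<bar>w\<bar>"
    and "(seps x + seps y) + (seps z + seps w) \<in> roots H"
  shows "z = - x \<or> z = - y \<or> w = - x \<or> w = - y"
proof -
  have "(\<Sum>j\<in>{1..l}. (scoord x j + scoord y j + (scoord z j + scoord w j))\<^sup>2) = 2"
    using assms(1-4) by (intro root_coord_norm[OF assms(7)]) (simp add: seps_coord_element)
  then have "pairing x x + pairing y y + pairing z z + pairing w w + 2 * pairing x y + 2 * pairing z w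
     + 2 * pairing x z + 2 * pairing x w + 2 * pairing y z + 2 * pairing y w = 2"
    using assms(1-4)
    by (simp add: scoord_pairing[symmetric] power2_eq_square algebra_simps sum.distrib sum_distrib_left)
  moreover have "pairing x x = 1" "pairing y y = 1" "pairing z z = 1" "pairing w w = 1"
    using assms(1-4) by (auto simp: pairing_def signed_indices_def)
  moreover have "pairing x y = 0" "pairing z w = 0" using assms by (simp_all add: pairing_eq_0)
  ultimately have "pairing x z + pairing x w + pairing y z + pairing y w < 0" by simp
  then have "pairing x z < 0 \<or> pairing x w < 0 \<or> pairing y z < 0 \<or> pairing y w < 0" by linarith
  moreover have "v = - u" if "pairing u v < 0" for u v
    using that by (auto simp: pairing_def of_bool_def split: if_splits)
  ultimately show ?thesis by blast
qed

lemma seps_sum_inj: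
  assumes "x \<in> S" "y \<in> S" "a \<in> S" "b \<in> S" "\<bar>x\<bar> \<noteq> \<bar>y\<bar>" "\<bar>a\<bar> \<noteq> \<bar>b\<bar>"
    and "seps x + seps y = seps a + seps b"
  shows "(x = a \<and> y = b) \<or> (x = b \<and> y = a)"
proof -
  have e: "scoord x j + scoord y j = scoord a j + scoord b j" if "j \<in> {1..l}" for j
  proof -
    have "(seps x + seps y) (coord_element j) = (seps a + seps b) (coord_element j)"
      using assms(7) by (rule fun_cong)
    then have "of_int (scoord x j + scoord y j) = (of_int (scoord a j + scoord b j) :: complex)"
      using assms(1-4) that by (simp add: seps_coord_element)
    then show ?thesis by (simp only: of_int_eq_iff)
  qed
  have p: "pairing u x + pairing u y = pairing u a + pairing u b" if u: "u \<in> S" for u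
  proof -
    have "(\<Sum>j\<in>{1..l}. scoord u j * (scoord x j + scoord y j)) =
        (\<Sum>j\<in>{1..l}. scoord u j * (scoord a j + scoord b j))"
      by (intro sum.cong refl) (simp only: e)
    then show ?thesis
      using assms(1-4) u by (simp add: scoord_pairing distrib_left sum.distrib del: One_nat_def)
  qed
  have "pairing x x = 1" "pairing y y = 1"
    using assms(1,2) by (auto simp: pairing_def signed_indices_def)
  moreover have "pairing x y = 0" "pairing y x = 0" using assms by (simp_all add: pairing_eq_0)
  ultimately have "pairing x a + pairing x b = 1" "pairing y a + pairing y b = 1"
    using p[OF assms(1)] p[OF assms(2)] by simp_all
  then have "x = a \<or> x = b" "y = a \<or> y = b"
    by (auto simp: pairing_def of_bool_def split: if_splits)
  then show ?thesis using assms(5) by auto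
qed

lemma root_is_pair:
  assumes "\<beta> \<in> roots H"
  obtains x y where "x \<in> S" "y \<in> S" "\<bar>x\<bar> \<noteq> \<bar>y\<bar>" "\<beta> = seps x + seps y"
proof -
  obtain n where n: "\<beta> = comb n" using root_comb[OF assms] by metis
  have "(\<Sum>j\<in>{1..l}. (coord n j)\<^sup>2) = 2" using root_norm[of n] assms n by simp
  then obtain a b where ab: "a \<in> {1..l}" "b \<in> {1..l}" "a \<noteq> b" "\<bar>coord n a\<bar> = 1" "\<bar>coord n b\<bar> = 1"
    "\<And>j. j \<in> {1..l} \<Longrightarrow> j \<noteq> a \<Longrightarrow> j \<noteq> b \<Longrightarrow> coord n j = 0"
    by (rule sum_squares_eq_2[OF finite_atLeastAtMost]) (rule that)
  define x y where "x = coord n a * int a" and "y = coord n b * int b"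
  have abs: "\<bar>x\<bar> = int a" "\<bar>y\<bar> = int b" using ab(4,5) by (simp_all add: x_def y_def abs_mult)
  have sgn: "sgn x = coord n a" "sgn y = coord n b"
    using ab(1,2,4,5) by (auto simp: x_def y_def sgn_mult abs_if split: if_splits)
  have "\<beta> h = (seps x + seps y) h" for h
  proof -
    have "\<beta> h = (\<Sum>j\<in>{1..l}. (if j = a then of_int (coord n a) * eps a h else 0)
        + (if j = b then of_int (coord n b) * eps b h else 0))"
      unfolding n comb_eps using ab(3,6) by (intro sum.cong) auto
    also have "\<dots> = of_int (coord n a) * eps a h + of_int (coord n b) * eps b h"
      using ab(1,2) by (simp add: sum.distrib)
    finally show ?thesis by (simp add: seps_def abs sgn)
  qed
  then have "\<beta> = seps x + seps y" by (rule ext)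
  moreover have "x \<in> S" "y \<in> S" using ab(1,2) abs by (auto simp: signed_indices_def)
  moreover have "\<bar>x\<bar> \<noteq> \<bar>y\<bar>" using abs ab(3) by simp
  ultimately show thesis using that by blast
qed

lemma add_simple_root:
  assumes "\<beta> \<in> roots H" "i \<in> {1..l}"
    and "\<And>j. j \<in> {1..l} \<Longrightarrow> \<beta> (coord_element j) = of_int (v j)" "dot i v = - 1"
  shows "(\<lambda>h. \<beta> h + \<alpha> i h) \<in> roots H"
proof -
  obtain n where n: "\<beta> = comb n" using root_comb[OF assms(1)] by metis
  have "coord n j = v j" if "j \<in> {1..l}" for j
    using assms(3)[OF that] comb_coord_element[of n j] n by simp
  then have "dot i (coord n) = - 1" using assms(4) by (simp add: dot_sum[OF assms(2)])
  then have "comb (n(i := n i + 1)) \<in> roots H" using reflection[of n i] assms(1,2) n by simp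
  moreover have "comb (n(i := n i + 1)) = (\<lambda>h. \<beta> h + \<alpha> i h)"
    using comb_update[OF assms(2), of n 1] n by (intro ext) simp
  ultimately show ?thesis by simp
qed

lemma eps_diff_root:
  assumes "1 \<le> i" "i < j" "j \<le> l"
  shows "(\<lambda>h. eps i h - eps j h) \<in> roots H"
  using Suc_leI[OF assms(2)] assms(3)
proof (induction j rule: dec_induct)
  case base
  have "(\<lambda>h. eps i h - eps (Suc i) h) = \<alpha> i" using alpha_eps[of i] base by (intro ext) simp
  then show ?case using alpha_root[of i] assms base by simp
next
  case (step j)
  have "(\<lambda>h. (eps i h - eps j h) + \<alpha> j h) \<in> roots H"
  proof (rule add_simple_root)
    show "(\<lambda>h. eps i h - eps j h) \<in> roots H" using step by simp
    show "j \<in> {1..l}" using step by simp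
    show "dot j (\<lambda>k. of_bool (i = k) - of_bool (j = k)) = - 1" using step by (simp add: dot_def)
    show "eps i (coord_element k) - eps j (coord_element k) = of_int (of_bool (i = k) - of_bool (j = k))"
      if "k \<in> {1..l}" for k
      using that step assms by (simp add: eps_coord_element)
  qed
  then show ?case using alpha_eps[of j] step by simp
qed

lemma eps_sum_root:
  assumes "1 \<le> i" "i < j" "j \<le> l"
  shows "(\<lambda>h. eps i h + eps j h) \<in> roots H"
  using assms(3,2)
proof (induction j rule: inc_induct)
  case base
  show ?case
  proof (cases "i = l - 1")
    case True
    have "(\<lambda>h. eps (l - 1) h + eps l h) = \<alpha> l" using alpha_eps_last by (intro ext) simp
    then show ?thesis using alpha_root[of l] True l_ge_4 by simp
  next
    case False
    have "(\<lambda>h. (eps i h - eps (l - 1) h) + \<alpha> l h) \<in> roots H"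
    proof (rule add_simple_root)
      show "(\<lambda>h. eps i h - eps (l - 1) h) \<in> roots H"
        using assms(1) base False by (intro eps_diff_root) auto
      show "l \<in> {1..l}" using l_ge_4 by simp
      show "dot l (\<lambda>k. of_bool (i = k) - of_bool (l - 1 = k)) = - 1"
        using False base l_ge_4 by (simp add: dot_def)
      show "eps i (coord_element k) - eps (l - 1) (coord_element k)
          = of_int (of_bool (i = k) - of_bool (l - 1 = k))" if "k \<in> {1..l}" for k
        using that assms(1) base l_ge_4 by (simp add: eps_coord_element)
    qed
    then show ?thesis using alpha_eps_last by (simp add: algebra_simps)
  qed
next
  case (step j)
  have "(\<lambda>h. (eps i h + eps (Suc j) h) + \<alpha> j h) \<in> roots H"
  proof (rule add_simple_root)
    show "(\<lambda>h. eps i h + eps (Suc j) h) \<in> roots H" using step by simp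
    show "j \<in> {1..l}" using step by simp
    show "dot j (\<lambda>k. of_bool (i = k) + of_bool (Suc j = k)) = - 1" using step by (simp add: dot_def)
    show "eps i (coord_element k) + eps (Suc j) (coord_element k)
        = of_int (of_bool (i = k) + of_bool (Suc j = k))" if "k \<in> {1..l}" for k
      using that assms(1) step by (simp add: eps_coord_element)
  qed
  then show ?case using alpha_eps[of j] step by simp
qed

text \<open>Every \<open>\<epsilon>\<^sub>i \<plusminus> \<epsilon>\<^sub>j\<close> is reached from a simple root by adding simple roots along the chain, each step
  having inner product \<open>- 1\<close>; the remaining pairs are negatives.\<close>

lemma pair_is_root:
  assumes "x \<in> S" "y \<in> S" "\<bar>x\<bar> \<noteq> \<bar>y\<bar>"
  shows "seps x + seps y \<in> roots H"
proof -
  have less: "seps x + seps y \<in> roots H" if "x \<in> S" "y \<in> S" "\<bar>x\<bar> < \<bar>y\<bar>" for x y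
  proof -
    let ?i = "nat \<bar>x\<bar>" and ?j = "nat \<bar>y\<bar>"
    have ij: "1 \<le> ?i" "?i < ?j" "?j \<le> l" using that by (auto simp: signed_indices_def)
    have pos: "(\<lambda>h. eps ?i h + eps ?j h) \<in> roots H" and neg: "(\<lambda>h. eps ?i h - eps ?j h) \<in> roots H"
      using eps_sum_root[OF ij] eps_diff_root[OF ij] .
    have "x \<noteq> 0" "y \<noteq> 0" using that by (auto simp: signed_indices_def)
    then consider "0 < x" "0 < y" | "0 < x" "y < 0" | "x < 0" "0 < y" | "x < 0" "y < 0" by linarith
    then show ?thesis
    proof cases
      case 1
      then have "seps x + seps y = (\<lambda>h. eps ?i h + eps ?j h)" by (intro ext) (simp add: seps_def)
      then show ?thesis using pos by (simp only:)
    next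
      case 2
      then have "seps x + seps y = (\<lambda>h. eps ?i h - eps ?j h)" by (intro ext) (simp add: seps_def)
      then show ?thesis using neg by (simp only:)
    next
      case 3
      then have "seps x + seps y = - (\<lambda>h. eps ?i h - eps ?j h)" by (intro ext) (simp add: seps_def)
      then show ?thesis using roots_neg[OF neg] by (simp only:)
    next
      case 4
      then have "seps x + seps y = - (\<lambda>h. eps ?i h + eps ?j h)" by (intro ext) (simp add: seps_def)
      then show ?thesis using roots_neg[OF pos] by (simp only:)
    qed
  qed
  show ?thesis
  proof (cases "\<bar>x\<bar> < \<bar>y\<bar>")
    case True
    then show ?thesis using less assms by blast
  next
    case False
    then have "seps y + seps x \<in> roots H" using less assms by force
    then show ?thesis by (simp only: add.commute)
  qed
qed

subsection \<open>The grading defined by a set of simple roots\<close>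

text \<open>The value 2 rather than 1 makes all \<open>\<epsilon>\<^sub>x\<close> integral: \<open>\<epsilon>\<^sub>l\<close> is \<open>(\<alpha>\<^sub>l - \<alpha>\<^sub>l\<^sub>-\<^sub>1) / 2\<close>.\<close>

definition grading_element :: "('a \<Rightarrow> complex) set \<Rightarrow> 'a" where
  "grading_element I = (SOME h. h \<in> H \<and> (\<forall>k\<in>{1..l}. \<alpha> k h = (if \<alpha> k \<in> I then 0 else 2)))"

lemma grading_element:
  "grading_element I \<in> H"
  "k \<in> {1..l} \<Longrightarrow> \<alpha> k (grading_element I) = (if \<alpha> k \<in> I then 0 else 2)"
proof -
  have "\<exists>h. h \<in> H \<and> (\<forall>k\<in>{1..l}. \<alpha> k h = (if \<alpha> k \<in> I then 0 else 2))"
    by (rule prescribe_alpha)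
  then have *: "grading_element I \<in> H \<and>
      (\<forall>k\<in>{1..l}. \<alpha> k (grading_element I) = (if \<alpha> k \<in> I then 0 else 2))"
    unfolding grading_element_def by (rule someI_ex)
  then show "grading_element I \<in> H" by blast
  show "k \<in> {1..l} \<Longrightarrow> \<alpha> k (grading_element I) = (if \<alpha> k \<in> I then 0 else 2)"
    using * by blast
qed

lemma seps_grading_element:
  assumes "x \<in> S"
  shows "seps x (grading_element I) = of_int (level l {i. \<alpha> i \<in> I} x)"
proof -
  have l: "l \<in> {1..l}" "l - 1 \<in> {1..l}" using l_ge_4 by auto
  have "(\<Sum>k\<in>{nat \<bar>x\<bar>..<l}. \<alpha> k (grading_element I)) =
      (\<Sum>k\<in>{nat \<bar>x\<bar>..<l}. of_int (if \<alpha> k \<in> I then 0 else 2))"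
    using assms by (intro sum.cong refl) (subst grading_element(2), auto simp: signed_indices_def)
  then show ?thesis
    unfolding seps_def eps_def level_def grading_element(2)[OF l(1)] grading_element(2)[OF l(2)]
    by simp
qed

lemma comb_grading_element:
  "comb n (grading_element I) = of_int (2 * (\<Sum>k | k \<in> {1..l} \<and> \<alpha> k \<notin> I. n k))"
proof -
  have "comb n (grading_element I) = (\<Sum>k\<in>{1..l}. if \<alpha> k \<notin> I then of_int (2 * n k) else 0)"
    unfolding comb_def
    by (intro sum.cong refl) (subst grading_element(2), auto)
  also have "\<dots> = (\<Sum>k\<in>{1..l} \<inter> {k. \<alpha> k \<notin> I}. of_int (2 * n k))"
    by (simp only: sum.inter_restrict[OF finite_atLeastAtMost] mem_Collect_eq)
  also have "{1..l} \<inter> {k. \<alpha> k \<notin> I} = {k. k \<in> {1..l} \<and> \<alpha> k \<notin> I}" by blast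
  finally show ?thesis by (simp add: sum_distrib_left)
qed

lemma group_closure_grading:
  assumes "I \<subseteq> P" "\<gamma> \<in> group_closure I"
  shows "\<gamma> (grading_element I) = 0"
  using assms(2)
proof (induction rule: group_closure.induct)
  case (base s)
  then show ?case
  proof (cases "s = 0")
    case False
    then have "s \<in> I" using base by simp
    then obtain k where "k \<in> {1..l}" "s = \<alpha> k" using assms(1) P_alpha by blast
    then show ?thesis using grading_element(2) \<open>s \<in> I\<close> by simp
  qed simp
qed simp

lemma comb_in_group_closure:
  assumes "\<And>k. k \<in> {1..l} \<Longrightarrow> n k \<noteq> 0 \<Longrightarrow> \<alpha> k \<in> I"
  shows "comb n \<in> group_closure I"
proof -
  have mult: "(\<lambda>h. of_nat m * \<gamma> h) \<in> group_closure I" if "\<gamma> \<in> I" for m :: nat and \<gamma>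
  proof (induction m)
    case 0
    have "(\<lambda>h. of_nat 0 * \<gamma> h) = 0" by (intro ext) simp
    then show ?case by (simp only: zero_in_group_closure)
  next
    case (Suc m)
    have "(\<lambda>h. of_nat (Suc m) * \<gamma> h) = (\<lambda>h. of_nat m * \<gamma> h) + \<gamma>"
      by (intro ext) (simp add: algebra_simps)
    moreover have "\<gamma> \<in> group_closure I" using that by (simp add: group_closure.base)
    ultimately show ?case using group_closure_add[OF Suc.IH] by (simp only:)
  qed
  have imult: "(\<lambda>h. of_int m * \<gamma> h) \<in> group_closure I" if "\<gamma> \<in> I" for m :: int and \<gamma>
  proof (cases "0 \<le> m")
    case True
    then show ?thesis using mult[OF that, of "nat m"] by simp
  next
    case False
    then have "(\<lambda>h. of_int m * \<gamma> h) = - (\<lambda>h. of_nat (nat (- m)) * \<gamma> h)" by (intro ext) simp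
    then show ?thesis using mult[OF that, of "nat (- m)"] by (simp only: group_closure_minus_iff)
  qed
  have "(\<lambda>h. \<Sum>k\<in>T. of_int (n k) * \<alpha> k h) \<in> group_closure I"
    if "finite T" "T \<subseteq> {1..l}" for T
    using that
  proof (induction T rule: finite_induct)
    case empty
    have "(\<lambda>h. \<Sum>k\<in>{}. of_int (n k) * \<alpha> k h) = 0" by (intro ext) simp
    then show ?case by (simp only: zero_in_group_closure)
  next
    case (insert k T)
    have "(\<lambda>h. of_int (n k) * \<alpha> k h) \<in> group_closure I"
    proof (cases "n k = 0")
      case True
      then have "(\<lambda>h. of_int (n k) * \<alpha> k h) = 0" by (intro ext) simp
      then show ?thesis by (simp only: zero_in_group_closure)
    next
      case False
      then show ?thesis using assms[of k] insert.prems imult by blast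
    qed
    moreover have "(\<lambda>h. \<Sum>k\<in>insert k T. of_int (n k) * \<alpha> k h) =
        (\<lambda>h. of_int (n k) * \<alpha> k h) + (\<lambda>h. \<Sum>k\<in>T. of_int (n k) * \<alpha> k h)"
      using insert.hyps by (intro ext) simp
    ultimately show ?case using group_closure_add insert.IH insert.prems by simp
  qed
  then show ?thesis unfolding comb_def by simp
qed

text \<open>The coefficients of a root all have the same sign, so its degree vanishes only if each simple
  root that occurs lies in \<open>I\<close>.\<close>

lemma root_grading:
  assumes I: "I \<subseteq> P" and \<beta>: "\<beta> \<in> roots H" and m: "\<beta> (grading_element I) = of_int m"
  shows "\<beta> \<in> pos_roots H P \<union> sub_roots H I \<longleftrightarrow> 0 \<le> m"
    and "\<beta> \<in> pos_roots H P - sub_roots H I \<longleftrightarrow> 0 < m"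
proof -
  let ?K = "{k. k \<in> {1..l} \<and> \<alpha> k \<notin> I}"
  obtain n where n: "\<beta> = comb n" "(\<forall>i\<in>{1..l}. 0 \<le> n i) \<or> (\<forall>i\<in>{1..l}. n i \<le> 0)"
    using root_comb[OF \<beta>] by metis
  have m': "m = 2 * (\<Sum>k\<in>?K. n k)"
    using m unfolding n(1) comb_grading_element by (simp only: of_int_eq_iff)
  have sub: "m = 0" if "\<beta> \<in> sub_roots H I"
  proof -
    have "\<beta> (grading_element I) = 0"
      using \<open>\<beta> \<in> sub_roots H I\<close> by (intro group_closure_grading[OF I]) (simp add: sub_roots_def)
    then show ?thesis using m by simp
  qed
  have sub': "\<beta> \<in> sub_roots H I" if "m = 0"
  proof -
    have "finite ?K" by simp
    moreover have "(\<Sum>k\<in>?K. \<bar>n k\<bar>) = 0"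
    proof -
      have "(\<Sum>k\<in>?K. \<bar>n k\<bar>) = \<bar>\<Sum>k\<in>?K. n k\<bar>"
      proof (cases "\<forall>i\<in>{1..l}. 0 \<le> n i")
        case True
        then have "(\<Sum>k\<in>?K. \<bar>n k\<bar>) = (\<Sum>k\<in>?K. n k)" by (intro sum.cong) auto
        moreover have "0 \<le> (\<Sum>k\<in>?K. n k)" using True by (intro sum_nonneg) auto
        ultimately show ?thesis by simp
      next
        case False
        then have neg: "\<forall>i\<in>{1..l}. n i \<le> 0" using n(2) by blast
        then have "(\<Sum>k\<in>?K. \<bar>n k\<bar>) = (\<Sum>k\<in>?K. - n k)" by (intro sum.cong) auto
        moreover have "(\<Sum>k\<in>?K. n k) \<le> 0" using neg by (intro sum_nonpos) auto
        ultimately show ?thesis by (simp add: sum_negf)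
      qed
      then show ?thesis using m' that by simp
    qed
    ultimately have "\<forall>k\<in>?K. n k = 0" by (simp add: sum_nonneg_eq_0_iff)
    then have "comb n \<in> group_closure I" by (intro comb_in_group_closure) blast
    then show ?thesis using \<beta> n(1) by (simp add: sub_roots_def)
  qed
  have pos: "0 \<le> m" if "\<beta> \<in> pos_roots H P"
  proof -
    obtain n' where n': "\<beta> = comb n'" "\<forall>i\<in>{1..l}. 0 \<le> n' i" using \<open>\<beta> \<in> pos_roots H P\<close> pos_root_iff by blast
    have "m = 2 * (\<Sum>k\<in>?K. n' k)"
      using m unfolding n'(1) comb_grading_element by (simp only: of_int_eq_iff)
    moreover have "0 \<le> (\<Sum>k\<in>?K. n' k)" using n'(2) by (intro sum_nonneg) auto
    ultimately show ?thesis by simp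
  qed
  have pos': "\<beta> \<in> pos_roots H P" if "0 < m"
  proof -
    have "\<not> (\<forall>i\<in>{1..l}. n i \<le> 0)"
    proof
      assume "\<forall>i\<in>{1..l}. n i \<le> 0"
      then have "(\<Sum>k\<in>?K. n k) \<le> 0" by (intro sum_nonpos) auto
      then show False using m' that by simp
    qed
    then show ?thesis using n \<beta> pos_root_iff by blast
  qed
  show "\<beta> \<in> pos_roots H P \<union> sub_roots H I \<longleftrightarrow> 0 \<le> m"
    using sub sub' pos pos' by (cases "m = 0") auto
  show "\<beta> \<in> pos_roots H P - sub_roots H I \<longleftrightarrow> 0 < m"
    using sub sub' pos pos' by (cases "m = 0") fastforce+
qed

end

subsection \<open>Abelian ideals as relations\<close>

context simple_lie_algebra_type_D
begin

lemma pos_roots_sum_nonzero: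
  assumes "\<beta> \<in> pos_roots H P" "\<gamma> \<in> pos_roots H P"
  shows "\<beta> + \<gamma> \<noteq> 0"
proof
  assume e: "\<beta> + \<gamma> = 0"
  have pos: "\<exists>m::int. \<delta> height_element = of_int m \<and> 0 < m" if d: "\<delta> \<in> pos_roots H P" for \<delta>
  proof -
    obtain n where n: "\<delta> \<in> roots H" "\<delta> = comb n" "\<forall>i\<in>{1..l}. 0 \<le> n i"
      using pos_root_iff[THEN iffD1, OF d] by (elim conjE exE)
    obtain m :: int where m: "\<delta> height_element = of_int m" "m \<noteq> 0"
      using root_height_integer[OF n(1)] .
    have "\<delta> height_element = of_int (\<Sum>i\<in>{1..l}. n i)"
      unfolding n(2) comb_def using height_element(2)[OF alpha_P] by simp
    then have "m = (\<Sum>i\<in>{1..l}. n i)" using m(1) by (simp only: of_int_eq_iff)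
    moreover have "0 \<le> (\<Sum>i\<in>{1..l}. n i)" using n(3) by (intro sum_nonneg) auto
    ultimately have "0 < m" using m(2) by simp
    with m(1) show ?thesis by blast
  qed
  obtain a b :: int where ab: "\<beta> height_element = of_int a" "\<gamma> height_element = of_int b" "0 < a" "0 < b"
    using pos[OF assms(1)] pos[OF assms(2)] by blast
  have "(\<beta> + \<gamma>) height_element = 0" using fun_cong[OF e, of height_element] by simp
  then have "of_int (a + b) = (0 :: complex)" using ab by simp
  then have "a + b = 0" by (simp only: of_int_eq_0_iff)
  then show False using ab by simp
qed

text \<open>One direction is \<open>bracket_nonzero\<close>. For the other, the bracket of two root spaces lies in a weight
  space whose weight is neither a root nor 0, the latter because both roots are positive.\<close>

lemma abelian_ideal_iff:
  assumes \<Phi>: "\<Phi> \<subseteq> pos_roots H P"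
  shows "abelian_on (ideal_of H \<Phi>) \<longleftrightarrow> (\<forall>\<beta>\<in>\<Phi>. \<forall>\<gamma>\<in>\<Phi>. \<beta> + \<gamma> \<notin> roots H)"
proof
  assume ab: "abelian_on (ideal_of H \<Phi>)"
  show "\<forall>\<beta>\<in>\<Phi>. \<forall>\<gamma>\<in>\<Phi>. \<beta> + \<gamma> \<notin> roots H"
  proof (intro ballI notI)
    fix \<beta> \<gamma> assume "\<beta> \<in> \<Phi>" "\<gamma> \<in> \<Phi>" and s: "\<beta> + \<gamma> \<in> roots H"
    then have r: "\<beta> \<in> roots H" "\<gamma> \<in> roots H" using \<Phi> pos_root_iff by blast+
    obtain x where x: "x \<in> root_space H \<beta>" "x \<noteq> 0" using root_space_nontrivial[OF r(1)] .
    obtain y where y: "y \<in> root_space H \<gamma>" "y \<noteq> 0" using root_space_nontrivial[OF r(2)] .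
    have "x \<in> ideal_of H \<Phi>" "y \<in> ideal_of H \<Phi>"
      using \<open>\<beta> \<in> \<Phi>\<close> \<open>\<gamma> \<in> \<Phi>\<close> x(1) y(1) unfolding ideal_of_def by (blast intro: span_base)+
    then have "[x, y]\<^sub>L = 0" using ab unfolding abelian_on_def by blast
    then show False using bracket_nonzero[OF r s x y] by blast
  qed
next
  assume nr: "\<forall>\<beta>\<in>\<Phi>. \<forall>\<gamma>\<in>\<Phi>. \<beta> + \<gamma> \<notin> roots H"
  let ?U = "\<Union>\<beta>\<in>\<Phi>. root_space H \<beta>"
  have 1: "[x, y]\<^sub>L = 0" if xy: "x \<in> ?U" "y \<in> ?U" for x y
  proof -
    obtain \<beta> \<gamma> where b: "\<beta> \<in> \<Phi>" "x \<in> root_space H \<beta>" and c: "\<gamma> \<in> \<Phi>" "y \<in> root_space H \<gamma>"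
      using xy by blast
    have "[x, y]\<^sub>L \<in> root_space H (\<beta> + \<gamma>)" using root_space_br b(2) c(2) by blast
    moreover have "\<beta> + \<gamma> \<notin> roots H" using nr b(1) c(1) by blast
    moreover have "\<beta> + \<gamma> \<noteq> 0" using pos_roots_sum_nonzero \<Phi> b(1) c(1) by blast
    moreover have "\<beta> + \<gamma> \<in> dual_space H"
    proof -
      have "\<beta> \<in> dual_space H" "\<gamma> \<in> dual_space H"
        using \<Phi> b(1) c(1) pos_root_iff roots_dual by blast+
      then show ?thesis using ray_dual[of \<beta> \<gamma> 1] unfolding ray_1 by blast
    qed
    ultimately show ?thesis unfolding roots_def by blast
  qed
  have 2: "[x, y]\<^sub>L = 0" if "x \<in> ?U" "y \<in> span ?U" for x y
  proof -
    have "subspace {y. [x, y]\<^sub>L = 0}" by (rule subspaceI) (auto simp: ad.zero ad.add ad.scale)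
    then have "span ?U \<subseteq> {y. [x, y]\<^sub>L = 0}" by (rule span_minimal[rotated]) (use 1 that in blast)
    then show ?thesis using that by blast
  qed
  have 3: "[x, y]\<^sub>L = 0" if "x \<in> span ?U" "y \<in> span ?U" for x y
  proof -
    have "subspace {x. [x, y]\<^sub>L = 0}" by (rule subspaceI) (auto simp: adl.zero adl.add adl.scale)
    then have "span ?U \<subseteq> {x. [x, y]\<^sub>L = 0}" by (rule span_minimal[rotated]) (use 2 that in blast)
    then show ?thesis using that by blast
  qed
  then show "abelian_on (ideal_of H \<Phi>)" unfolding abelian_on_def ideal_of_def by blast
qed

definition relation_of :: "('a \<Rightarrow> complex) set \<Rightarrow> (int \<times> int) set" where
  "relation_of \<Phi> = {(x, y). x \<in> S \<and> y \<in> S \<and> \<bar>x\<bar> \<noteq> \<bar>y\<bar> \<and> seps x + seps y \<in> \<Phi>}"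

definition roots_of :: "(int \<times> int) set \<Rightarrow> ('a \<Rightarrow> complex) set" where
  "roots_of M = {seps x + seps y | x y. (x, y) \<in> M}"

lemma pair_grading:
  assumes "x \<in> S" "y \<in> S"
  shows "(seps x + seps y) (grading_element I) = of_int (level l {i. \<alpha> i \<in> I} x + level l {i. \<alpha> i \<in> I} y)"
  using assms by (simp add: seps_grading_element)

lemma level_minus: "level l A (- x) = - level l A x"
  by (simp add: level_def sgn_minus)

lemma cancel_pair: "(seps x + seps y) + (seps (- y) + seps z) = seps x + seps z"
  unfolding seps_minus by (intro ext) simp

lemma relation_of_ideal:
  assumes I: "I \<subseteq> P" and \<Phi>: "\<Phi> \<in> abelian_ideal_sets H P I"
  shows "relation_of \<Phi> \<in> rel_ideals l (level l {i. \<alpha> i \<in> I})" (is "_ \<in> rel_ideals l ?lam")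
proof -
  have sub: "\<Phi> \<subseteq> pos_roots H P - sub_roots H I"
    and closed: "\<And>\<beta> \<gamma>. \<beta> \<in> \<Phi> \<Longrightarrow> \<gamma> \<in> pos_roots H P \<union> sub_roots H I \<Longrightarrow>
        \<beta> + \<gamma> \<in> pos_roots H P \<Longrightarrow> \<beta> + \<gamma> \<in> \<Phi>"
    and ab: "abelian_on (ideal_of H \<Phi>)"
    using \<Phi> unfolding abelian_ideal_sets_def ideal_sets_def by blast+
  have nr: "\<beta> + \<gamma> \<notin> roots H" if "\<beta> \<in> \<Phi>" "\<gamma> \<in> \<Phi>" for \<beta> \<gamma>
    using abelian_ideal_iff[of \<Phi>] sub ab that by blast
  have posl: "0 < ?lam x + ?lam y" if "x \<in> S" "y \<in> S" "\<bar>x\<bar> \<noteq> \<bar>y\<bar>" "seps x + seps y \<in> \<Phi>" for x y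
    using root_grading(2)[OF I pair_is_root pair_grading] that sub by blast
  have 1: "relation_of \<Phi> \<subseteq> {(x, y). x \<in> S \<and> y \<in> S \<and> \<bar>x\<bar> \<noteq> \<bar>y\<bar> \<and> 0 < ?lam x + ?lam y}"
    using posl by (auto simp: relation_of_def)
  have 2: "sym (relation_of \<Phi>)"
    unfolding sym_def relation_of_def by (auto simp: add.commute)
  have 3: "(x, z) \<in> relation_of \<Phi>"
    if xy: "(x, y) \<in> relation_of \<Phi>" and z: "z \<in> S" "?lam y \<le> ?lam z" "\<bar>z\<bar> \<noteq> \<bar>x\<bar>" "\<bar>z\<bar> \<noteq> \<bar>y\<bar>"
    for x y z
  proof -
    have xy': "x \<in> S" "y \<in> S" "\<bar>x\<bar> \<noteq> \<bar>y\<bar>" "seps x + seps y \<in> \<Phi>"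
      using xy by (auto simp: relation_of_def)
    have yS: "- y \<in> S" and yz: "\<bar>- y\<bar> \<noteq> \<bar>z\<bar>" and xz: "\<bar>x\<bar> \<noteq> \<bar>z\<bar>" using xy' z by auto
    have "0 \<le> ?lam (- y) + ?lam z" using z(2) by (simp add: level_minus)
    then have "seps (- y) + seps z \<in> pos_roots H P \<union> sub_roots H I"
      using root_grading(1)[OF I pair_is_root[OF yS z(1) yz] pair_grading[OF yS z(1)]] by blast
    moreover have "0 < ?lam x + ?lam z" using posl[OF xy'] z(2) by simp
    then have "seps x + seps z \<in> pos_roots H P"
      using root_grading(2)[OF I pair_is_root[OF xy'(1) z(1) xz] pair_grading[OF xy'(1) z(1)]] by blast
    ultimately have "seps x + seps z \<in> \<Phi>"
      using closed[OF xy'(4), of "seps (- y) + seps z"] unfolding cancel_pair by blast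
    then show ?thesis using xy' z(1) xz by (simp add: relation_of_def)
  qed
  have 4: "\<bar>x\<bar> = \<bar>z\<bar>" if xy: "(x, y) \<in> relation_of \<Phi>" "(- y, z) \<in> relation_of \<Phi>" for x y z
  proof (rule ccontr)
    assume "\<bar>x\<bar> \<noteq> \<bar>z\<bar>"
    then have "seps x + seps z \<in> roots H" using xy by (intro pair_is_root) (auto simp: relation_of_def)
    moreover have "(seps x + seps y) + (seps (- y) + seps z) \<notin> roots H"
      using xy by (intro nr) (auto simp: relation_of_def)
    ultimately show False unfolding cancel_pair by blast
  qed
  show ?thesis unfolding rel_ideals_def using 1 2 3 4 by blast
qed

text \<open>Up to the order of the indices in each pair, two roots with a root as sum have the form
  \<open>\<epsilon>\<^sub>x + \<epsilon>\<^sub>y\<close> and \<open>- \<epsilon>\<^sub>y + \<epsilon>\<^sub>w\<close>. These are the sums considered in \<open>rel_ideals\<close>.\<close>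

lemma cancel_normal_form:
  assumes "x \<in> S" "y \<in> S" "z \<in> S" "w \<in> S" "\<bar>x\<bar> \<noteq> \<bar>y\<bar>" "\<bar>z\<bar> \<noteq> \<bar>w\<bar>"
    and "(seps x + seps y) + (seps z + seps w) \<in> roots H"
  obtains x' y' w' where "x' = x \<and> y' = y \<or> x' = y \<and> y' = x"
    "z = - y' \<and> w = w' \<or> z = w' \<and> w = - y'" "\<bar>x'\<bar> \<noteq> \<bar>w'\<bar>"
    "(seps x + seps y) + (seps z + seps w) = seps x' + seps w'"
proof -
  have "\<exists>x' y' w'. (x' = x \<and> y' = y \<or> x' = y \<and> y' = x) \<and>
      (z = - y' \<and> w = w' \<or> z = w' \<and> w = - y')"
    using root_sum_cancels[OF assms] by blast
  then obtain x' y' w' where p: "x' = x \<and> y' = y \<or> x' = y \<and> y' = x"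
    "z = - y' \<and> w = w' \<or> z = w' \<and> w = - y'" by blast
  have S: "x' \<in> S" "w' \<in> S" using p assms(1-4) by auto
  have "seps x + seps y = seps x' + seps y'" using p(1) by (auto simp only: add.commute)
  moreover have "seps z + seps w = seps (- y') + seps w'" using p(2) by (auto simp only: add.commute)
  ultimately have e: "(seps x + seps y) + (seps z + seps w) = seps x' + seps w'"
    by (simp only: cancel_pair)
  then have "pairing x' w' = 0" using root_pairing_2[OF S] assms(7) by (simp only:)
  then have "\<bar>x'\<bar> \<noteq> \<bar>w'\<bar>" using pairing_eq_0[OF S(1)] by blast
  then show thesis using that p e by blast
qed

lemma roots_of_ideal:
  assumes I: "I \<subseteq> P" and M: "M \<in> rel_ideals l (level l {i. \<alpha> i \<in> I})"
  shows "roots_of M \<in> abelian_ideal_sets H P I"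
proof -
  let ?lam = "level l {i. \<alpha> i \<in> I}"
  have MS: "\<And>x y. (x, y) \<in> M \<Longrightarrow> x \<in> S \<and> y \<in> S \<and> \<bar>x\<bar> \<noteq> \<bar>y\<bar> \<and> 0 < ?lam x + ?lam y"
    and Msym: "\<And>x y. (x, y) \<in> M \<Longrightarrow> (y, x) \<in> M"
    and Mcl: "\<And>x y z. (x, y) \<in> M \<Longrightarrow> z \<in> S \<Longrightarrow> ?lam y \<le> ?lam z \<Longrightarrow> \<bar>z\<bar> \<noteq> \<bar>x\<bar> \<Longrightarrow> \<bar>z\<bar> \<noteq> \<bar>y\<bar> \<Longrightarrow> (x, z) \<in> M"
    and Mab: "\<And>x y z. (x, y) \<in> M \<Longrightarrow> (- y, z) \<in> M \<Longrightarrow> \<bar>x\<bar> = \<bar>z\<bar>"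
    using M unfolding rel_ideals_def sym_def by blast+
  have sub: "roots_of M \<subseteq> pos_roots H P - sub_roots H I"
  proof
    fix \<beta> assume "\<beta> \<in> roots_of M"
    then obtain x y where xy: "(x, y) \<in> M" "\<beta> = seps x + seps y" unfolding roots_of_def by blast
    then have s: "x \<in> S" "y \<in> S" "\<bar>x\<bar> \<noteq> \<bar>y\<bar>" "0 < ?lam x + ?lam y" using MS by blast+
    show "\<beta> \<in> pos_roots H P - sub_roots H I"
      unfolding xy(2) using root_grading(2)[OF I pair_is_root[OF s(1-3)] pair_grading[OF s(1,2)]] s(4)
      by blast
  qed
  have closed: "\<beta> + \<gamma> \<in> roots_of M"
    if b: "\<beta> \<in> roots_of M" and c: "\<gamma> \<in> pos_roots H P \<union> sub_roots H I"
      and s: "\<beta> + \<gamma> \<in> pos_roots H P" for \<beta> \<gamma>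
  proof -
    obtain x y where xy: "(x, y) \<in> M" "\<beta> = seps x + seps y" using b unfolding roots_of_def by blast
    then have xyS: "x \<in> S" "y \<in> S" "\<bar>x\<bar> \<noteq> \<bar>y\<bar>" using MS by blast+
    have "\<gamma> \<in> roots H" using c pos_root_iff unfolding sub_roots_def by blast
    then obtain z w where zw: "z \<in> S" "w \<in> S" "\<bar>z\<bar> \<noteq> \<bar>w\<bar>" "\<gamma> = seps z + seps w"
      by (rule root_is_pair)
    have "(seps x + seps y) + (seps z + seps w) \<in> roots H"
      using s pos_root_iff unfolding xy(2) zw(4) by blast
    from cancel_normal_form[OF xyS(1,2) zw(1,2) xyS(3) zw(3) this]
    obtain x' y' w' where n: "x' = x \<and> y' = y \<or> x' = y \<and> y' = x"
      "z = - y' \<and> w = w' \<or> z = w' \<and> w = - y'" "\<bar>x'\<bar> \<noteq> \<bar>w'\<bar>"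
      "(seps x + seps y) + (seps z + seps w) = seps x' + seps w'" by blast
    have "0 \<le> ?lam z + ?lam w"
      using root_grading(1)[OF I pair_is_root[OF zw(1-3)] pair_grading[OF zw(1,2)]] c zw(4) by blast
    then have "?lam y' \<le> ?lam w'" using n(2) by (auto simp: level_minus)
    moreover have "(x', y') \<in> M" using n(1) xy(1) Msym by blast
    moreover have "w' \<in> S" "\<bar>w'\<bar> \<noteq> \<bar>y'\<bar>" using n(2) zw by auto
    ultimately have "(x', w') \<in> M" using Mcl n(3) by metis
    then show ?thesis unfolding xy(2) zw(4) n(4) roots_of_def by blast
  qed
  have "\<beta> + \<gamma> \<notin> roots H" if b: "\<beta> \<in> roots_of M" and c: "\<gamma> \<in> roots_of M" for \<beta> \<gamma>
  proof
    assume s: "\<beta> + \<gamma> \<in> roots H"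
    obtain x y where xy: "(x, y) \<in> M" "\<beta> = seps x + seps y" using b unfolding roots_of_def by blast
    obtain z w where zw: "(z, w) \<in> M" "\<gamma> = seps z + seps w" using c unfolding roots_of_def by blast
    have S: "x \<in> S" "y \<in> S" "z \<in> S" "w \<in> S" "\<bar>x\<bar> \<noteq> \<bar>y\<bar>" "\<bar>z\<bar> \<noteq> \<bar>w\<bar>"
      using MS[OF xy(1)] MS[OF zw(1)] by blast+
    have "(seps x + seps y) + (seps z + seps w) \<in> roots H" using s unfolding xy(2) zw(2) .
    from cancel_normal_form[OF S this]
    obtain x' y' w' where n: "x' = x \<and> y' = y \<or> x' = y \<and> y' = x"
      "z = - y' \<and> w = w' \<or> z = w' \<and> w = - y'" "\<bar>x'\<bar> \<noteq> \<bar>w'\<bar>"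
      "(seps x + seps y) + (seps z + seps w) = seps x' + seps w'" by blast
    have "(x', y') \<in> M" "(- y', w') \<in> M" using n(1,2) xy(1) zw(1) Msym by blast+
    then show False using Mab n(3) by blast
  qed
  then have "abelian_on (ideal_of H (roots_of M))"
    using abelian_ideal_iff[of "roots_of M"] sub by blast
  then show ?thesis
    using sub closed unfolding abelian_ideal_sets_def ideal_sets_def by blast
qed

theorem bij_betw_abelian_ideals_relations:
  assumes I: "I \<subseteq> P"
  shows "bij_betw relation_of (abelian_ideal_sets H P I) (rel_ideals l (level l {i. \<alpha> i \<in> I}))"
proof (rule bij_betw_byWitness[where f' = roots_of])
  show "\<forall>\<Phi>\<in>abelian_ideal_sets H P I. roots_of (relation_of \<Phi>) = \<Phi>"
  proof
    fix \<Phi> assume "\<Phi> \<in> abelian_ideal_sets H P I"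
    then have "\<Phi> \<subseteq> roots H"
      unfolding abelian_ideal_sets_def ideal_sets_def pos_roots_def by blast
    then show "roots_of (relation_of \<Phi>) = \<Phi>"
      unfolding roots_of_def relation_of_def by (fastforce elim: root_is_pair)
  qed
  show "\<forall>M\<in>rel_ideals l (level l {i. \<alpha> i \<in> I}). relation_of (roots_of M) = M"
  proof
    fix M assume M: "M \<in> rel_ideals l (level l {i. \<alpha> i \<in> I})"
    have MS: "x \<in> S \<and> y \<in> S \<and> \<bar>x\<bar> \<noteq> \<bar>y\<bar>" if "(x, y) \<in> M" for x y
      using M that unfolding rel_ideals_def by blast
    have Msym: "(y, x) \<in> M" if "(x, y) \<in> M" for x y
      using M that unfolding rel_ideals_def sym_def by blast
    have "(x, y) \<in> M" if xy: "(x, y) \<in> relation_of (roots_of M)" for x y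
    proof -
      obtain a b where ab: "(a, b) \<in> M" "seps x + seps y = seps a + seps b"
        and xyS: "x \<in> S" "y \<in> S" "\<bar>x\<bar> \<noteq> \<bar>y\<bar>"
        using xy unfolding relation_of_def roots_of_def by blast
      have "(x = a \<and> y = b) \<or> (x = b \<and> y = a)"
        using seps_sum_inj[OF xyS(1,2) _ _ xyS(3) _ ab(2)] MS[OF ab(1)] by blast
      then show ?thesis using ab(1) Msym by blast
    qed
    moreover have "(x, y) \<in> relation_of (roots_of M)" if "(x, y) \<in> M" for x y
      using MS[OF that] that unfolding relation_of_def roots_of_def by blast
    ultimately show "relation_of (roots_of M) = M" by auto
  qed
  show "relation_of ` abelian_ideal_sets H P I \<subseteq> rel_ideals l (level l {i. \<alpha> i \<in> I})"
    using relation_of_ideal[OF I] by blast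
  show "roots_of ` rel_ideals l (level l {i. \<alpha> i \<in> I}) \<subseteq> abelian_ideal_sets H P I"
    using roots_of_ideal[OF I] by blast
qed

end

section \<open>Decomposing the abelian ideals into threshold graphs\<close>

text \<open>Symmetric loop-free relations whose vertices are totally preordered by dominance, that is, the
  threshold graphs with this dominance preorder.\<close>

definition threshold_graphs :: "int set \<Rightarrow> (int \<Rightarrow> int) \<Rightarrow> (int \<times> int) set set" where
  "threshold_graphs X lam = {M. M \<subseteq> X \<times> X \<and> sym M \<and> (\<forall>x. (x, x) \<notin> M) \<and>
    (\<forall>x y z. (x, y) \<in> M \<longrightarrow> z \<in> X \<longrightarrow> lam y \<le> lam z \<longrightarrow> z \<noteq> x \<longrightarrow> (x, z) \<in> M)}"

locale dominance =
  fixes l :: nat and lam :: "int \<Rightarrow> int"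
  assumes l_ge_4: "4 \<le> l"
    and lam_minus: "lam (- x) = - lam x"
    and lam_antimono: "1 \<le> x \<Longrightarrow> x \<le> y \<Longrightarrow> y \<le> int l \<Longrightarrow> lam y \<le> lam x"
    and lam_last_nonneg: "0 \<le> lam (int l)"
begin

abbreviation "S \<equiv> signed_indices l"
abbreviation "n \<equiv> int l"

lemma lam_nonneg: "1 \<le> x \<Longrightarrow> x \<le> n \<Longrightarrow> 0 \<le> lam x"
  using lam_antimono[of x n] lam_last_nonneg by simp

lemma lam_less: "1 \<le> y \<Longrightarrow> x \<le> n \<Longrightarrow> lam y < lam x \<Longrightarrow> x < y"
  using lam_antimono[of y x] by (cases "x < y") auto

lemma lam_pos_imp: "x \<in> S \<Longrightarrow> 0 < lam x \<Longrightarrow> 0 < x"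
proof (rule ccontr)
  assume x: "x \<in> S" "0 < lam x" "\<not> 0 < x"
  then have "0 \<le> lam (- x)" by (intro lam_nonneg) (auto simp: signed_indices_def)
  then show False using x lam_minus[of x] by simp
qed

lemma S_pos: "1 \<le> x \<Longrightarrow> x \<le> n \<Longrightarrow> x \<in> S" "1 \<le> x \<Longrightarrow> x \<le> n \<Longrightarrow> - x \<in> S"
  by (auto simp: signed_indices_def)

definition Q :: "int set" where
  "Q = {x. 1 \<le> x \<and> x \<le> n \<and> lam n < lam x}"

definition R :: "(int \<times> int) set set" where
  "R = rel_ideals l lam"

definition positive :: "(int \<times> int) set \<Rightarrow> bool" where
  "positive M \<longleftrightarrow> (\<forall>x y. (x, y) \<in> M \<longrightarrow> 0 < x \<and> 0 < y)"

text \<open>The mirror image of positivity under the sign change of \<open>\<epsilon>\<^sub>l\<close>.\<close>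

definition mirror_positive :: "(int \<times> int) set \<Rightarrow> bool" where
  "mirror_positive M \<longleftrightarrow> (\<forall>x y. (x, y) \<in> M \<longrightarrow> (0 < x \<and> x \<noteq> n \<or> x = - n) \<and> (0 < y \<and> y \<noteq> n \<or> y = - n))"

definition Ap :: "(int \<times> int) set set" where "Ap = {M \<in> R. positive M}"
definition Am :: "(int \<times> int) set set" where "Am = {M \<in> R. mirror_positive M}"
definition B :: "(int \<times> int) set set" where "B = R - Ap - Am"

lemma R_S: "M \<in> R \<Longrightarrow> (x, y) \<in> M \<Longrightarrow> x \<in> S \<and> y \<in> S \<and> \<bar>x\<bar> \<noteq> \<bar>y\<bar> \<and> 0 < lam x + lam y"
  and R_sym: "M \<in> R \<Longrightarrow> (x, y) \<in> M \<Longrightarrow> (y, x) \<in> M"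
  and R_closed: "M \<in> R \<Longrightarrow> (x, y) \<in> M \<Longrightarrow> z \<in> S \<Longrightarrow> lam y \<le> lam z \<Longrightarrow>
    \<bar>z\<bar> \<noteq> \<bar>x\<bar> \<Longrightarrow> (x, z) \<in> M \<or> z = - y"
  and R_abelian: "M \<in> R \<Longrightarrow> (x, y) \<in> M \<Longrightarrow> (- y, z) \<in> M \<Longrightarrow> \<bar>x\<bar> = \<bar>z\<bar>"
  unfolding R_def rel_ideals_def sym_def abs_eq_iff by blast+

lemma R_I:
  assumes "\<And>x y. (x, y) \<in> M \<Longrightarrow> x \<in> S \<and> y \<in> S \<and> \<bar>x\<bar> \<noteq> \<bar>y\<bar> \<and> 0 < lam x + lam y"
    and "\<And>x y. (x, y) \<in> M \<Longrightarrow> (y, x) \<in> M"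
    and "\<And>x y z. (x, y) \<in> M \<Longrightarrow> z \<in> S \<Longrightarrow> lam y \<le> lam z \<Longrightarrow> \<bar>z\<bar> \<noteq> \<bar>x\<bar> \<Longrightarrow> \<bar>z\<bar> \<noteq> \<bar>y\<bar> \<Longrightarrow> (x, z) \<in> M"
    and "\<And>x y z. (x, y) \<in> M \<Longrightarrow> (- y, z) \<in> M \<Longrightarrow> \<bar>x\<bar> = \<bar>z\<bar>"
  shows "M \<in> R"
  unfolding R_def rel_ideals_def sym_def using assms by blast

lemma finite_R: "finite R"
proof -
  have "S \<subseteq> {- n..n}" by (auto simp: signed_indices_def)
  then have "finite S" by (rule finite_subset) simp
  then have "finite (Pow (S \<times> S))" by simp
  moreover have "R \<subseteq> Pow (S \<times> S)" using R_S by fast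
  ultimately show ?thesis by (rule finite_subset[rotated])
qed

lemma thr_D:
  assumes "M \<in> threshold_graphs X lam"
  shows "(x, y) \<in> M \<Longrightarrow> x \<in> X \<and> y \<in> X \<and> x \<noteq> y"
    and "(x, y) \<in> M \<Longrightarrow> (y, x) \<in> M"
    and "(x, y) \<in> M \<Longrightarrow> z \<in> X \<Longrightarrow> lam y \<le> lam z \<Longrightarrow> z \<noteq> x \<Longrightarrow> (x, z) \<in> M"
  using assms unfolding threshold_graphs_def sym_def by blast+

lemma thr_I:
  assumes "\<And>x y. (x, y) \<in> M \<Longrightarrow> x \<in> X \<and> y \<in> X \<and> x \<noteq> y"
    and "\<And>x y. (x, y) \<in> M \<Longrightarrow> (y, x) \<in> M"
    and "\<And>x y z. (x, y) \<in> M \<Longrightarrow> z \<in> X \<Longrightarrow> lam y \<le> lam z \<Longrightarrow> z \<noteq> x \<Longrightarrow> z \<noteq> y \<Longrightarrow> (x, z) \<in> M"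
  shows "M \<in> threshold_graphs X lam"
proof -
  have "(x, z) \<in> M" if "(x, y) \<in> M" "z \<in> X" "lam y \<le> lam z" "z \<noteq> x" for x y z
    using assms(3)[of x y z] that by (cases "z = y") auto
  moreover have "M \<subseteq> X \<times> X" using assms(1) by auto
  moreover have "\<And>x. (x, x) \<notin> M" using assms(1) by blast
  ultimately show ?thesis unfolding threshold_graphs_def sym_def using assms(2) by blast
qed

subsection \<open>Ideals of positive pairs\<close>

text \<open>An index of level 0 has a negative of the same level. If \<open>n - 1\<close> and \<open>n\<close> both have level 0,
  a neighbour of an index of level 0 is also adjacent to the negative of one of these two, and a
  positive ideal has to avoid level 0. A single index \<open>n\<close> of level 0 is harmless, because the closure
  rule does not allow to replace \<open>n\<close> by \<open>- n\<close>.\<close>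

lemma Ap_threshold:
  assumes X: "X = {1..n} \<and> (0 < lam n \<or> 0 < lam (n - 1)) \<or> X = Q \<and> lam n = 0 \<and> lam (n - 1) = 0"
  shows "Ap = threshold_graphs X lam"
proof -
  have "n \<in> {1..n}" "n \<notin> Q" using l_ge_4 by (auto simp: Q_def)
  then have nQ: "{1..n} \<noteq> Q" by blast
  show ?thesis
  proof (intro set_eqI iffI)
  fix M assume "M \<in> Ap"
  then have M: "M \<in> R" and pos: "\<And>x y. (x, y) \<in> M \<Longrightarrow> 0 < x \<and> 0 < y"
    by (auto simp: Ap_def positive_def)
  have range: "1 \<le> x \<and> x \<le> n" if "(x, y) \<in> M" for x y
    using R_S[OF M that] pos[OF that] by (auto simp: signed_indices_def)
  have XM: "x \<in> X" if xy: "(x, y) \<in> M" for x y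
  proof (cases "X = {1..n}")
    case True
    then show ?thesis using range[OF xy] by simp
  next
    case False
    then have XQ: "X = Q" "lam n = 0" "lam (n - 1) = 0" using X by auto
    have "lam x \<noteq> 0"
    proof
      assume x0: "lam x = 0"
      have yx: "(y, x) \<in> M" by (rule R_sym[OF M xy])
      have "0 < lam y" using R_S[OF M xy] x0 by simp
      then have "y \<noteq> n" "y \<noteq> n - 1" using XQ by auto
      \<comment> \<open>one of the two last indices differs from \<open>x\<close>, and its negative has the same level\<close>
      define z where "z = (if x = n then n - 1 else n)"
      have z: "z \<noteq> x" "z \<noteq> y" "lam z = 0" "1 \<le> z" "z \<le> n"
        using XQ \<open>y \<noteq> n\<close> \<open>y \<noteq> n - 1\<close> l_ge_4 by (auto simp: z_def)
      have "(y, - z) \<in> M \<or> - z = - x"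
        using z x0 lam_minus[of z] range[OF xy] pos[OF xy] S_pos
        by (intro R_closed[OF M yx]) auto
      then show False using z pos[of y "- z"] by auto
    qed
    then show ?thesis using range[OF xy] lam_nonneg[of x] XQ by (auto simp: Q_def)
  qed
  show "M \<in> threshold_graphs X lam"
  proof (rule thr_I)
    show "x \<in> X \<and> y \<in> X \<and> x \<noteq> y" if "(x, y) \<in> M" for x y
      using XM[OF that] XM[OF R_sym[OF M that]] R_S[OF M that] by auto
    show "(y, x) \<in> M" if "(x, y) \<in> M" for x y by (rule R_sym[OF M that])
    show "(x, z) \<in> M" if "(x, y) \<in> M" "z \<in> X" "lam y \<le> lam z" "z \<noteq> x" "z \<noteq> y" for x y z
    proof -
      have z: "1 \<le> z" "z \<le> n" using that(2) X by (auto simp: Q_def)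
      have "(x, z) \<in> M \<or> z = - y"
        using that(3,4) z pos[OF that(1)] S_pos(1)[OF z] by (intro R_closed[OF M that(1)]) auto
      then show ?thesis using z pos[OF that(1)] by auto
    qed
  qed
next
  fix M assume M: "M \<in> threshold_graphs X lam"
  have Xr: "1 \<le> x \<and> x \<le> n" if "x \<in> X" for x using that X by (auto simp: Q_def)
  have pos: "0 < x \<and> 0 < y" if "(x, y) \<in> M" for x y using thr_D(1)[OF M that] Xr by force
  have n0: "0 < lam y \<or> y = n \<and> X = {1..n}" if "y \<in> X" for y
  proof (cases "X = {1..n} \<and> lam n = 0")
    case True
    then have "0 < lam (n - 1)" using X nQ by auto
    moreover have "lam (n - 1) \<le> lam y" if "y \<noteq> n"
      using Xr[OF \<open>y \<in> X\<close>] that by (intro lam_antimono) auto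
    ultimately show ?thesis using True by (cases "y = n") auto
  next
    case False
    then have "X = {1..n} \<and> 0 < lam n \<or> X = Q \<and> lam n = 0" using X lam_last_nonneg by auto
    then show ?thesis using lam_antimono[of y n] Xr[OF that] that by (auto simp: Q_def)
  qed
  have "M \<in> R"
  proof (rule R_I)
    fix x y assume xy: "(x, y) \<in> M"
    then have x: "x \<in> X" "y \<in> X" "x \<noteq> y" using thr_D(1)[OF M] by blast+
    have "0 < lam x + lam y"
      using n0[OF x(1)] n0[OF x(2)] x(3) lam_nonneg Xr[OF x(1)] Xr[OF x(2)] by force
    then show "x \<in> S \<and> y \<in> S \<and> \<bar>x\<bar> \<noteq> \<bar>y\<bar> \<and> 0 < lam x + lam y"
      using x Xr S_pos(1) pos[OF xy] by auto
  next
    show "(y, x) \<in> M" if "(x, y) \<in> M" for x y by (rule thr_D(2)[OF M that])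
  next
    fix x y z assume xy: "(x, y) \<in> M" and z: "z \<in> S" "lam y \<le> lam z" "\<bar>z\<bar> \<noteq> \<bar>x\<bar>" "\<bar>z\<bar> \<noteq> \<bar>y\<bar>"
    have y: "y \<in> X" using thr_D(1)[OF M xy] by blast
    have "0 < z"
    proof (rule ccontr)
      assume "\<not> 0 < z"
      then have mz: "1 \<le> - z" "- z \<le> n" using z(1) by (auto simp: signed_indices_def)
      then have "lam z \<le> 0" using lam_nonneg[of "- z"] lam_minus[of z] by simp
      moreover have "0 \<le> lam y" using lam_nonneg Xr[OF y] by blast
      ultimately have 0: "lam y = 0" "lam z = 0" using z(2) by simp_all
      then have "y = n" "X = {1..n}" using n0[OF y] by auto
      then have "lam n = 0" "0 < lam (n - 1)" using 0 X nQ by auto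
      then have "lam (n - 1) > lam (- z)" using 0 lam_minus[of z] by simp
      then have "n - 1 < - z" using mz(1) by (rule lam_less[rotated 2]) simp
      then show False using mz z(4) \<open>y = n\<close> by simp
    qed
    moreover from this have "z \<in> X"
      using X z(1,2) n0[OF y] y by (auto simp: signed_indices_def Q_def)
    ultimately show "(x, z) \<in> M" using thr_D(3)[OF M xy _ z(2)] z(3) by auto
  next
    fix x y z assume "(x, y) \<in> M" "(- y, z) \<in> M"
    then show "\<bar>x\<bar> = \<bar>z\<bar>" using pos[of x y] pos[of "- y" z] by simp
  qed
  then show "M \<in> Ap" using pos by (simp add: Ap_def positive_def)
  qed
qed

subsection \<open>The mirror image\<close>

definition flip :: "int \<Rightarrow> int" where
  "flip x = (if \<bar>x\<bar> = n then - x else x)"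

lemma flip_flip [simp]: "flip (flip x) = x" and abs_flip [simp]: "\<bar>flip x\<bar> = \<bar>x\<bar>"
  and flip_minus: "flip (- x) = - flip x"
  by (auto simp: flip_def)

lemma card_mirror:
  assumes "lam n = 0"
  shows "card Am = card Ap"
proof -
  let ?F = "\<lambda>M. {(x, y). (flip x, flip y) \<in> M}"
  have lf: "lam (flip x) = lam x" for x
  proof (cases "\<bar>x\<bar> = n")
    case True
    then have "x = n \<or> x = - n" by auto
    then show ?thesis using assms lam_minus[of n] by (auto simp: flip_def)
  qed (simp add: flip_def)
  have fS: "flip x \<in> S \<longleftrightarrow> x \<in> S" for x by (simp add: signed_indices_def)
  have FR: "?F M \<in> R" if M: "M \<in> R" for M
  proof (rule R_I)
    fix x y assume "(x, y) \<in> ?F M"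
    then show "x \<in> S \<and> y \<in> S \<and> \<bar>x\<bar> \<noteq> \<bar>y\<bar> \<and> 0 < lam x + lam y"
      using R_S[OF M, of "flip x" "flip y"] by (simp add: fS lf)
  next
    fix x y assume "(x, y) \<in> ?F M"
    then show "(y, x) \<in> ?F M" using R_sym[OF M] by blast
  next
    fix x y z assume "(x, y) \<in> ?F M" "z \<in> S" "lam y \<le> lam z" "\<bar>z\<bar> \<noteq> \<bar>x\<bar>" "\<bar>z\<bar> \<noteq> \<bar>y\<bar>"
    then have "(flip x, flip z) \<in> M \<or> flip z = - flip y"
      by (intro R_closed[OF M]) (auto simp: fS lf)
    then show "(x, z) \<in> ?F M" using \<open>\<bar>z\<bar> \<noteq> \<bar>y\<bar>\<close> by (metis (mono_tags, lifting) abs_flip abs_minus_cancel case_prodI mem_Collect_eq)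
  next
    fix x y z assume "(x, y) \<in> ?F M" "(- y, z) \<in> ?F M"
    then have "\<bar>flip x\<bar> = \<bar>flip z\<bar>"
      by (intro R_abelian[OF M, of "flip x" "flip y" "flip z"]) (auto simp: flip_minus)
    then show "\<bar>x\<bar> = \<bar>z\<bar>" by simp
  qed
  have F2: "?F (?F M) = M" for M by auto
  have fpos: "0 < flip x \<longleftrightarrow> (0 < x \<and> x \<noteq> n \<or> x = - n)" for x
    using l_ge_4 by (auto simp: flip_def)
  have FA: "?F M \<in> Ap \<longleftrightarrow> M \<in> Am" if "M \<in> R" for M
  proof -
    have "positive (?F M) \<longleftrightarrow> mirror_positive M"
    proof
      assume "positive (?F M)"
      then have p: "0 < x \<and> 0 < y" if "(flip x, flip y) \<in> M" for x y
        using that unfolding positive_def by blast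
      show "mirror_positive M"
        unfolding mirror_positive_def
      proof (intro allI impI)
        fix x y assume "(x, y) \<in> M"
        then have "0 < flip x \<and> 0 < flip y" by (intro p) simp
        then show "(0 < x \<and> x \<noteq> n \<or> x = - n) \<and> (0 < y \<and> y \<noteq> n \<or> y = - n)" by (simp add: fpos)
      qed
    next
      assume m: "mirror_positive M"
      show "positive (?F M)"
        unfolding positive_def
      proof (intro allI impI)
        fix x y assume "(x, y) \<in> ?F M"
        then have "(0 < flip x \<and> flip x \<noteq> n \<or> flip x = - n) \<and> (0 < flip y \<and> flip y \<noteq> n \<or> flip y = - n)"
          using m unfolding mirror_positive_def by blast
        then have "0 < flip (flip x) \<and> 0 < flip (flip y)"
          by (simp only: fpos[of "flip x"] fpos[of "flip y"])
        then show "0 < x \<and> 0 < y" by simp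
      qed
    qed
    then show ?thesis using FR[OF that] that by (simp add: Ap_def Am_def)
  qed
  have "bij_betw ?F Am Ap"
  proof (rule bij_betw_byWitness[where f' = ?F])
    show "\<forall>M\<in>Am. ?F (?F M) = M" "\<forall>M\<in>Ap. ?F (?F M) = M" using F2 by blast+
    show "?F ` Am \<subseteq> Ap" using FA by (auto simp: Am_def)
    show "?F ` Ap \<subseteq> Am"
    proof (rule image_subsetI)
      fix M assume "M \<in> Ap"
      then have "M \<in> R" by (simp add: Ap_def)
      then have "?F (?F M) \<in> Ap \<longleftrightarrow> ?F M \<in> Am" using FA FR by blast
      then show "?F M \<in> Am" using \<open>M \<in> Ap\<close> unfolding F2 by blast
    qed
  qed
  then show ?thesis by (rule bij_betw_same_card)
qed

lemma Ap_Int_Am: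
  assumes "lam n = 0" "0 < lam (n - 1)"
  shows "Ap \<inter> Am = threshold_graphs Q lam"
proof -
  have Q: "Q = {1..n - 1}"
  proof (intro set_eqI iffI)
    fix x assume x: "x \<in> Q"
    then have "x \<noteq> n" by (auto simp: Q_def)
    then show "x \<in> {1..n - 1}" using x by (simp add: Q_def)
  next
    fix x assume x: "x \<in> {1..n - 1}"
    then show "x \<in> Q" using lam_antimono[of x "n - 1"] assms by (simp add: Q_def)
  qed
  have Ap: "Ap = threshold_graphs {1..n} lam" using Ap_threshold[of "{1..n}"] assms by blast
  show ?thesis
  proof (intro set_eqI iffI)
    fix M assume "M \<in> Ap \<inter> Am"
    then have M: "M \<in> threshold_graphs {1..n} lam" and "mirror_positive M" "positive M"
      using Ap by (auto simp: Ap_def Am_def)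
    then have nn: "x \<noteq> n \<and> y \<noteq> n" if "(x, y) \<in> M" for x y
      using that unfolding mirror_positive_def positive_def by fastforce
    show "M \<in> threshold_graphs Q lam"
    proof (rule thr_I)
      show "x \<in> Q \<and> y \<in> Q \<and> x \<noteq> y" if "(x, y) \<in> M" for x y
        using thr_D(1)[OF M that] nn[OF that] by (auto simp: Q)
      show "(y, x) \<in> M" if "(x, y) \<in> M" for x y by (rule thr_D(2)[OF M that])
      show "(x, z) \<in> M" if "(x, y) \<in> M" "z \<in> Q" "lam y \<le> lam z" "z \<noteq> x" for x y z
        using that by (intro thr_D(3)[OF M that(1)]) (auto simp: Q)
    qed
  next
    fix M assume M: "M \<in> threshold_graphs Q lam"
    have "M \<in> threshold_graphs {1..n} lam"
    proof (rule thr_I)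
      show "x \<in> {1..n} \<and> y \<in> {1..n} \<and> x \<noteq> y" if "(x, y) \<in> M" for x y
        using thr_D(1)[OF M that] by (auto simp: Q)
      show "(y, x) \<in> M" if "(x, y) \<in> M" for x y by (rule thr_D(2)[OF M that])
      show "(x, z) \<in> M" if "(x, y) \<in> M" "z \<in> {1..n}" "lam y \<le> lam z" "z \<noteq> x" for x y z
      proof -
        have "y \<in> Q" using thr_D(1)[OF M that(1)] by blast
        then have "z \<in> Q" using that(2,3) by (auto simp: Q_def)
        then show ?thesis using thr_D(3)[OF M that(1)] that by blast
      qed
    qed
    then have "M \<in> Ap" using Ap by blast
    moreover from this have "M \<in> R" by (simp add: Ap_def)
    moreover have "mirror_positive M"
      unfolding mirror_positive_def using thr_D(1)[OF M] by (force simp: Q)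
    ultimately show "M \<in> Ap \<inter> Am" by (simp add: Am_def)
  qed
qed

subsection \<open>The remaining ideals\<close>

text \<open>All indices from 1 to \<open>a\<close> are at least as high as \<open>a\<close> and may replace it.\<close>

lemma negative_pair:
  assumes M: "M \<in> R" and ab: "(a, - b) \<in> M" and b: "0 < b"
  shows "1 \<le> a" "a < b" "b \<le> n" "lam b < lam a" "(1, - b) \<in> M"
    and "2 \<le> a \<Longrightarrow> (2, - b) \<in> M"
proof -
  have s: "a \<in> S" "- b \<in> S" "0 < lam a + lam (- b)" using R_S[OF M ab] by blast+
  have bn: "1 \<le> b" "b \<le> n" using s(2) b by (auto simp: signed_indices_def)
  have l: "lam b < lam a" using s(3) lam_minus[of b] by simp
  then have "0 < a" using lam_nonneg[OF bn] by (intro lam_pos_imp[OF s(1)]) simp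
  then have an: "1 \<le> a" "a \<le> n" using s(1) by (auto simp: signed_indices_def)
  have less: "a < b" using lam_less[OF bn(1) an(2) l] .
  have step: "(z, - b) \<in> M" if z: "1 \<le> z" "z \<le> a" for z
  proof -
    have "(- b, z) \<in> M \<or> z = - a"
      using z less an lam_antimono[of z a] S_pos(1)[of z]
      by (intro R_closed[OF M R_sym[OF M ab]]) auto
    then have "(- b, z) \<in> M" using z an by auto
    then show ?thesis by (rule R_sym[OF M])
  qed
  show "1 \<le> a" "a < b" "b \<le> n" "lam b < lam a" using an less bn l by blast+
  show "(1, - b) \<in> M" using step an by simp
  show "2 \<le> a \<Longrightarrow> (2, - b) \<in> M" using step by simp
qed

text \<open>Together with \<open>(1, - b)\<close> the pair \<open>(2, b)\<close> would violate commutativity, so nothing may lead from \<open>- b\<close>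
  to \<open>b\<close>. Only the last index can be in this position, and only if it is alone in its block.\<close>

lemma second_negative_pair:
  assumes M: "M \<in> R" and 2: "(2, - b) \<in> M" and b: "0 < b"
  shows "b = n" "lam n < lam (n - 1)" "(a, n) \<notin> M"
proof -
  have b2: "2 < b" "b \<le> n" "(1, - b) \<in> M" using negative_pair[OF M 2 b] by auto
  \<comment> \<open>An index \<open>c\<close> at most as high as \<open>b\<close> leads from \<open>- b\<close> to \<open>b\<close>.\<close>
  have no: False if c: "1 \<le> c" "c \<le> n" "c \<noteq> 2" "c \<noteq> b" "lam c \<le> lam b" for c
  proof -
    have "lam (- b) \<le> lam c" using lam_minus[of b] lam_nonneg[of b] lam_nonneg[OF c(1,2)] b2 by simp
    then have "(2, c) \<in> M \<or> c = - (- b)"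
      using c S_pos(1)[of c] by (intro R_closed[OF M 2]) auto
    then have "(2, c) \<in> M" using c by simp
    then have "(2, b) \<in> M \<or> b = - c"
      using c b2 S_pos(1)[of b] by (intro R_closed[OF M]) auto
    then have "(b, 2) \<in> M" using c b2 R_sym[OF M] by auto
    then show False using R_abelian[OF M b2(3)] by force
  qed
  show bn: "b = n"
  proof (rule ccontr)
    assume "b \<noteq> n"
    then show False using no[of n] lam_antimono[of b n] b2 l_ge_4 by auto
  qed
  show "lam n < lam (n - 1)"
  proof (rule ccontr)
    assume "\<not> ?thesis"
    then show False using no[of "n - 1"] bn l_ge_4 by auto
  qed
  show "(a, n) \<notin> M"
  proof
    assume "(a, n) \<in> M"
    then have na: "(- (- b), a) \<in> M" using R_sym[OF M] bn by simp
    show False using R_abelian[OF M b2(3) na] R_abelian[OF M 2 na] by simp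
  qed
qed

lemma not_positive:
  assumes M: "M \<in> R" "\<not> positive M"
  obtains b where "0 < b" "(1, - b) \<in> M"
proof -
  obtain x y where xy: "(x, y) \<in> M" "y \<le> 0"
    using M(2) R_sym[OF M(1)] unfolding positive_def by force
  then have "y \<in> S" using R_S[OF M(1)] by blast
  then have "0 < - y" "(x, - (- y)) \<in> M" using xy by (auto simp: signed_indices_def)
  then show thesis using negative_pair(5)[OF M(1)] that by metis
qed

text \<open>Otherwise \<open>(2, - n)\<close> belongs to \<open>M\<close>. Then \<open>n\<close> occurs in no pair and no \<open>- c\<close> with \<open>c < n\<close> does, because
  that would force \<open>(1, n)\<close>; so \<open>M\<close> is the mirror image of a positive ideal.\<close>

lemma B_negative_pair:
  assumes M: "M \<in> B" and ab: "(a, - b) \<in> M" "0 < b"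
  shows "a = 1"
proof (rule ccontr)
  assume "a \<noteq> 1"
  have MR: "M \<in> R" "M \<notin> Am" using M by (auto simp: B_def)
  have "2 \<le> a" using negative_pair(1)[OF MR(1) ab] \<open>a \<noteq> 1\<close> by simp
  then have 2: "(2, - b) \<in> M" by (rule negative_pair(6)[OF MR(1) ab])
  have bn: "b = n" and no: "\<And>a. (a, n) \<notin> M" using second_negative_pair[OF MR(1) 2 ab(2)] by auto
  have side: "0 < y \<and> y \<noteq> n \<or> y = - n" if xy: "(x, y) \<in> M" for x y
  proof (cases "0 < y")
    case True
    then show ?thesis using no xy by auto
  next
    case False
    define c where "c = - y"
    have c: "0 < c" "(x, - c) \<in> M"
      using False R_S[OF MR(1) xy] xy by (auto simp: c_def signed_indices_def)
    note nc = negative_pair[OF MR(1) c(2,1)]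
    have "c = n"
    proof (rule ccontr)
      assume "c \<noteq> n"
      have "(1, n) \<in> M \<or> n = - (- c)"
        using nc l_ge_4 lam_minus[of c] lam_nonneg[of c] lam_last_nonneg S_pos(1)[of n]
        by (intro R_closed[OF MR(1) nc(5)]) auto
      then show False using no \<open>c \<noteq> n\<close> by simp
    qed
    then show ?thesis by (simp add: c_def)
  qed
  then have "mirror_positive M" using R_sym[OF MR(1)] unfolding mirror_positive_def by blast
  then show False using MR by (simp add: Am_def)
qed

lemma B_empty:
  assumes "lam 1 = lam 2"
  shows "B = {}"
proof (rule ccontr)
  assume "B \<noteq> {}"
  then obtain M where M: "M \<in> B" by blast
  then have MR: "M \<in> R" "\<not> positive M" by (auto simp: B_def Ap_def)
  obtain b where b: "0 < b" "(1, - b) \<in> M" using not_positive[OF MR] .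
  note nb = negative_pair[OF MR(1) b(2,1)]
  have "b \<noteq> 2" using nb(4) assms by auto
  then have "(- b, 2) \<in> M \<or> (2::int) = - 1"
    using nb assms l_ge_4 S_pos(1)[of 2] by (intro R_closed[OF MR(1) R_sym[OF MR(1) b(2)]]) auto
  then have "(2, - b) \<in> M" using R_sym[OF MR(1)] by auto
  then show False using B_negative_pair[OF M _ b(1)] by force
qed

definition J :: "(int \<times> int) set \<Rightarrow> int set" where
  "J M = {b. 0 < b \<and> (1, - b) \<in> M}"

text \<open>The set \<open>J M\<close> is a final segment for the level, the index 1 is adjacent to all positive indices, and
  apart from 1 nothing positive is adjacent to \<open>J M\<close>, because of the pairs \<open>(1, - b)\<close>.\<close>

lemma B_structure:
  assumes M: "M \<in> B"
  shows "b \<in> J M \<Longrightarrow> 2 \<le> b \<and> b \<le> n"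
    and "b \<in> J M \<Longrightarrow> 2 \<le> c \<Longrightarrow> c \<le> n \<Longrightarrow> lam c \<le> lam b \<Longrightarrow> c \<in> J M"
    and "2 \<le> c \<Longrightarrow> c \<le> n \<Longrightarrow> lam c = lam n \<Longrightarrow> c \<in> J M"
    and "2 \<le> c \<Longrightarrow> c \<le> n \<Longrightarrow> (1, c) \<in> M"
    and "2 \<le> a \<Longrightarrow> 0 < c \<Longrightarrow> (a, c) \<in> M \<Longrightarrow> c \<notin> J M"
proof -
  have MR: "M \<in> R" "\<not> positive M" "\<not> mirror_positive M" using M by (auto simp: B_def Ap_def Am_def)
  have range: "2 \<le> b \<and> b \<le> n" if "b \<in> J M" for b
    using negative_pair[OF MR(1), of 1 b] that by (auto simp: J_def)
  have up: "c \<in> J M" if b: "b \<in> J M" and c: "2 \<le> c" "c \<le> n" "lam c \<le> lam b" for b c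
  proof (cases "c = b")
    case False
    have "(1, - c) \<in> M \<or> - c = - (- b)"
      using b c False range[OF b] lam_minus[of b] lam_minus[of c] S_pos(2)[of c]
      by (intro R_closed[OF MR(1), of 1 "- b"]) (auto simp: J_def)
    then show ?thesis using c range[OF b] by (auto simp: J_def)
  qed (use b in simp)
  obtain b where b: "b \<in> J M" using not_positive[OF MR(1,2)] by (auto simp: J_def)
  have low: "c \<in> J M" if c: "2 \<le> c" "c \<le> n" "lam c = lam n" for c
    using up[OF b c(1,2)] c(3) range[OF b] lam_antimono[of b n] by simp
  have toward: "(1, c) \<in> M" if b: "b \<in> J M" and c: "2 \<le> c" "c \<le> n" "c \<noteq> b" for b c
  proof -
    have "lam (- b) \<le> lam c" using lam_minus[of b] lam_nonneg[of b] lam_nonneg[of c] range[OF b] c by simp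
    then have "(1, c) \<in> M \<or> c = - (- b)"
      using b c S_pos(1)[of c] by (intro R_closed[OF MR(1)]) (auto simp: J_def)
    then show ?thesis using c by simp
  qed
  have nJ: "n \<in> J M" using low[of n] l_ge_4 by simp
  have 1: "(1, n) \<in> M"
  proof (cases "J M = {n}")
    case True
    \<comment> \<open>Since \<open>M\<close> is not mirror-positive, \<open>n\<close> occurs in it.\<close>
    have "\<exists>x. (x, n) \<in> M"
    proof (rule ccontr)
      assume no: "\<not> ?thesis"
      have "0 < y \<and> y \<noteq> n \<or> y = - n" if xy: "(x, y) \<in> M" for x y
      proof (cases "0 < y")
        case True
        then show ?thesis using no xy by auto
      next
        case False
        have c: "0 < - y" "(x, - (- y)) \<in> M"
          using False R_S[OF MR(1) xy] xy by (auto simp: signed_indices_def)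
        then have "- y \<in> J M" using negative_pair(5)[OF MR(1) c(2,1)] by (auto simp: J_def)
        then show ?thesis using True by simp
      qed
      then have "mirror_positive M" using R_sym[OF MR(1)] unfolding mirror_positive_def by blast
      then show False using MR(3) by blast
    qed
    then obtain x where x: "(x, n) \<in> M" by blast
    have xS: "x \<in> S" "\<bar>x\<bar> \<noteq> n" using R_S[OF MR(1) x] by auto
    have "0 < x"
    proof (rule ccontr)
      assume "\<not> 0 < x"
      then have "0 < - x" "(n, - (- x)) \<in> M" using xS R_sym[OF MR(1) x] by (auto simp: signed_indices_def)
      then have "n = 1" using B_negative_pair[OF M] by blast
      then show False using l_ge_4 by simp
    qed
    then have xr: "1 \<le> x" "x \<le> n" using xS by (auto simp: signed_indices_def)
    have "(n, 1) \<in> M \<or> 1 = - x"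
      using xr l_ge_4 lam_antimono[of 1 x] S_pos(1)[of 1] by (intro R_closed[OF MR(1) R_sym[OF MR(1) x]]) auto
    then show ?thesis using xr R_sym[OF MR(1)] by auto
  next
    case False
    then obtain b' where "b' \<in> J M" "b' \<noteq> n" using nJ by blast
    then show ?thesis using toward[of b' n] l_ge_4 by simp
  qed
  show "b \<in> J M \<Longrightarrow> 2 \<le> b \<and> b \<le> n" for b by (rule range)
  show "b \<in> J M \<Longrightarrow> 2 \<le> c \<Longrightarrow> c \<le> n \<Longrightarrow> lam c \<le> lam b \<Longrightarrow> c \<in> J M" for b by (rule up)
  show "2 \<le> c \<Longrightarrow> c \<le> n \<Longrightarrow> lam c = lam n \<Longrightarrow> c \<in> J M" by (rule low)
  show "2 \<le> c \<Longrightarrow> c \<le> n \<Longrightarrow> (1, c) \<in> M" using 1 toward[OF nJ] by (cases "c = n") auto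
  show "2 \<le> a \<Longrightarrow> 0 < c \<Longrightarrow> (a, c) \<in> M \<Longrightarrow> c \<notin> J M"
  proof
    assume a: "2 \<le> a" "0 < c" "(a, c) \<in> M" "c \<in> J M"
    have "(1, - c) \<in> M" "(- (- c), a) \<in> M" using a(4) R_sym[OF MR(1) a(3)] by (auto simp: J_def)
    then have "\<bar>1\<bar> = \<bar>a\<bar>" by (rule R_abelian[OF MR(1)])
    then show False using a(1) by simp
  qed
qed

text \<open>An ideal in \<open>B\<close> is determined by its pairs avoiding \<open>J\<close>. Conversely a threshold graph \<open>N\<close>
  on \<open>Q\<close> recovers \<open>J\<close> as the set of indices not adjacent to 1.\<close>

definition extend :: "(int \<times> int) set \<Rightarrow> (int \<times> int) set" where
  "extend N = N \<union> {(1, y) | y. 2 \<le> \<bar>y\<bar> \<and> \<bar>y\<bar> \<le> n \<and> (1, \<bar>y\<bar>) \<notin> N}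
                \<union> {(y, 1) | y. 2 \<le> \<bar>y\<bar> \<and> \<bar>y\<bar> \<le> n \<and> (1, \<bar>y\<bar>) \<notin> N}"

definition core :: "(int \<times> int) set \<Rightarrow> (int \<times> int) set" where
  "core M = {(a, c) \<in> M. 0 < a \<and> 0 < c \<and> a \<notin> J M \<and> c \<notin> J M}"

lemma core_threshold:
  assumes lt: "lam 2 < lam 1" and M: "M \<in> B"
  shows "core M \<in> threshold_graphs Q lam"
proof -
  have MR: "M \<in> R" using M by (simp add: B_def)
  note st = B_structure[OF M]
  have 1: "1 \<in> Q" using lt lam_antimono[of 2 n] l_ge_4 by (simp add: Q_def)
  have inQ: "a \<in> Q" if "(a, c) \<in> M" "0 < a" "a \<notin> J M" for a c
  proof (cases "a = 1")
    case False
    have an: "2 \<le> a" "a \<le> n" using R_S[OF MR that(1)] that(2) False by (auto simp: signed_indices_def)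
    then have "lam a \<noteq> lam n" using st(3) that(3) by blast
    then show ?thesis using an lam_antimono[of a n] by (simp add: Q_def)
  qed (use 1 in simp)
  show ?thesis
  proof (rule thr_I)
    fix x y assume xy: "(x, y) \<in> core M"
    then show "x \<in> Q \<and> y \<in> Q \<and> x \<noteq> y"
      using inQ[of x y] inQ[of y x] R_sym[OF MR] R_S[OF MR, of x y] by (auto simp: core_def)
  next
    show "(y, x) \<in> core M" if "(x, y) \<in> core M" for x y
      using that R_sym[OF MR] by (auto simp: core_def)
  next
    fix x y z assume xy: "(x, y) \<in> core M" and z: "z \<in> Q" "lam y \<le> lam z" "z \<noteq> x" "z \<noteq> y"
    have zn: "1 \<le> z" "z \<le> n" using z(1) by (auto simp: Q_def)
    have xy': "(x, y) \<in> M" "0 < x" "0 < y" "x \<notin> J M" "y \<notin> J M" using xy by (auto simp: core_def)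
    have "(x, z) \<in> M \<or> z = - y"
      using xy' z zn S_pos(1)[of z] by (intro R_closed[OF MR xy'(1)]) auto
    then have xz: "(x, z) \<in> M" using zn xy'(3) by auto
    have "z \<notin> J M"
    proof
      assume zJ: "z \<in> J M"
      show False
      proof (cases "x = 1")
        case True
        then have "2 \<le> y" "y \<le> n" using R_S[OF MR xy'(1)] xy'(3) by (auto simp: signed_indices_def)
        then show False using st(2)[OF zJ _ _ z(2)] xy'(5) by blast
      next
        case False
        then show False using st(5)[of x z] xz zJ xy'(2) zn by auto
      qed
    qed
    then show "(x, z) \<in> core M" using xz xy' zn by (simp add: core_def)
  qed
qed

lemma threshold_1:
  assumes lt: "lam 2 < lam 1" and N: "N \<in> threshold_graphs Q lam" and xy: "(x, y) \<in> N" "y \<noteq> 1"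
  shows "(1, y) \<in> N"
proof (cases "x = 1")
  case False
  have x: "x \<in> Q" using thr_D(1)[OF N xy(1)] by blast
  have "1 \<in> Q" using lt lam_antimono[of 2 n] l_ge_4 by (simp add: Q_def)
  moreover have "lam x \<le> lam 1" using x lam_antimono[of 1 x] by (simp add: Q_def)
  ultimately have "(y, 1) \<in> N" using thr_D(3)[OF N thr_D(2)[OF N xy(1)]] xy(2) by blast
  then show ?thesis by (rule thr_D(2)[OF N])
qed (use xy in simp)

lemma extend_in_B:
  assumes lt: "lam 2 < lam 1" and N: "N \<in> threshold_graphs Q lam"
  shows "extend N \<in> B"
proof -
  have Nr: "1 \<le> x \<and> x \<le> n \<and> lam n < lam x \<and> 1 \<le> y \<and> y \<le> n \<and> lam n < lam y \<and> x \<noteq> y"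
    if "(x, y) \<in> N" for x y using thr_D(1)[OF N that] by (auto simp: Q_def)
  have low: "lam y < lam 1" if "2 \<le> \<bar>y\<bar>" "\<bar>y\<bar> \<le> n" for y
  proof (cases "0 < y")
    case True
    then show ?thesis using that lt lam_antimono[of 2 y] by simp
  next
    case False
    then show ?thesis
      using that lt lam_nonneg[of "- y"] lam_minus[of y] lam_nonneg[of 2] l_ge_4 by simp
  qed
  have pos: "- lam y < lam 1" if "2 \<le> \<bar>y\<bar>" "\<bar>y\<bar> \<le> n" for y
    using low[of "- y"] that lam_minus[of y] by simp
  have cases: thesis if "(x, y) \<in> extend N"
    "(x, y) \<in> N \<Longrightarrow> thesis"
    "x = 1 \<Longrightarrow> 2 \<le> \<bar>y\<bar> \<Longrightarrow> \<bar>y\<bar> \<le> n \<Longrightarrow> (1, \<bar>y\<bar>) \<notin> N \<Longrightarrow> thesis"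
    "y = 1 \<Longrightarrow> 2 \<le> \<bar>x\<bar> \<Longrightarrow> \<bar>x\<bar> \<le> n \<Longrightarrow> (1, \<bar>x\<bar>) \<notin> N \<Longrightarrow> thesis" for x y thesis
    using that unfolding extend_def by blast
  have R: "extend N \<in> R"
  proof (rule R_I)
    fix x y assume "(x, y) \<in> extend N"
    then show "x \<in> S \<and> y \<in> S \<and> \<bar>x\<bar> \<noteq> \<bar>y\<bar> \<and> 0 < lam x + lam y"
    proof (rule cases)
      assume "(x, y) \<in> N"
      then show ?thesis using Nr[of x y] lam_last_nonneg by (auto simp: signed_indices_def)
    next
      assume "x = 1" "2 \<le> \<bar>y\<bar>" "\<bar>y\<bar> \<le> n"
      then show ?thesis using pos[of y] l_ge_4 by (auto simp: signed_indices_def)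
    next
      assume "y = 1" "2 \<le> \<bar>x\<bar>" "\<bar>x\<bar> \<le> n"
      then show ?thesis using pos[of x] l_ge_4 by (auto simp: signed_indices_def)
    qed
  next
    fix x y assume "(x, y) \<in> extend N"
    then show "(y, x) \<in> extend N" using thr_D(2)[OF N] unfolding extend_def by blast
  next
    fix x y z assume xy: "(x, y) \<in> extend N" and z: "z \<in> S" "lam y \<le> lam z" "\<bar>z\<bar> \<noteq> \<bar>x\<bar>" "\<bar>z\<bar> \<noteq> \<bar>y\<bar>"
    from xy show "(x, z) \<in> extend N"
    proof (rule cases)
      assume "(x, y) \<in> N"
      then have "lam n < lam z" using Nr[of x y] z(2) by simp
      then have "0 < z" using lam_last_nonneg by (intro lam_pos_imp[OF z(1)]) simp
      then have "z \<in> Q" using z(1) \<open>lam n < lam z\<close> by (auto simp: Q_def signed_indices_def)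
      then have "(x, z) \<in> N" using thr_D(3)[OF N \<open>(x, y) \<in> N\<close>] z by auto
      then show ?thesis by (simp add: extend_def)
    next
      assume y: "x = 1" "2 \<le> \<bar>y\<bar>" "\<bar>y\<bar> \<le> n" "(1, \<bar>y\<bar>) \<notin> N"
      have zr: "2 \<le> \<bar>z\<bar>" "\<bar>z\<bar> \<le> n" using z(1,3) y(1) by (auto simp: signed_indices_def)
      show ?thesis
      proof (cases "(1, \<bar>z\<bar>) \<in> N")
        case False
        then show ?thesis using zr y(1) by (auto simp: extend_def)
      next
        case zN: True
        show ?thesis
        proof (cases "0 < z")
          case True
          then show ?thesis using zN y(1) by (simp add: extend_def)
        next
          case False
          then have za: "\<bar>z\<bar> = - z" by simp
          have zl: "lam n < - lam z" using Nr[OF zN] za lam_minus[of z] by simp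
          then have yl: "lam y < 0" using z(2) lam_last_nonneg by simp
          have "\<not> 0 < y" using yl lam_nonneg[of y] y(3) by auto
          then have ya: "\<bar>y\<bar> = - y" by simp
          have "lam \<bar>z\<bar> \<le> lam \<bar>y\<bar>" using z(2) za ya lam_minus[of y] lam_minus[of z] by simp
          moreover have "\<bar>y\<bar> \<in> Q"
            using \<open>lam \<bar>z\<bar> \<le> lam \<bar>y\<bar>\<close> Nr[OF zN] y(2,3) by (simp add: Q_def)
          ultimately have "(1, \<bar>y\<bar>) \<in> N" using thr_D(3)[OF N zN] y(2) by simp
          then show ?thesis using y(4) by blast
        qed
      qed
    next
      assume "y = 1"
      then show ?thesis using z low[of z] by (auto simp: signed_indices_def)
    qed
  next
    fix x y z assume xy: "(x, y) \<in> extend N" and yz: "(- y, z) \<in> extend N"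
    have not: False if "(a, b) \<in> N" "2 \<le> \<bar>b\<bar>" "(1, \<bar>b\<bar>) \<notin> N" for a b
      using threshold_1[OF lt N that(1)] Nr[OF that(1)] that(2,3) by simp
    from xy show "\<bar>x\<bar> = \<bar>z\<bar>"
    proof (rule cases)
      assume n: "(x, y) \<in> N"
      from yz show ?thesis
        by (rule cases) (use Nr[OF n] Nr[of "- y" z] not[OF n] in auto)
    next
      assume n: "x = 1" "2 \<le> \<bar>y\<bar>" "(1, \<bar>y\<bar>) \<notin> N"
      from yz show ?thesis
      proof (rule cases)
        assume "(- y, z) \<in> N"
        then show ?thesis using not[of z "- y"] n thr_D(2)[OF N] by auto
      qed (use n in auto)
    next
      assume "y = 1"
      from yz show ?thesis by (rule cases) (use \<open>y = 1\<close> Nr[of "- y" z] in auto)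
    qed
  qed
  have "(1, n) \<notin> N" using Nr[of 1 n] by auto
  then have e: "(1, - n) \<in> extend N" "(1, n) \<in> extend N" using l_ge_4 by (auto simp: extend_def)
  have "\<not> positive (extend N)" using e(1) l_ge_4 unfolding positive_def by fastforce
  moreover have "\<not> mirror_positive (extend N)" using e(2) l_ge_4 unfolding mirror_positive_def by fastforce
  ultimately show ?thesis using R by (simp add: B_def Ap_def Am_def)
qed

lemma J_extend:
  assumes N: "N \<in> threshold_graphs Q lam"
  shows "J (extend N) = {b. 2 \<le> b \<and> b \<le> n \<and> (1, b) \<notin> N}"
proof -
  have "(1, - b) \<notin> N" if "0 < b" for b using thr_D(1)[OF N, of 1 "- b"] that by (auto simp: Q_def)
  then show ?thesis by (auto simp: J_def extend_def)
qed

lemma card_B: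
  assumes lt: "lam 2 < lam 1"
  shows "card B = card (threshold_graphs Q lam)"
proof -
  have "bij_betw core B (threshold_graphs Q lam)"
  proof (rule bij_betw_byWitness[where f' = extend])
    show "core ` B \<subseteq> threshold_graphs Q lam" using core_threshold[OF lt] by blast
    show "extend ` threshold_graphs Q lam \<subseteq> B" using extend_in_B[OF lt] by blast
    show "\<forall>N\<in>threshold_graphs Q lam. core (extend N) = N"
    proof
      fix N assume N: "N \<in> threshold_graphs Q lam"
      have Nr: "0 < x \<and> 0 < y" if "(x, y) \<in> N" for x y using thr_D(1)[OF N that] by (auto simp: Q_def)
      have nJ: "y \<notin> J (extend N)" if "(x, y) \<in> N" for x y
        using threshold_1[OF lt N that] unfolding J_extend[OF N] by auto
      show "core (extend N) = N"
      proof (intro equalityI subrelI)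
        fix x y assume "(x, y) \<in> core (extend N)"
        then show "(x, y) \<in> N" unfolding core_def J_extend[OF N] by (auto simp: extend_def)
      next
        fix x y assume xy: "(x, y) \<in> N"
        have "(x, y) \<in> extend N" using xy by (simp add: extend_def)
        then show "(x, y) \<in> core (extend N)"
          using Nr[OF xy] nJ[OF xy] nJ[OF thr_D(2)[OF N xy]] by (simp add: core_def)
      qed
    qed
    show "\<forall>M\<in>B. extend (core M) = M"
    proof
      fix M assume M: "M \<in> B"
      have MR: "M \<in> R" using M by (simp add: B_def)
      note st = B_structure[OF M]
      have 1: "1 \<notin> J M" using st(1)[of 1] by auto
      have c1: "(1, b) \<in> core M \<longleftrightarrow> b \<notin> J M" if "2 \<le> b" "b \<le> n" for b
        using st(4)[OF that] that 1 by (auto simp: core_def)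
      show "extend (core M) = M"
      proof (intro equalityI subrelI)
        fix x y assume "(x, y) \<in> extend (core M)"
        then consider "(x, y) \<in> core M" | "x = 1" "2 \<le> \<bar>y\<bar>" "\<bar>y\<bar> \<le> n" "(1, \<bar>y\<bar>) \<notin> core M"
          | "y = 1" "2 \<le> \<bar>x\<bar>" "\<bar>x\<bar> \<le> n" "(1, \<bar>x\<bar>) \<notin> core M"
          unfolding extend_def by blast
        moreover have one: "(1, y) \<in> M" if "2 \<le> \<bar>y\<bar>" "\<bar>y\<bar> \<le> n" "(1, \<bar>y\<bar>) \<notin> core M" for y
        proof (cases "0 < y")
          case True
          then show ?thesis using st(4)[of y] that by simp
        next
          case False
          then have "- y \<in> J M" using c1[of "\<bar>y\<bar>"] that by auto
          then show ?thesis by (simp add: J_def)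
        qed
        ultimately show "(x, y) \<in> M"
        proof cases
          case 1
          then show ?thesis by (simp add: core_def)
        next
          case 2
          then show ?thesis using one by simp
        next
          case 3
          then show ?thesis using R_sym[OF MR one[of x]] by simp
        qed
      next
        fix x y assume xy: "(x, y) \<in> M"
        have main: "(a, b) \<in> extend (core M)" if ab: "(a, b) \<in> M" "a = 1" for a b
        proof -
          have b: "2 \<le> \<bar>b\<bar>" "\<bar>b\<bar> \<le> n" using R_S[OF MR ab(1)] ab(2) by (auto simp: signed_indices_def)
          show ?thesis
          proof (cases "(1, \<bar>b\<bar>) \<in> core M")
            case True
            then have "\<bar>b\<bar> \<notin> J M" by (simp add: core_def)
            then have "0 < b" using ab b by (auto simp: J_def abs_if split: if_splits)
            then show ?thesis using True ab(2) by (simp add: extend_def)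
          next
            case False
            then show ?thesis using b ab(2) by (auto simp: extend_def)
          qed
        qed
        have ext_sym: "(b, a) \<in> extend (core M)" if "(a, b) \<in> extend (core M)" for a b
          using that R_sym[OF MR] by (auto simp: extend_def core_def)
        show "(x, y) \<in> extend (core M)"
        proof (cases "x = 1 \<or> y = 1")
          case True
          then show ?thesis using main[OF xy] main[OF R_sym[OF MR xy]] ext_sym by blast
        next
          case False
          have "0 < y"
          proof (rule ccontr)
            assume "\<not> 0 < y"
            then have "0 < - y" "(x, - (- y)) \<in> M" using R_S[OF MR xy] xy by (auto simp: signed_indices_def)
            then show False using B_negative_pair[OF M] False by blast
          qed
          moreover have "0 < x"
          proof (rule ccontr)
            assume "\<not> 0 < x"
            then have "0 < - x" "(y, - (- x)) \<in> M"
              using R_S[OF MR xy] R_sym[OF MR xy] by (auto simp: signed_indices_def)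
            then show False using B_negative_pair[OF M] False by blast
          qed
          ultimately have "(x, y) \<in> core M"
            using st(5)[of x y] st(5)[of y x] xy R_sym[OF MR xy] False by (auto simp: core_def)
          then show ?thesis by (simp add: extend_def)
        qed
      qed
    qed
  qed
  then show ?thesis by (rule bij_betw_same_card)
qed

subsection \<open>The three cases\<close>

lemma card_B_if: "card B = (if lam 1 = lam 2 then 0 else card (threshold_graphs Q lam))"
  using B_empty card_B lam_antimono[of 1 2] l_ge_4 by auto

text \<open>If \<open>n - 1\<close> has the same level as \<open>n\<close>, a neighbour of \<open>- n\<close> is also adjacent to \<open>- (n - 1)\<close>, which a
  mirror image does not contain.\<close>

lemma Am_subset_Ap:
  assumes "lam (n - 1) = lam n"
  shows "Am \<subseteq> Ap"
proof
  fix M assume "M \<in> Am"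
  then have M: "M \<in> R" "mirror_positive M" by (auto simp: Am_def)
  have "positive M"
  proof (rule ccontr)
    assume "\<not> positive M"
    then obtain b where b: "0 < b" "(1, - b) \<in> M" using not_positive[OF M(1)] by blast
    note nb = negative_pair[OF M(1) b(2,1)]
    have "b = n" using M(2) b unfolding mirror_positive_def by fastforce
    then have "(1, - (n - 1)) \<in> M \<or> - (n - 1) = - (- b)"
      using assms lam_minus[of n] lam_minus[of "n - 1"] l_ge_4 S_pos(2)[of "n - 1"]
      by (intro R_closed[OF M(1) b(2)]) auto
    then have "(1, - (n - 1)) \<in> M" using \<open>b = n\<close> l_ge_4 by auto
    then show False using M(2) l_ge_4 unfolding mirror_positive_def by fastforce
  qed
  then show "M \<in> Ap" using M by (simp add: Ap_def)
qed

lemma card_R_connected: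
  assumes "lam (n - 1) = lam n"
  shows "card R = card Ap + card B"
proof -
  have "R = Ap \<union> B" "Ap \<inter> B = {}"
    using Am_subset_Ap[OF assms] by (auto simp: B_def Ap_def)
  moreover have "finite Ap" "finite B" using finite_R by (auto simp: Ap_def B_def)
  ultimately show ?thesis by (simp add: card_Un_disjoint)
qed

theorem card_rel_ideals:
  shows "lam n = 0 \<Longrightarrow> 0 < lam (n - 1) \<Longrightarrow>
      card (rel_ideals l lam) + card (threshold_graphs Q lam) =
        2 * card (threshold_graphs {1..n} lam) +
        (if lam 1 = lam 2 then 0 else card (threshold_graphs Q lam))"
    and "lam (n - 1) = lam n \<Longrightarrow> 0 < lam n \<Longrightarrow>
      card (rel_ideals l lam) = card (threshold_graphs {1..n} lam) +
        (if lam 1 = lam 2 then 0 else card (threshold_graphs Q lam))"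
    and "lam (n - 1) = 0 \<Longrightarrow> lam n = 0 \<Longrightarrow>
      card (rel_ideals l lam) = card (threshold_graphs Q lam) +
        (if lam 1 = lam 2 then 0 else card (threshold_graphs Q lam))"
proof -
  show "card (rel_ideals l lam) + card (threshold_graphs Q lam) =
        2 * card (threshold_graphs {1..n} lam) +
        (if lam 1 = lam 2 then 0 else card (threshold_graphs Q lam))"
    if t: "lam n = 0" "0 < lam (n - 1)"
  proof -
    have fin: "finite Ap" "finite Am" "finite B" using finite_R by (auto simp: Ap_def Am_def B_def)
    have "R = (Ap \<union> Am) \<union> B" "(Ap \<union> Am) \<inter> B = {}" by (auto simp: B_def Ap_def Am_def)
    then have "card R = card (Ap \<union> Am) + card B" using fin by (simp add: card_Un_disjoint)
    moreover have "card (Ap \<union> Am) + card (Ap \<inter> Am) = card Ap + card Am"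
      using card_Un_Int[OF fin(1,2)] by simp
    moreover have "Ap = threshold_graphs {1..n} lam" using Ap_threshold[of "{1..n}"] t by blast
    ultimately show ?thesis
      using card_mirror[OF t(1)] Ap_Int_Am[OF t] card_B_if unfolding R_def by simp
  qed
  show "card (rel_ideals l lam) = card (threshold_graphs {1..n} lam) +
        (if lam 1 = lam 2 then 0 else card (threshold_graphs Q lam))"
    if t: "lam (n - 1) = lam n" "0 < lam n"
    using card_R_connected[OF t(1)] Ap_threshold[of "{1..n}"] t card_B_if unfolding R_def by simp
  show "card (rel_ideals l lam) = card (threshold_graphs Q lam) +
        (if lam 1 = lam 2 then 0 else card (threshold_graphs Q lam))"
    if t: "lam (n - 1) = 0" "lam n = 0"
    using card_R_connected Ap_threshold[of Q] t card_B_if unfolding R_def by simp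
qed

end

section \<open>Counting threshold graphs\<close>

locale blocks =
  fixes Y :: "int set" and blk :: "int \<Rightarrow> nat"
  assumes finite_Y: "finite Y"
begin

definition W :: "nat \<Rightarrow> nat \<Rightarrow> int set" where
  "W u v = {x \<in> Y. u \<le> blk x \<and> blk x \<le> v}"

definition G :: "nat \<Rightarrow> nat \<Rightarrow> (int \<times> int) set set" where
  "G u v = threshold_graphs (W u v) (\<lambda>x. - int (blk x))"

lemma G_D:
  assumes "M \<in> G u v"
  shows "(x, y) \<in> M \<Longrightarrow> x \<in> W u v \<and> y \<in> W u v \<and> x \<noteq> y"
    and "(x, y) \<in> M \<Longrightarrow> (y, x) \<in> M"
    and "(x, y) \<in> M \<Longrightarrow> z \<in> W u v \<Longrightarrow> blk z \<le> blk y \<Longrightarrow> z \<noteq> x \<Longrightarrow> (x, z) \<in> M"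
proof -
  have M: "M \<subseteq> W u v \<times> W u v" "sym M" "\<And>x. (x, x) \<notin> M"
    "\<And>x y z. (x, y) \<in> M \<Longrightarrow> z \<in> W u v \<Longrightarrow> - int (blk y) \<le> - int (blk z) \<Longrightarrow> z \<noteq> x \<Longrightarrow> (x, z) \<in> M"
    using assms unfolding G_def threshold_graphs_def by blast+
  show "(x, y) \<in> M \<Longrightarrow> x \<in> W u v \<and> y \<in> W u v \<and> x \<noteq> y" using M(1,3) by blast
  show "(x, y) \<in> M \<Longrightarrow> (y, x) \<in> M" using M(2) by (rule symD)
  show "(x, y) \<in> M \<Longrightarrow> z \<in> W u v \<Longrightarrow> blk z \<le> blk y \<Longrightarrow> z \<noteq> x \<Longrightarrow> (x, z) \<in> M"
    by (rule M(4)) simp_all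
qed

lemma G_I:
  assumes "\<And>x y. (x, y) \<in> M \<Longrightarrow> x \<in> W u v \<and> y \<in> W u v \<and> x \<noteq> y"
    and "\<And>x y. (x, y) \<in> M \<Longrightarrow> (y, x) \<in> M"
    and "\<And>x y z. (x, y) \<in> M \<Longrightarrow> z \<in> W u v \<Longrightarrow> blk z \<le> blk y \<Longrightarrow> z \<noteq> x \<Longrightarrow> (x, z) \<in> M"
  shows "M \<in> G u v"
proof -
  have "M \<subseteq> W u v \<times> W u v" using assms(1) by auto
  moreover have "\<And>x. (x, x) \<notin> M" using assms(1) by blast
  moreover have "(x, z) \<in> M"
    if "(x, y) \<in> M" "z \<in> W u v" "- int (blk y) \<le> - int (blk z)" "z \<noteq> x" for x y z
    using that by (intro assms(3)[of x y z]) simp_all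
  ultimately show ?thesis
    unfolding G_def threshold_graphs_def sym_def using assms(2) by blast
qed

lemma finite_G: "finite (G u v)"
proof -
  have "finite (Pow (W u v \<times> W u v))" using finite_Y by (simp add: W_def)
  moreover have "G u v \<subseteq> Pow (W u v \<times> W u v)" unfolding G_def threshold_graphs_def by blast
  ultimately show ?thesis by (rule finite_subset[rotated])
qed

lemma card_G_single:
  "card (G u u) = (if 2 \<le> card {x \<in> Y. blk x = u} then 2 else 1)"
proof -
  let ?X = "{x \<in> Y. blk x = u}"
  let ?K = "{(x, y). x \<in> ?X \<and> y \<in> ?X \<and> x \<noteq> y}"
  have WX: "W u u = ?X" by (auto simp: W_def)
  have "G u u = {{}, ?K}"
  proof (intro equalityI subsetI)
    fix M assume M: "M \<in> G u u"
    have "M = ?K" if ne: "M \<noteq> {}"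
    proof -
      obtain x0 y0 where xy: "(x0, y0) \<in> M" using ne by auto
      have x0: "x0 \<in> ?X" using G_D(1)[OF M xy] WX by blast
      have nb: "(x0, z) \<in> M" if "z \<in> ?X" "z \<noteq> x0" for z
        using G_D(3)[OF M xy, of z] G_D(1)[OF M xy] that unfolding WX by simp
      have "(x, y) \<in> M" if "x \<in> ?X" "y \<in> ?X" "x \<noteq> y" for x y
      proof (cases "x = x0")
        case False
        have "(x, x0) \<in> M" using G_D(2)[OF M nb[OF that(1) False]] .
        then show ?thesis using G_D(3)[OF M, of x x0 y] that x0 unfolding WX by simp
      qed (use nb that in simp)
      then have "?K \<subseteq> M" by blast
      moreover have "M \<subseteq> ?K" using G_D(1)[OF M] unfolding WX by auto
      ultimately show ?thesis by blast
    qed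
    then show "M \<in> {{}, ?K}" by blast
  next
    fix M assume "M \<in> {{}, ?K}"
    then consider "M = {}" | "M = ?K" by blast
    then show "M \<in> G u u"
    proof cases
      case 1
      then show ?thesis by (auto intro!: G_I)
    next
      case 2
      show ?thesis by (rule G_I) (use 2 in \<open>auto simp: W_def\<close>)
    qed
  qed
  moreover have "?K \<noteq> {} \<longleftrightarrow> 2 \<le> card ?X"
  proof
    assume "?K \<noteq> {}"
    then obtain x y where "{x, y} \<subseteq> ?X" "x \<noteq> y" by blast
    then show "2 \<le> card ?X" using card_mono[of ?X "{x, y}"] finite_Y by simp
  next
    assume "2 \<le> card ?X"
    then obtain x y where "x \<in> ?X" "y \<in> ?X" "x \<noteq> y"
      using card_le_Suc0_iff_eq[of ?X] finite_Y by fastforce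
    then show "?K \<noteq> {}" by blast
  qed
  ultimately show ?thesis by (auto simp: card_insert_if)
qed

text \<open>Either some vertex of the first block is adjacent to some vertex of the last one, and then the
  first block is adjacent to everything and can be removed, or the last block is isolated.\<close>

lemma card_G_rec:
  assumes "u < v" "\<exists>x\<in>Y. blk x = u" "\<exists>y\<in>Y. blk y = v"
  shows "card (G u v) = card (G (Suc u) v) + card (G u (v - 1))"
proof -
  obtain a b where a: "a \<in> Y" "blk a = u" and b: "b \<in> Y" "blk b = v" using assms by blast
  define G1 where "G1 = {M \<in> G u v. (a, b) \<in> M}"
  define G0 where "G0 = {M \<in> G u v. (a, b) \<notin> M}"
  have ab: "a \<in> W u v" "b \<in> W u v" "a \<noteq> b" using a b assms(1) by (auto simp: W_def)
  have "G0 = G u (v - 1)"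
  proof (intro equalityI subsetI)
    fix M assume "M \<in> G0"
    then have M: "M \<in> G u v" "(a, b) \<notin> M" by (auto simp: G0_def)
    have nv: "blk y \<noteq> v" if xy: "(x, y) \<in> M" for x y
    proof
      assume y: "blk y = v"
      have "blk a \<le> blk x" using G_D(1)[OF M(1) xy] a by (simp add: W_def)
      then have "(y, a) \<in> M"
        using G_D(3)[OF M(1) G_D(2)[OF M(1) xy] ab(1)] y a assms(1) by fastforce
      then have "(a, y) \<in> M" by (rule G_D(2)[OF M(1)])
      then show False using G_D(3)[OF M(1) _ ab(2)] y b ab(3) M(2) by auto
    qed
    have W': "x \<in> W u (v - 1)" if "x \<in> W u v" "blk x \<noteq> v" for x using that by (auto simp: W_def)
    show "M \<in> G u (v - 1)"
    proof (rule G_I)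
      show "x \<in> W u (v - 1) \<and> y \<in> W u (v - 1) \<and> x \<noteq> y" if "(x, y) \<in> M" for x y
        using G_D(1)[OF M(1) that] nv[OF that] nv[OF G_D(2)[OF M(1) that]] W' by blast
      show "(y, x) \<in> M" if "(x, y) \<in> M" for x y by (rule G_D(2)[OF M(1) that])
      show "(x, z) \<in> M" if "(x, y) \<in> M" "z \<in> W u (v - 1)" "blk z \<le> blk y" "z \<noteq> x" for x y z
        using that by (intro G_D(3)[OF M(1) that(1)]) (auto simp: W_def)
    qed
  next
    fix M assume M: "M \<in> G u (v - 1)"
    have "M \<in> G u v"
    proof (rule G_I)
      show "x \<in> W u v \<and> y \<in> W u v \<and> x \<noteq> y" if "(x, y) \<in> M" for x y
        using G_D(1)[OF M that] by (auto simp: W_def)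
      show "(y, x) \<in> M" if "(x, y) \<in> M" for x y by (rule G_D(2)[OF M that])
      show "(x, z) \<in> M" if "(x, y) \<in> M" "z \<in> W u v" "blk z \<le> blk y" "z \<noteq> x" for x y z
        using that G_D(1)[OF M that(1)] by (intro G_D(3)[OF M that(1)]) (auto simp: W_def)
    qed
    moreover have "(a, b) \<notin> M" using G_D(1)[OF M, of a b] b assms(1) by (auto simp: W_def)
    ultimately show "M \<in> G0" by (simp add: G0_def)
  qed
  moreover have "card G1 = card (G (Suc u) v)"
  proof -
    let ?W' = "W (Suc u) v"
    let ?T = "{(x, y). x \<in> W u v \<and> y \<in> W u v \<and> x \<noteq> y \<and> (blk x = u \<or> blk y = u)}"
    have W'W: "x \<in> ?W' \<longleftrightarrow> x \<in> W u v \<and> blk x \<noteq> u" for x by (auto simp: W_def)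
    have "bij_betw (\<lambda>M. M \<inter> ?W' \<times> ?W') G1 (G (Suc u) v)"
    proof (rule bij_betw_byWitness[where f' = "\<lambda>N. N \<union> ?T"])
      show "\<forall>M\<in>G1. (M \<inter> ?W' \<times> ?W') \<union> ?T = M"
      proof
        fix M assume "M \<in> G1"
        then have M: "M \<in> G u v" "(a, b) \<in> M" by (auto simp: G1_def)
        have first: "(x, y) \<in> M" if x: "x \<in> W u v" "blk x = u" and y: "y \<in> W u v" "x \<noteq> y" for x y
        proof -
          have "x \<noteq> b" using x(2) b(2) assms(1) by auto
          then have "(b, x) \<in> M" using G_D(3)[OF M(1) G_D(2)[OF M(1,2)] x(1)] x(2) a(2) by simp
          then have "(x, b) \<in> M" by (rule G_D(2)[OF M(1)])
          then show ?thesis using G_D(3)[OF M(1), of x b y] y b(2) by (auto simp: W_def)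
        qed
        show "(M \<inter> ?W' \<times> ?W') \<union> ?T = M"
        proof (intro equalityI subrelI)
          fix x y assume "(x, y) \<in> (M \<inter> ?W' \<times> ?W') \<union> ?T"
          then show "(x, y) \<in> M" using first[of x y] G_D(2)[OF M(1) first[of y x]] by auto
        next
          fix x y assume "(x, y) \<in> M"
          then show "(x, y) \<in> (M \<inter> ?W' \<times> ?W') \<union> ?T" using G_D(1)[OF M(1), of x y] W'W by auto
        qed
      qed
      show "\<forall>N\<in>G (Suc u) v. (N \<union> ?T) \<inter> ?W' \<times> ?W' = N"
      proof
        fix N assume N: "N \<in> G (Suc u) v"
        have "N \<subseteq> ?W' \<times> ?W'" using G_D(1)[OF N] by auto
        moreover have "?T \<inter> ?W' \<times> ?W' = {}" using W'W by auto
        ultimately show "(N \<union> ?T) \<inter> ?W' \<times> ?W' = N" by blast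
      qed
      show "(\<lambda>M. M \<inter> ?W' \<times> ?W') ` G1 \<subseteq> G (Suc u) v"
      proof (rule image_subsetI)
        fix M assume "M \<in> G1"
        then have M: "M \<in> G u v" by (simp add: G1_def)
        show "M \<inter> ?W' \<times> ?W' \<in> G (Suc u) v"
        proof (rule G_I)
          show "x \<in> ?W' \<and> y \<in> ?W' \<and> x \<noteq> y" if "(x, y) \<in> M \<inter> ?W' \<times> ?W'" for x y
            using that G_D(1)[OF M, of x y] by blast
          show "(y, x) \<in> M \<inter> ?W' \<times> ?W'" if "(x, y) \<in> M \<inter> ?W' \<times> ?W'" for x y
            using that G_D(2)[OF M, of x y] by blast
          show "(x, z) \<in> M \<inter> ?W' \<times> ?W'"
            if "(x, y) \<in> M \<inter> ?W' \<times> ?W'" "z \<in> ?W'" "blk z \<le> blk y" "z \<noteq> x" for x y z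
            using that G_D(3)[OF M, of x y z] W'W by blast
        qed
      qed
      show "(\<lambda>N. N \<union> ?T) ` G (Suc u) v \<subseteq> G1"
      proof (rule image_subsetI)
        fix N assume N: "N \<in> G (Suc u) v"
        have "N \<union> ?T \<in> G u v"
        proof (rule G_I)
          show "x \<in> W u v \<and> y \<in> W u v \<and> x \<noteq> y" if "(x, y) \<in> N \<union> ?T" for x y
            using that G_D(1)[OF N, of x y] W'W by blast
          show "(y, x) \<in> N \<union> ?T" if "(x, y) \<in> N \<union> ?T" for x y
            using that G_D(2)[OF N, of x y] by blast
          show "(x, z) \<in> N \<union> ?T" if "(x, y) \<in> N \<union> ?T" "z \<in> W u v" "blk z \<le> blk y" "z \<noteq> x" for x y z
          proof (cases "blk x = u \<or> blk z = u")
            case True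
            have "x \<in> W u v" using that(1) G_D(1)[OF N, of x y] W'W by blast
            then show ?thesis using True that(2,4) by blast
          next
            case False
            then have "z \<in> ?W'" using W'W that(2) by blast
            moreover have "(x, y) \<in> N"
              using that(1,3) False \<open>z \<in> W u v\<close> by (auto simp: W_def)
            ultimately show ?thesis using G_D(3)[OF N] that(3,4) by blast
          qed
        qed
        moreover have "(a, b) \<in> ?T" using ab a(2) by simp
        ultimately show "N \<union> ?T \<in> G1" by (simp add: G1_def)
      qed
    qed
    then show ?thesis by (rule bij_betw_same_card)
  qed
  moreover have "G u v = G1 \<union> G0" "G1 \<inter> G0 = {}" by (auto simp: G1_def G0_def)
  then have "card (G u v) = card G1 + card G0"
    using finite_G[of u v] by (metis card_Un_disjoint finite_Un)
  ultimately show ?thesis by simp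
qed

text \<open>The recursion is that of the binomial coefficients, starting from the numbers 1 and 2 of the
  single blocks.\<close>

lemma card_G:
  assumes "\<And>j. u \<le> j \<Longrightarrow> j \<le> u + n \<Longrightarrow> \<exists>x\<in>Y. blk x = j"
  shows "card (G u (u + n)) =
    (\<Sum>j\<le>n. (n choose j) * (if 2 \<le> card {x \<in> Y. blk x = u + j} then 2 else 1))"
  using assms
proof (induction n arbitrary: u)
  case 0
  then show ?case using card_G_single by simp
next
  case (Suc n)
  let ?w = "\<lambda>j. (if 2 \<le> card {x \<in> Y. blk x = j} then 2 else 1) :: nat"
  have "card (G u (u + Suc n)) = card (G (Suc u) (Suc u + n)) + card (G u (u + n))"
    using card_G_rec[of u "u + Suc n"] Suc.prems[of u] Suc.prems[of "u + Suc n"] by simp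
  also have "\<dots> = (\<Sum>j\<le>n. (n choose j) * ?w (Suc u + j)) + (\<Sum>j\<le>n. (n choose j) * ?w (u + j))"
    using Suc.IH[of "Suc u"] Suc.IH[of u] Suc.prems by simp
  also have "\<dots> = (\<Sum>j\<le>Suc n. (Suc n choose j) * ?w (u + j))"
  proof -
    have "(\<Sum>j\<le>Suc n. (Suc n choose j) * ?w (u + j)) =
        ?w u + (\<Sum>j\<le>n. (Suc n choose Suc j) * ?w (Suc u + j))"
      by (subst sum.atMost_Suc_shift) simp
    also have "(\<Sum>j\<le>n. (Suc n choose Suc j) * ?w (Suc u + j)) =
        (\<Sum>j\<le>n. (n choose j) * ?w (Suc u + j)) + (\<Sum>j\<le>n. (n choose Suc j) * ?w (u + Suc j))"
      by (simp add: sum.distrib[symmetric] distrib_right)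
    also have "?w u + \<dots> = (\<Sum>j\<le>n. (n choose j) * ?w (Suc u + j)) +
        (\<Sum>j\<le>Suc n. (n choose j) * ?w (u + j))"
    proof -
      have shift: "(\<Sum>j\<le>Suc n. (n choose j) * ?w (u + j)) =
          ?w u + (\<Sum>j\<le>n. (n choose Suc j) * ?w (u + Suc j))"
        by (subst sum.atMost_Suc_shift) simp
      show ?thesis unfolding shift by (rule add.left_commute)
    qed
    also have "(\<Sum>j\<le>Suc n. (n choose j) * ?w (u + j)) = (\<Sum>j\<le>n. (n choose j) * ?w (u + j))"
      by (simp add: binomial_eq_0)
    finally show ?thesis by simp
  qed
  finally show ?case .
qed

end

text \<open>The block of \<open>x\<close> is its class when \<open>x\<close> and \<open>x + 1\<close> are identified for all \<open>x \<in> A\<close>; blocks are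
  numbered from 1. The members of \<open>block_starts A l\<close> are the first elements of the blocks of size
  at least 2.\<close>

definition block_index :: "nat set \<Rightarrow> nat \<Rightarrow> nat" where
  "block_index A x = Suc (card ({1..<x} - A))"

definition block_starts :: "nat set \<Rightarrow> nat \<Rightarrow> nat set" where
  "block_starts A l = {m. 1 \<le> m \<and> m < l \<and> m \<in> A \<and> (m = 1 \<or> m - 1 \<notin> A)}"

lemma block_index_pos [simp]: "0 < block_index A m"
  by (simp add: block_index_def)

lemma block_index_1 [simp]: "block_index A (Suc 0) = 1"
  by (simp add: block_index_def)

lemma block_index_Suc:
  assumes "1 \<le> x"
  shows "block_index A (Suc x) = (if x \<in> A then block_index A x else Suc (block_index A x))"
proof (cases "x \<in> A")
  case True
  then have "{1..<Suc x} - A = {1..<x} - A" by (auto simp: less_Suc_eq)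
  then show ?thesis using True by (simp add: block_index_def)
next
  case False
  then have "{1..<Suc x} - A = insert x ({1..<x} - A)" using assms by auto
  then show ?thesis using False by (simp add: block_index_def)
qed

lemma block_index_mono: "x \<le> y \<Longrightarrow> block_index A x \<le> block_index A y"
  unfolding block_index_def by (intro Suc_leI le_imp_less_Suc card_mono) auto

lemma block_index_eq_iff:
  assumes "1 \<le> x" "x \<le> y"
  shows "block_index A x = block_index A y \<longleftrightarrow> {x..<y} \<subseteq> A"
  using assms(2)
proof (induction y rule: dec_induct)
  case (step y)
  have "block_index A x \<le> block_index A y" using step by (intro block_index_mono) simp
  then have "block_index A x = block_index A (Suc y) \<longleftrightarrow> y \<in> A \<and> block_index A x = block_index A y"
    using block_index_Suc[of y A] step assms(1) by auto
  also have "\<dots> \<longleftrightarrow> {x..<Suc y} \<subseteq> A" using step by (auto simp: less_Suc_eq subset_iff)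
  finally show ?case .
qed simp

lemma block_index_surj:
  assumes "1 \<le> j" "j \<le> block_index A l" "1 \<le> l"
  shows "\<exists>x\<in>{1..l}. block_index A x = j"
  using assms(3,2)
proof (induction l rule: dec_induct)
  case base
  then show ?case using assms(1) by (intro bexI[of _ 1]) auto
next
  case (step l)
  show ?case
  proof (cases "j \<le> block_index A l")
    case True
    then show ?thesis using step.IH by force
  next
    case False
    then have "j = block_index A (Suc l)"
      using step block_index_Suc[of l A] by (auto split: if_splits)
    then show ?thesis by auto
  qed
qed

lemma inj_block_starts: "inj_on (block_index A) (block_starts A l)"
proof -
  have "m = m'" if "m \<in> block_starts A l" "m' \<in> block_starts A l" "m \<le> m'"
    "block_index A m = block_index A m'" for m m'
  proof (rule ccontr)
    assume "m \<noteq> m'"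
    then have "m' - 1 \<in> {m..<m'}" "m' \<noteq> 1" using that by (auto simp: block_starts_def)
    moreover have "{m..<m'} \<subseteq> A"
      using block_index_eq_iff[of m m' A] that by (auto simp: block_starts_def)
    ultimately show False using that(2) by (auto simp: block_starts_def)
  qed
  then show ?thesis unfolding inj_on_def by (metis nat_le_linear)
qed

lemma block_starts_image:
  "block_index A ` block_starts A l = {j. 2 \<le> card {x \<in> {1..l}. block_index A x = j}}"
proof (intro equalityI subsetI)
  fix j assume "j \<in> block_index A ` block_starts A l"
  then obtain m where m: "1 \<le> m" "m < l" "m \<in> A" "j = block_index A m" by (auto simp: block_starts_def)
  then have "{m, Suc m} \<subseteq> {x \<in> {1..l}. block_index A x = j}" using block_index_Suc[of m A] by auto
  then have "card {m, Suc m} \<le> card {x \<in> {1..l}. block_index A x = j}" by (intro card_mono) auto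
  then show "j \<in> {j. 2 \<le> card {x \<in> {1..l}. block_index A x = j}}" by simp
next
  fix j assume "j \<in> {j. 2 \<le> card {x \<in> {1..l}. block_index A x = j}}"
  then have c: "2 \<le> card {x \<in> {1..l}. block_index A x = j}" by simp
  let ?X = "{x \<in> {1..l}. block_index A x = j}"
  have fin: "finite ?X" by simp
  have ne: "?X \<noteq> {}" using c by (metis card.empty not_numeral_le_zero)
  define m where "m = Min ?X"
  have m: "m \<in> ?X" unfolding m_def using fin ne by (rule Min_in)
  have "\<not> ?X \<subseteq> {m}" using c card_mono[of "{m}" ?X] by auto
  then obtain y where y: "y \<in> ?X" "y \<noteq> m" by blast
  have "m \<le> y" unfolding m_def using fin y(1) by (rule Min_le)
  then have "m < y" using y(2) by simp
  moreover have "{m..<y} \<subseteq> A" using block_index_eq_iff[of m y A] m y(1) \<open>m \<le> y\<close> by auto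
  ultimately have mA: "m \<in> A" by auto
  have "m - 1 \<notin> A" if "m \<noteq> 1"
  proof
    assume "m - 1 \<in> A"
    then have "block_index A (m - 1) = block_index A m"
      using block_index_Suc[of "m - 1" A] that m by auto
    then have "m - 1 \<in> ?X" using m that by auto
    then have "m \<le> m - 1" unfolding m_def using fin by (intro Min_le)
    then show False using m by auto
  qed
  then have "m \<in> block_starts A l" using mA m \<open>m < y\<close> y(1) by (auto simp: block_starts_def)
  then show "j \<in> block_index A ` block_starts A l" using m by blast
qed

lemma finite_block_starts: "finite (block_starts A l)"
  by (rule finite_subset[of _ "{1..<l}"]) (auto simp: block_starts_def)

text \<open>The number of threshold graphs on the first \<open>k\<close> of the blocks of \<open>{1..l}\<close>.\<close>

definition graph_count :: "nat set \<Rightarrow> nat \<Rightarrow> nat \<Rightarrow> nat" where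
  "graph_count A l k = 2 ^ (k - 1) +
    (\<Sum>m\<in>{m \<in> block_starts A l. block_index A m \<le> k}. (k - 1) choose (block_index A m - 1))"

lemma card_threshold_graphs_blocks:
  assumes k: "1 \<le> k" "k \<le> block_index A l" and l: "1 \<le> l"
  shows "card (threshold_graphs {x. 1 \<le> x \<and> x \<le> int l \<and> block_index A (nat x) \<le> k}
      (\<lambda>x. - int (block_index A (nat x)))) = graph_count A l k"
proof -
  let ?b = "\<lambda>x. block_index A (nat x)"
  interpret blocks "{1..int l}" ?b by unfold_locales simp
  let ?w = "\<lambda>j. 2 \<le> card {x \<in> {1..int l}. ?b x = j}"
  have w: "?w j \<longleftrightarrow> j \<in> block_index A ` block_starts A l" for j
  proof -
    have "{x \<in> {1..int l}. ?b x = j} = int ` {x \<in> {1..l}. block_index A x = j}"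
    proof (intro equalityI subsetI)
      fix x assume "x \<in> {x \<in> {1..int l}. ?b x = j}"
      then show "x \<in> int ` {x \<in> {1..l}. block_index A x = j}"
        by (intro image_eqI[of _ _ "nat x"]) auto
    qed auto
    then show ?thesis unfolding block_starts_image by (simp add: card_image)
  qed
  have ex: "\<exists>x\<in>{1..int l}. ?b x = j" if j: "1 \<le> j" "j \<le> 1 + (k - 1)" for j
  proof -
    have "j \<le> block_index A l" using j(2) k by simp
    then obtain x where "x \<in> {1..l}" "block_index A x = j"
      using block_index_surj[OF j(1) _ l] by blast
    then show ?thesis by (intro bexI[of _ "int x"]) auto
  qed
  have "{x. 1 \<le> x \<and> x \<le> int l \<and> ?b x \<le> k} = W 1 k"
    by (auto simp: W_def Suc_le_eq)
  then have "card (threshold_graphs {x. 1 \<le> x \<and> x \<le> int l \<and> ?b x \<le> k} (\<lambda>x. - int (?b x)))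
      = card (G 1 (1 + (k - 1)))"
    using k by (simp add: G_def)
  also have "\<dots> = (\<Sum>j\<le>k - 1. ((k - 1) choose j) * (if ?w (1 + j) then 2 else 1))"
    using ex by (rule card_G)
  also have "\<dots> = (\<Sum>j\<le>k - 1. (k - 1) choose j) + (\<Sum>j\<le>k - 1. if ?w (1 + j) then (k - 1) choose j else 0)"
    unfolding sum.distrib[symmetric] by (intro sum.cong) auto
  also have "(\<Sum>j\<le>k - 1. (k - 1) choose j) = 2 ^ (k - 1)" by (rule choose_row_sum)
  also have "(\<Sum>j\<le>k - 1. if ?w (1 + j) then (k - 1) choose j else 0) =
      (\<Sum>j\<in>{j\<in>{..k - 1}. ?w (1 + j)}. (k - 1) choose j)"
    by (rule sum.inter_filter[symmetric]) simp
  also have "\<dots> = (\<Sum>m\<in>{m \<in> block_starts A l. block_index A m \<le> k}. (k - 1) choose (block_index A m - 1))"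
  proof (rule sum.reindex_bij_betw[symmetric, where h = "\<lambda>m. block_index A m - 1"])
    have b1: "1 \<le> block_index A m" for m using block_index_pos[of A m] by linarith
    show "bij_betw (\<lambda>m. block_index A m - 1) {m \<in> block_starts A l. block_index A m \<le> k}
        {j \<in> {..k - 1}. ?w (1 + j)}"
      unfolding bij_betw_def
    proof
      show "inj_on (\<lambda>m. block_index A m - 1) {m \<in> block_starts A l. block_index A m \<le> k}"
      proof (rule inj_onI)
        fix m m' assume m: "m \<in> {m \<in> block_starts A l. block_index A m \<le> k}"
          "m' \<in> {m \<in> block_starts A l. block_index A m \<le> k}" "block_index A m - 1 = block_index A m' - 1"
        then have "block_index A m = block_index A m'" using m(3) b1[of m] b1[of m'] by linarith
        then show "m = m'" using m inj_onD[OF inj_block_starts] by blast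
      qed
      show "(\<lambda>m. block_index A m - 1) ` {m \<in> block_starts A l. block_index A m \<le> k} =
          {j \<in> {..k - 1}. ?w (1 + j)}"
      proof (intro equalityI subsetI)
        fix j assume "j \<in> (\<lambda>m. block_index A m - 1) ` {m \<in> block_starts A l. block_index A m \<le> k}"
        then obtain m where m: "m \<in> block_starts A l" "block_index A m \<le> k" "j = block_index A m - 1" by blast
        then have "1 + j = block_index A m" using b1[of m] by linarith
        then show "j \<in> {j \<in> {..k - 1}. ?w (1 + j)}" unfolding w using m k by auto
      next
        fix j assume "j \<in> {j \<in> {..k - 1}. ?w (1 + j)}"
        then have j: "j \<le> k - 1" "1 + j \<in> block_index A ` block_starts A l" unfolding w by auto
        then obtain m where m: "m \<in> block_starts A l" "1 + j = block_index A m" by blast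
        then have "j = block_index A m - 1" "block_index A m \<le> k" using j(1) k by auto
        then show "j \<in> (\<lambda>m. block_index A m - 1) ` {m \<in> block_starts A l. block_index A m \<le> k}"
          using m(1) by blast
      qed
    qed
  qed
  finally show ?thesis unfolding graph_count_def .
qed

lemma threshold_graphs_cong:
  assumes "\<And>x y. x \<in> X \<Longrightarrow> y \<in> X \<Longrightarrow> f x \<le> f y \<longleftrightarrow> g x \<le> g y"
  shows "threshold_graphs X f = threshold_graphs X g"
proof -
  have "M \<in> threshold_graphs X g" if "M \<in> threshold_graphs X f"
    "\<And>x y. x \<in> X \<Longrightarrow> y \<in> X \<Longrightarrow> f x \<le> f y \<longleftrightarrow> g x \<le> g y" for M and f g :: "int \<Rightarrow> int"
    using that unfolding threshold_graphs_def by blast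
  from this[of _ f g] this[of _ g f] show ?thesis using assms by blast
qed

subsection \<open>Levels and blocks\<close>

lemma sum_levels:
  assumes "1 \<le> x" "x \<le> l"
  shows "(\<Sum>k\<in>{x..<l}. if k \<in> A then 0 else 2) = 2 * (int (block_index A l) - int (block_index A x))"
  using assms(2)
proof (induction l rule: dec_induct)
  case (step l)
  then show ?case using block_index_Suc[of l A] assms(1) by (simp add: sum.atLeastLessThan_Suc)
qed simp

lemma level_block_index:
  assumes "1 \<le> x" "x \<le> int l"
  shows "level l A x = 2 * (int (block_index A l) - int (block_index A (nat x)))
    + (if l \<in> A then 0 else 1) - (if l - 1 \<in> A then 0 else 1)"
  using assms sum_levels[of "nat x" l A] by (simp add: level_def)

subsection \<open>The number of abelian ideals in terms of blocks\<close>

lemma rel_ideals_cong: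
  assumes "\<And>x. x \<in> signed_indices l \<Longrightarrow> f x = g x"
  shows "rel_ideals l f = rel_ideals l g"
proof -
  have sub: "rel_ideals l f \<subseteq> rel_ideals l g"
    if e: "\<And>x. x \<in> signed_indices l \<Longrightarrow> f x = g x" for f g :: "int \<Rightarrow> int"
  proof
    fix M assume "M \<in> rel_ideals l f"
    then have M: "\<And>x y. (x, y) \<in> M \<Longrightarrow> x \<in> signed_indices l \<and> y \<in> signed_indices l \<and> \<bar>x\<bar> \<noteq> \<bar>y\<bar> \<and> 0 < f x + f y"
      "sym M"
      "\<And>x y z. (x, y) \<in> M \<Longrightarrow> z \<in> signed_indices l \<Longrightarrow> f y \<le> f z \<Longrightarrow> \<bar>z\<bar> \<noteq> \<bar>x\<bar> \<Longrightarrow> \<bar>z\<bar> \<noteq> \<bar>y\<bar> \<Longrightarrow> (x, z) \<in> M"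
      "\<And>x y z. (x, y) \<in> M \<Longrightarrow> (- y, z) \<in> M \<Longrightarrow> \<bar>x\<bar> = \<bar>z\<bar>"
      unfolding rel_ideals_def by blast+
    have "M \<subseteq> {(x, y). x \<in> signed_indices l \<and> y \<in> signed_indices l \<and> \<bar>x\<bar> \<noteq> \<bar>y\<bar> \<and> 0 < g x + g y}"
    proof (rule subrelI)
      fix x y assume "(x, y) \<in> M"
      then show "(x, y) \<in> {(x, y). x \<in> signed_indices l \<and> y \<in> signed_indices l \<and> \<bar>x\<bar> \<noteq> \<bar>y\<bar> \<and> 0 < g x + g y}"
        using M(1)[of x y] e[of x] e[of y] by simp
    qed
    moreover have "(x, z) \<in> M" if "(x, y) \<in> M" "z \<in> signed_indices l" "g y \<le> g z" "\<bar>z\<bar> \<noteq> \<bar>x\<bar>" "\<bar>z\<bar> \<noteq> \<bar>y\<bar>" for x y z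
      using that M(1)[OF that(1)] e[of y] e[of z] by (intro M(3)[OF that(1)]) auto
    ultimately show "M \<in> rel_ideals l g" unfolding rel_ideals_def using M(2,4) by blast
  qed
  show ?thesis using sub[of f g] sub[of g f] assms by auto
qed

text \<open>The level of an index is a decreasing function of its block, so the whole of \<open>{1..l}\<close> consists of
  \<open>D\<close> blocks and the set \<open>Q\<close> of indices above the last level of the first \<open>D - 1\<close>. The three cases
  of \<open>card_rel_ideals\<close> differ by the levels of \<open>l - 1\<close> and \<open>l\<close>.\<close>

lemma card_rel_ideals_blocks:
  assumes l: "4 \<le> l" and A: "l \<in> A \<Longrightarrow> l - 1 \<in> A"
  defines "D \<equiv> block_index A l"
  shows "l - 1 \<notin> A \<Longrightarrow> card (rel_ideals l (level l A)) + graph_count A l (D - 1) =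
      2 * graph_count A l D + (if 1 \<in> A then 0 else graph_count A l (D - 1))"
    and "l - 1 \<in> A \<Longrightarrow> l \<notin> A \<Longrightarrow> card (rel_ideals l (level l A)) =
      graph_count A l D + (if 1 \<in> A then 0 else graph_count A l (D - 1))"
    and "l \<in> A \<Longrightarrow> 1 < D \<Longrightarrow> card (rel_ideals l (level l A)) =
      graph_count A l (D - 1) + (if 1 \<in> A then 0 else graph_count A l (D - 1))"
    and "l \<in> A \<Longrightarrow> D = 1 \<Longrightarrow> card (rel_ideals l (level l A)) = 1"
proof -
  let ?lam = "level l A" and ?b = "\<lambda>x. block_index A (nat x)"
  let ?c = "(if l \<in> A then 0 else 1) - (if l - 1 \<in> A then 0 else 1) :: int"
  have lam: "?lam x = 2 * (int D - int (?b x)) + ?c" if "1 \<le> x" "x \<le> int l" for x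
    using level_block_index[OF that, of A] unfolding D_def by linarith
  have last: "?lam (int l) = ?c" using lam[of "int l"] l by (simp add: D_def)
  have l1: "D = (if l - 1 \<in> A then block_index A (l - 1) else Suc (block_index A (l - 1)))"
    using block_index_Suc[of "l - 1" A] l by (simp add: D_def)
  have "nat (int l - 1) = l - 1" by simp
  then have last1: "?lam (int l - 1) = ?c + (if l - 1 \<in> A then 0 else 2)"
    using lam[of "int l - 1"] l l1 by simp
  interpret dominance l ?lam
  proof
    show "4 \<le> l" by (rule l)
    show "?lam (- x) = - ?lam x" for x by (simp add: level_def sgn_minus)
    show "?lam y \<le> ?lam x" if "1 \<le> x" "x \<le> y" "y \<le> int l" for x y
      using that lam[of x] lam[of y] block_index_mono[of "nat x" "nat y" A] by simp
    show "0 \<le> ?lam (int l)" using last A by auto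
  qed
  have "block_index A 2 = (if 1 \<in> A then 1 else 2)" using block_index_Suc[of 1 A] by (simp add: numeral_2_eq_2)
  then have first: "?lam 1 = ?lam 2 \<longleftrightarrow> 1 \<in> A" using lam[of 1] lam[of 2] l by simp
  have thr: "card (threshold_graphs {x. 1 \<le> x \<and> x \<le> int l \<and> ?b x \<le> k} ?lam) = graph_count A l k"
    if k: "1 \<le> k" "k \<le> D" for k
  proof -
    have "threshold_graphs {x. 1 \<le> x \<and> x \<le> int l \<and> ?b x \<le> k} ?lam =
        threshold_graphs {x. 1 \<le> x \<and> x \<le> int l \<and> ?b x \<le> k} (\<lambda>x. - int (?b x))"
      by (rule threshold_graphs_cong) (simp add: lam)
    then show ?thesis using card_threshold_graphs_blocks[OF k(1) k(2)[unfolded D_def]] l by simp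
  qed
  have D1: "1 \<le> D" by (simp add: D_def Suc_le_eq)
  have bD: "?b x \<le> D" if "x \<le> int l" for x
    using block_index_mono[of "nat x" l A] that by (simp add: D_def)
  have "{1..int l} = {x. 1 \<le> x \<and> x \<le> int l \<and> ?b x \<le> D}" using bD by auto
  then have full: "card (threshold_graphs {1..int l} ?lam) = graph_count A l D"
    using thr[of D] D1 by simp
  have Q: "Q = {x. 1 \<le> x \<and> x \<le> int l \<and> ?b x \<le> D - 1}"
  proof (intro set_eqI)
    fix x
    show "x \<in> Q \<longleftrightarrow> x \<in> {x. 1 \<le> x \<and> x \<le> int l \<and> ?b x \<le> D - 1}"
      using lam[of x] last D1 by (auto simp: Q_def)
  qed
  have cQ: "card (threshold_graphs Q ?lam) = graph_count A l (D - 1)" if "1 < D"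
    unfolding Q using that by (intro thr) auto
  have D2: "1 < D" if "1 \<notin> A"
    using that bD[of 2] l \<open>block_index A 2 = _\<close> by simp
  have cQ1: "(if 1 \<in> A then 0 else card (threshold_graphs Q ?lam)) =
      (if 1 \<in> A then 0 else graph_count A l (D - 1))"
    using cQ D2 by simp
  {
    assume t: "l - 1 \<notin> A"
    then have "l \<notin> A" using A by blast
    have "1 < D" using l1 t block_index_pos[of A "l - 1"] by simp
    then show "card (rel_ideals l ?lam) + graph_count A l (D - 1) =
        2 * graph_count A l D + (if 1 \<in> A then 0 else graph_count A l (D - 1))"
      using card_rel_ideals(1) last last1 t \<open>l \<notin> A\<close> full cQ first by simp
  next
    assume t: "l - 1 \<in> A" "l \<notin> A"
    then show "card (rel_ideals l ?lam) =
        graph_count A l D + (if 1 \<in> A then 0 else graph_count A l (D - 1))"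
      using card_rel_ideals(2) last last1 full cQ1 first by simp
  next
    assume t: "l \<in> A"
    then have t': "l - 1 \<in> A" using A by blast
    have c: "card (rel_ideals l ?lam) = card (threshold_graphs Q ?lam) +
        (if 1 \<in> A then 0 else card (threshold_graphs Q ?lam))"
      using card_rel_ideals(3) last last1 t t' first by simp
    show "card (rel_ideals l ?lam) =
        graph_count A l (D - 1) + (if 1 \<in> A then 0 else graph_count A l (D - 1))" if "1 < D"
      using c cQ[OF that] by simp
    show "card (rel_ideals l ?lam) = 1" if "D = 1"
    proof -
      have "?b x \<noteq> 0" for x by (simp add: block_index_def)
      then have "Q = {}" unfolding Q using that by auto
      moreover have "threshold_graphs {} ?lam = {{}}" by (auto simp: threshold_graphs_def sym_def)
      moreover have "1 \<in> A" using D2 that by auto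
      ultimately show ?thesis using c by simp
    qed
  }
qed

section \<open>Connected components\<close>

text \<open>In the diagram every node has at most one neighbour of smaller index, so the diagram is a tree
  rooted at 1, and a component of a set \<open>A\<close> of nodes is determined by its smallest node.\<close>

definition parent :: "nat \<Rightarrow> nat \<Rightarrow> nat" where
  "parent l i = (if i = l then l - 2 else i - 1)"

function comp_root :: "nat \<Rightarrow> nat set \<Rightarrow> nat \<Rightarrow> nat" where
  "comp_root l A i = (if parent l i \<in> A \<and> parent l i < i then comp_root l A (parent l i) else i)"
  by auto
termination by (relation "measure (\<lambda>(l, A, i). i)") auto

declare comp_root.simps [simp del]

definition comp_roots :: "nat \<Rightarrow> nat set \<Rightarrow> nat set" where
  "comp_roots l A = {m \<in> A. parent l m \<notin> A}"

context
  fixes l :: nat and A :: "nat set"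
  assumes l: "4 \<le> l" and A: "A \<subseteq> {1..l}"
begin

lemma parent_less: "i \<in> A \<Longrightarrow> parent l i < i"
  using A l by (auto simp: parent_def)

lemma comp_root_step: "i \<in> A \<Longrightarrow> comp_root l A i = (if parent l i \<in> A then comp_root l A (parent l i) else i)"
  using parent_less[of i] by (subst comp_root.simps) simp

lemma comp_root_mem: "i \<in> A \<Longrightarrow> comp_root l A i \<in> comp_roots l A \<and> comp_root l A i \<le> i"
proof (induction i rule: less_induct)
  case (less i)
  show ?case
  proof (cases "parent l i \<in> A")
    case True
    then show ?thesis
      using less.IH[OF parent_less[OF less.prems] True] parent_less[OF less.prems] comp_root_step[OF less.prems]
      by simp
  next
    case False
    then show ?thesis using comp_root_step[OF less.prems] less.prems by (simp add: comp_roots_def)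
  qed
qed

lemma comp_root_of_root: "m \<in> comp_roots l A \<Longrightarrow> comp_root l A m = m"
  using comp_root_step[of m] by (simp add: comp_roots_def)

text \<open>This will turn the total size of the preceding components into the number of smaller nodes of
  \<open>A\<close>.\<close>

lemma comp_root_less_iff:
  assumes "i \<in> A" "m \<in> comp_roots l A"
  shows "comp_root l A i < m \<longleftrightarrow> i < m"
proof
  show "comp_root l A i < m" if "i < m" using comp_root_mem[OF assms(1)] that by linarith
  show "i < m" if "comp_root l A i < m"
    using assms(1) that
  proof (induction i rule: less_induct)
    case (less i)
    show ?case
    proof (rule ccontr)
      assume "\<not> i < m"
      have "i \<noteq> m" using less.prems comp_root_of_root[OF assms(2)] by auto
      then have im: "m < i" using \<open>\<not> i < m\<close> by simp
      have p: "parent l i \<in> A"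
        using less.prems comp_root_step[OF less.prems(1)] im by (auto split: if_splits)
      then have "parent l i < m"
        using less.IH[OF parent_less[OF less.prems(1)] p] less.prems comp_root_step[OF less.prems(1)]
        by simp
      \<comment> \<open>only the edge from \<open>l\<close> to \<open>l - 2\<close> skips a node\<close>
      then have "i = l" "m = l - 1" using im by (auto simp: parent_def split: if_splits)
      then have "parent l m = parent l i" using l by (auto simp: parent_def)
      then show False using p assms(2) by (simp add: comp_roots_def)
    qed
  qed
qed

lemma comp_roots_no_l: "l \<notin> A \<Longrightarrow> comp_roots l A = block_starts A l"
  using A l by (auto simp: comp_roots_def block_starts_def parent_def)

lemma card_below: "1 \<le> m \<Longrightarrow> m \<le> l \<Longrightarrow> block_index A m = m - card {i \<in> A. i < m}"
proof -
  assume m: "1 \<le> m" "m \<le> l"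
  have e: "{1..<m} \<inter> A = {i \<in> A. i < m}" using A by auto
  have "card ({1..<m} - A) = card {1..<m} - card ({1..<m} \<inter> A)" by (rule card_Diff_subset_Int) simp
  moreover have "card ({1..<m} \<inter> A) \<le> card {1..<m}" by (rule card_mono) auto
  ultimately show ?thesis using m unfolding block_index_def e by simp
qed

text \<open>The last block of \<open>{1..l}\<close> contains \<open>l - 1\<close> and \<open>l\<close>, so it is the last nontrivial block as well.\<close>

lemma last_block_start:
  assumes "l - 1 \<in> A"
  shows "block_starts A l \<noteq> {}"
    and "block_index A (Max (block_starts A l)) = block_index A l"
    and "{m \<in> block_starts A l. block_index A m \<le> block_index A l - 1} =
      block_starts A l - {Max (block_starts A l)}"
proof -
  have "block_index A l = block_index A (l - 1)" using block_index_Suc[of "l - 1" A] assms l by simp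
  then have "{l - 1, l} \<subseteq> {x \<in> {1..l}. block_index A x = block_index A l}" using l by auto
  then have "card {l - 1, l} \<le> card {x \<in> {1..l}. block_index A x = block_index A l}"
    by (intro card_mono) auto
  then have "block_index A l \<in> block_index A ` block_starts A l"
    unfolding block_starts_image using l by simp
  then obtain m where m: "m \<in> block_starts A l" "block_index A m = block_index A l" by auto
  have le: "block_index A m' \<le> block_index A l" if "m' \<in> block_starts A l" for m'
    using that by (intro block_index_mono) (auto simp: block_starts_def)
  have max: "m' \<le> m" if m': "m' \<in> block_starts A l" for m'
  proof (rule ccontr)
    assume "\<not> m' \<le> m"
    then have "block_index A m \<le> block_index A m'" by (intro block_index_mono) simp
    then have "block_index A m = block_index A m'" using m(2) le[OF m'] by simp
    then have "m = m'" using m(1) m' inj_onD[OF inj_block_starts] by blast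
    then show False using \<open>\<not> m' \<le> m\<close> by simp
  qed
  have Max: "Max (block_starts A l) = m" using finite_block_starts max m(1) by (rule Max_eqI)
  show "block_starts A l \<noteq> {}" using m(1) by blast
  show "block_index A (Max (block_starts A l)) = block_index A l" using Max m(2) by simp
  have "block_index A m' \<le> block_index A l - 1 \<longleftrightarrow> m' \<noteq> m" if m': "m' \<in> block_starts A l" for m'
  proof -
    have "block_index A m' = block_index A l \<longleftrightarrow> m' = m"
      using m m' inj_onD[OF inj_block_starts[of A l], of m' m] by auto
    then show ?thesis using le[OF m'] block_index_pos[of A l] by linarith
  qed
  then show "{m \<in> block_starts A l. block_index A m \<le> block_index A l - 1} =
      block_starts A l - {Max (block_starts A l)}" unfolding Max by auto
qed

end

text \<open>The number \<open>l\<^sub>j\<close> as a function of the smallest node of the component.\<close>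

definition shifted_root :: "nat \<Rightarrow> nat set \<Rightarrow> nat \<Rightarrow> nat" where
  "shifted_root l A m = m - card {i \<in> A. i < m} - (if m = l then 1 else 0)"

context simple_lie_algebra_type_D
begin

lemma edge_iff:
  assumes "i \<in> {1..l}" "j \<in> {1..l}"
  shows "(\<alpha> i, \<alpha> j) \<in> dynkin_edges H \<longleftrightarrow> i = parent l j \<or> j = parent l i"
proof -
  have sym: "dynkin_bonds H \<beta> \<gamma> = dynkin_bonds H \<gamma> \<beta>" for \<beta> \<gamma>
    by (simp add: dynkin_bonds_def mult.commute)
  have inj: "\<alpha> i = \<alpha> j \<longleftrightarrow> i = j"
    using assms inj_onD[OF bij_betw_imp_inj_on[OF bij_alpha]] by blast
  have less: "dynkin_bonds H (\<alpha> i) (\<alpha> j) \<noteq> 0 \<longleftrightarrow> i = parent l j" and nless: "j \<noteq> parent l i"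
    if ij: "i \<in> {1..l}" "j \<in> {1..l}" "i < j" for i j
  proof -
    have "(j = i + 1 \<and> j \<le> l - 1) \<or> (i = l - 2 \<and> j = l) \<longleftrightarrow> i = parent l j"
      using ij l_ge_4 by (auto simp: parent_def)
    then show "dynkin_bonds H (\<alpha> i) (\<alpha> j) \<noteq> 0 \<longleftrightarrow> i = parent l j" using bonds[OF ij] by simp
    show "j \<noteq> parent l i" using ij by (auto simp: parent_def)
  qed
  consider "i < j" | "i = j" | "j < i" by linarith
  then show ?thesis
  proof cases
    case 1
    then show ?thesis using less[OF assms 1] nless[OF assms 1] inj by (simp add: dynkin_edges_def)
  next
    case 2
    then show ?thesis using assms l_ge_4 by (auto simp: dynkin_edges_def parent_def)
  next
    case 3
    then show ?thesis using less[OF assms(2,1) 3] nless[OF assms(2,1) 3] inj sym[of "\<alpha> i" "\<alpha> j"]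
      by (simp add: dynkin_edges_def)
  qed
qed

definition node_set :: "('a \<Rightarrow> complex) set \<Rightarrow> nat set" where
  "node_set I = {i \<in> {1..l}. \<alpha> i \<in> I}"

lemma node_set_sub: "node_set I \<subseteq> {1..l}" "finite (node_set I)"
  by (auto simp: node_set_def)

lemma alpha_inj: "i \<in> {1..l} \<Longrightarrow> j \<in> {1..l} \<Longrightarrow> \<alpha> i = \<alpha> j \<Longrightarrow> i = j"
  using inj_onD[OF bij_betw_imp_inj_on[OF bij_alpha]] by blast

lemma I_nodes: "I \<subseteq> P \<Longrightarrow> I = \<alpha> ` node_set I"
  unfolding node_set_def P_alpha by auto

lemma card_alpha_image: "N \<subseteq> {1..l} \<Longrightarrow> card (\<alpha> ` N) = card N"
  by (rule card_image) (rule inj_on_subset[OF bij_betw_imp_inj_on[OF bij_alpha]])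

definition component :: "('a \<Rightarrow> complex) set \<Rightarrow> nat \<Rightarrow> ('a \<Rightarrow> complex) set" where
  "component I m = \<alpha> ` {i \<in> node_set I. comp_root l (node_set I) i = m}"

text \<open>Adjacent nodes have the same root, and every node is joined to its root by the chain of its parents.\<close>

lemma component_of_node:
  assumes I: "I \<subseteq> P" and i: "i \<in> node_set I"
  shows "(Restr (dynkin_edges H) I)\<^sup>* `` {\<alpha> i} = component I (comp_root l (node_set I) i)"
proof -
  let ?A = "node_set I"
  let ?R = "Restr (dynkin_edges H) I"
  let ?r = "comp_root l ?A"
  note root = comp_root_mem[OF l_ge_4 node_set_sub(1)[of I]]
  note step = comp_root_step[OF l_ge_4 node_set_sub(1)[of I]]
  have edge: "(\<alpha> i, \<alpha> j) \<in> ?R \<longleftrightarrow> i = parent l j \<or> j = parent l i" if "i \<in> ?A" "j \<in> ?A" for i j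
    using that edge_iff[of i j] by (auto simp: node_set_def)
  have "\<exists>j\<in>?A. \<gamma> = \<alpha> j \<and> ?r j = ?r i" if "(\<alpha> i, \<gamma>) \<in> ?R\<^sup>*" for \<gamma>
    using that
  proof (induction rule: rtrancl_induct)
    case base
    then show ?case using i by blast
  next
    case (step \<gamma> \<delta>)
    obtain j where j: "j \<in> ?A" "\<gamma> = \<alpha> j" "?r j = ?r i" using step.IH by blast
    have "\<delta> \<in> I" using step.hyps(2) by blast
    then obtain k where k: "k \<in> ?A" "\<delta> = \<alpha> k" using I_nodes[OF I] by blast
    have "j = parent l k \<or> k = parent l j" using edge[OF j(1) k(1)] step.hyps(2) j(2) k(2) by blast
    then have "?r k = ?r j"
      using \<open>\<And>i. i \<in> ?A \<Longrightarrow> ?r i = _\<close>[of k] \<open>\<And>i. i \<in> ?A \<Longrightarrow> ?r i = _\<close>[of j] j(1) k(1) by auto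
    then show ?case using k j(3) by auto
  qed
  then have sub: "?R\<^sup>* `` {\<alpha> i} \<subseteq> component I (?r i)" unfolding component_def by blast
  have "sym ?R"
    unfolding sym_def dynkin_edges_def dynkin_bonds_def by (auto simp: mult.commute)
  then have sR: "sym (?R\<^sup>*)" by (rule sym_rtrancl)
  have to_root: "(\<alpha> j, \<alpha> (?r j)) \<in> ?R\<^sup>*" if "j \<in> ?A" for j
    using that
  proof (induction j rule: less_induct)
    case (less j)
    show ?case
    proof (cases "parent l j \<in> ?A")
      case True
      have "(\<alpha> j, \<alpha> (parent l j)) \<in> ?R" using edge[OF less.prems True] by blast
      moreover have "(\<alpha> (parent l j), \<alpha> (?r j)) \<in> ?R\<^sup>*"
        using less.IH[OF parent_less[OF l_ge_4 node_set_sub(1) less.prems] True] step[OF less.prems] True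
        by simp
      ultimately show ?thesis by (rule converse_rtrancl_into_rtrancl)
    next
      case False
      then show ?thesis using step[OF less.prems] by simp
    qed
  qed
  have "component I (?r i) \<subseteq> ?R\<^sup>* `` {\<alpha> i}"
  proof
    fix \<gamma> assume "\<gamma> \<in> component I (?r i)"
    then obtain j where j: "j \<in> ?A" "\<gamma> = \<alpha> j" "?r j = ?r i" unfolding component_def by blast
    have "(\<alpha> i, \<alpha> (?r j)) \<in> ?R\<^sup>*" using to_root[OF i] j(3) by simp
    moreover have "(\<alpha> (?r j), \<gamma>) \<in> ?R\<^sup>*" using symD[OF sR to_root[OF j(1)]] j(2) by simp
    ultimately show "\<gamma> \<in> ?R\<^sup>* `` {\<alpha> i}" by (blast intro: rtrancl_trans)
  qed
  then show ?thesis using sub by blast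
qed

lemma dynkin_components_eq:
  assumes I: "I \<subseteq> P"
  shows "dynkin_components H I = component I ` comp_roots l (node_set I)"
proof -
  let ?A = "node_set I"
  have "dynkin_components H I = (\<lambda>\<gamma>. (Restr (dynkin_edges H) I)\<^sup>* `` {\<gamma>}) ` I"
    unfolding dynkin_components_def quotient_def by blast
  also have "\<dots> = (\<lambda>\<gamma>. (Restr (dynkin_edges H) I)\<^sup>* `` {\<gamma>}) ` (\<alpha> ` ?A)"
    using I_nodes[OF I] by (rule arg_cong)
  also have "\<dots> = (\<lambda>i. (Restr (dynkin_edges H) I)\<^sup>* `` {\<alpha> i}) ` ?A"
    by (rule image_image)
  also have "\<dots> = (\<lambda>i. component I (comp_root l ?A i)) ` ?A"
    using component_of_node[OF I] by (intro image_cong) auto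
  also have "\<dots> = component I ` comp_roots l ?A"
  proof (intro equalityI image_subsetI)
    fix i assume "i \<in> ?A"
    then show "component I (comp_root l ?A i) \<in> component I ` comp_roots l ?A"
      using comp_root_mem[OF l_ge_4 node_set_sub(1)] by blast
  next
    fix m assume m: "m \<in> comp_roots l ?A"
    then have "m \<in> ?A" "comp_root l ?A m = m"
      using comp_root_of_root[OF l_ge_4 node_set_sub(1)] by (auto simp: comp_roots_def)
    then show "component I m \<in> (\<lambda>i. component I (comp_root l ?A i)) ` ?A" by (metis image_eqI)
  qed
  finally show ?thesis .
qed

lemma min_index_component:
  assumes m: "m \<in> comp_roots l (node_set I)"
  shows "min_index \<alpha> l (component I m) = m"
proof -
  let ?A = "node_set I"
  let ?N = "{i \<in> ?A. comp_root l ?A i = m}"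
  have "{i \<in> {1..l}. \<alpha> i \<in> component I m} = ?N"
    unfolding component_def using alpha_inj node_set_sub(1)[of I] by blast
  moreover have "Min ?N = m"
  proof (rule Min_eqI)
    show "finite ?N" using node_set_sub(2) by simp
    show "m \<in> ?N" using m comp_root_of_root[OF l_ge_4 node_set_sub(1) m] by (simp add: comp_roots_def)
    show "m \<le> i" if "i \<in> ?N" for i using that comp_root_mem[OF l_ge_4 node_set_sub(1), of i I] by auto
  qed
  ultimately show ?thesis unfolding min_index_def by simp
qed

context
  fixes I :: "('a \<Rightarrow> complex) set" and C :: "nat \<Rightarrow> ('a \<Rightarrow> complex) set" and s :: nat
  assumes I: "I \<subseteq> P"
    and C: "bij_betw C {1..s} (dynkin_components H I)"
    and ordered: "\<forall>j\<in>{1..s}. \<forall>k\<in>{1..s}. j < k \<longrightarrow> min_index \<alpha> l (C j) < min_index \<alpha> l (C k)"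
begin

abbreviation (input) "A \<equiv> node_set I"
abbreviation (input) "root_at \<equiv> \<lambda>j. min_index \<alpha> l (C j)"

lemma root_at:
  assumes "j \<in> {1..s}"
  shows "root_at j \<in> comp_roots l A" "C j = component I (root_at j)"
proof -
  have "C j \<in> component I ` comp_roots l A"
    using bij_betwE[OF C] assms unfolding dynkin_components_eq[OF I] by blast
  then obtain m where m: "m \<in> comp_roots l A" "C j = component I m" by blast
  then show "root_at j \<in> comp_roots l A" "C j = component I (root_at j)"
    using min_index_component[OF m(1)] by simp_all
qed

lemma root_at_less_iff: "j \<in> {1..s} \<Longrightarrow> k \<in> {1..s} \<Longrightarrow> root_at j < root_at k \<longleftrightarrow> j < k"
  using ordered by (metis linorder_neqE_nat less_asym less_irrefl)

lemma bij_root_at: "bij_betw root_at {1..s} (comp_roots l A)"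
  unfolding bij_betw_def
proof
  show "inj_on root_at {1..s}"
    by (rule inj_onI) (metis root_at_less_iff linorder_neqE_nat less_irrefl)
  show "root_at ` {1..s} = comp_roots l A"
  proof (intro equalityI subsetI)
    fix m assume m: "m \<in> comp_roots l A"
    then have "component I m \<in> C ` {1..s}"
      unfolding bij_betw_imp_surj_on[OF C] dynkin_components_eq[OF I] by blast
    then obtain j where j: "j \<in> {1..s}" "component I m = C j" by blast
    then have "root_at j = m" using min_index_component[OF m] by simp
    then show "m \<in> root_at ` {1..s}" using j(1) by blast
  qed (use root_at(1) in blast)
qed

lemma sum_card_components:
  assumes j: "j \<in> {1..s}"
  shows "(\<Sum>k\<in>{1..<j}. card (C k)) = card {i \<in> A. i < root_at j}"
proof -
  let ?r = "comp_root l A"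
  let ?N = "\<lambda>m. {i \<in> A. ?r i = m}"
  have "bij_betw root_at {1..<j} {m \<in> comp_roots l A. m < root_at j}"
    unfolding bij_betw_def
  proof
    show "inj_on root_at {1..<j}"
      using bij_betw_imp_inj_on[OF bij_root_at] by (rule inj_on_subset) (use j in auto)
    show "root_at ` {1..<j} = {m \<in> comp_roots l A. m < root_at j}"
    proof (intro equalityI subsetI)
      fix m assume "m \<in> root_at ` {1..<j}"
      then obtain k where "k \<in> {1..s}" "k < j" "m = root_at k" using j by auto
      then show "m \<in> {m \<in> comp_roots l A. m < root_at j}" using root_at(1) root_at_less_iff[OF _ j] by blast
    next
      fix m assume m: "m \<in> {m \<in> comp_roots l A. m < root_at j}"
      then have "m \<in> root_at ` {1..s}" unfolding bij_betw_imp_surj_on[OF bij_root_at] by blast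
      then obtain k where k: "k \<in> {1..s}" "m = root_at k" by blast
      then have "k < j" using m root_at_less_iff[OF k(1) j] by simp
      then show "m \<in> root_at ` {1..<j}" using k by auto
    qed
  qed
  moreover have "(\<Sum>k\<in>{1..<j}. card (C k)) = (\<Sum>k\<in>{1..<j}. card (?N (root_at k)))"
  proof (rule sum.cong[OF refl])
    fix k assume "k \<in> {1..<j}"
    then have k: "k \<in> {1..s}" using j by simp
    have "?N (root_at k) \<subseteq> {1..l}" using node_set_sub(1) by blast
    then have "card (component I (root_at k)) = card (?N (root_at k))"
      unfolding component_def by (rule card_alpha_image)
    then show "card (C k) = card (?N (root_at k))" using root_at(2)[OF k] by simp
  qed
  ultimately have "(\<Sum>k\<in>{1..<j}. card (C k)) = (\<Sum>m\<in>{m \<in> comp_roots l A. m < root_at j}. card (?N m))"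
    using sum.reindex_bij_betw[of root_at "{1..<j}" _ "\<lambda>m. card (?N m)"] by simp
  also have "\<dots> = card (\<Union>m\<in>{m \<in> comp_roots l A. m < root_at j}. ?N m)"
  proof (rule card_UN_disjoint[symmetric])
    show "finite {m \<in> comp_roots l A. m < root_at j}" by (rule finite_subset[of _ "{..<root_at j}"]) auto
    show "\<forall>m\<in>{m \<in> comp_roots l A. m < root_at j}. finite (?N m)" using node_set_sub(2) by simp
  qed auto
  also have "(\<Union>m\<in>{m \<in> comp_roots l A. m < root_at j}. ?N m) = {i \<in> A. i < root_at j}"
    using comp_root_less_iff[OF l_ge_4 node_set_sub(1) _ root_at(1)[OF j]]
      comp_root_mem[OF l_ge_4 node_set_sub(1)] by blast
  finally show ?thesis .
qed

lemma root_le_l: "m \<in> comp_roots l A \<Longrightarrow> m \<le> l"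
  by (auto simp: comp_roots_def node_set_def)

text \<open>The exceptional case is the component \<open>{\<alpha>\<^sub>l}\<close>: it is the only one with root \<open>l\<close>, and a component with
  root \<open>l\<close> comes last.\<close>

lemma shifted_index_root:
  assumes j: "j \<in> {1..s}"
  shows "shifted_index \<alpha> l C s j = shifted_root l A (root_at j)"
proof -
  have "j = s \<and> C s = {\<alpha> l} \<longleftrightarrow> root_at j = l"
  proof
    assume e: "j = s \<and> C s = {\<alpha> l}"
    have "{i \<in> {1..l}. \<alpha> i \<in> {\<alpha> l}} = {l}" using alpha_inj[of _ l] l_ge_4 by auto
    then show "root_at j = l" using e by (simp add: min_index_def)
  next
    assume e: "root_at j = l"
    have "j = s"
    proof (rule ccontr)
      assume "j \<noteq> s"
      then have s: "s \<in> {1..s}" "j < s" using j by auto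
      then have "l < root_at s" using root_at_less_iff[OF j s(1)] e by simp
      then show False using root_le_l[OF root_at(1)[OF s(1)]] by simp
    qed
    moreover have "component I l = {\<alpha> l}"
    proof -
      have lr: "l \<in> comp_roots l A" using root_at(1)[OF j] e by simp
      have "{i \<in> A. comp_root l A i = l} = {l}"
      proof (intro equalityI subsetI)
        fix i assume "i \<in> {i \<in> A. comp_root l A i = l}"
        then have "i \<in> A" "l \<le> i" using comp_root_mem[OF l_ge_4 node_set_sub(1), of i I] by auto
        then show "i \<in> {l}" by (auto simp: node_set_def)
      qed (use lr comp_root_of_root[OF l_ge_4 node_set_sub(1) lr] in \<open>auto simp: comp_roots_def\<close>)
      then show ?thesis by (simp add: component_def)
    qed
    ultimately show "j = s \<and> C s = {\<alpha> l}" using root_at(2)[OF j] e by simp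
  qed
  then show ?thesis
    using sum_card_components[OF j] by (auto simp: shifted_index_def shifted_root_def)
qed

lemma sum_over_components:
  "(\<Sum>j=1..s. F (shifted_index \<alpha> l C s j)) = (\<Sum>m\<in>comp_roots l A. F (shifted_root l A m))"
proof -
  have "(\<Sum>j=1..s. F (shifted_index \<alpha> l C s j)) = (\<Sum>j\<in>{1..s}. F (shifted_root l A (root_at j)))"
    by (intro sum.cong refl) (simp only: shifted_index_root)
  also have "\<dots> = (\<Sum>m\<in>comp_roots l A. F (shifted_root l A m))"
    by (rule sum.reindex_bij_betw[OF bij_root_at])
  finally show ?thesis .
qed

lemma sum_over_all_but_last:
  "(\<Sum>j=1..s - 1. F (shifted_index \<alpha> l C s j)) =
    (\<Sum>m\<in>comp_roots l A - {Max (comp_roots l A)}. F (shifted_root l A m))"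
proof (cases "s = 0")
  case True
  then have "comp_roots l A = {}" using bij_root_at by (simp add: bij_betw_def)
  then show ?thesis using True by simp
next
  case False
  then have s: "s \<in> {1..s}" by simp
  have fin: "finite (comp_roots l A)"
    using finite_subset[of "comp_roots l A" A] node_set_sub(2) by (auto simp: comp_roots_def)
  have "Max (comp_roots l A) = root_at s"
  proof (rule Max_eqI[OF fin])
    show "root_at s \<in> comp_roots l A" by (rule root_at(1)[OF s])
    fix m assume "m \<in> comp_roots l A"
    then have "m \<in> root_at ` {1..s}" unfolding bij_betw_imp_surj_on[OF bij_root_at] .
    then obtain j where j: "j \<in> {1..s}" "m = root_at j" by blast
    then show "m \<le> root_at s" using root_at_less_iff[OF s j(1)] by auto
  qed
  moreover have "bij_betw root_at ({1..s} - {s}) (comp_roots l A - {root_at s})"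
    using bij_root_at s root_at(1)[OF s] by (intro bij_betw_DiffI) auto
  moreover have "{1..s} - {s} = {1..s - 1}" by auto
  ultimately have b: "bij_betw root_at {1..s - 1} (comp_roots l A - {Max (comp_roots l A)})" by simp
  have "(\<Sum>j=1..s - 1. F (shifted_index \<alpha> l C s j)) = (\<Sum>j\<in>{1..s - 1}. F (shifted_root l A (root_at j)))"
    by (intro sum.cong refl, subst shifted_index_root) auto
  also have "\<dots> = (\<Sum>m\<in>comp_roots l A - {Max (comp_roots l A)}. F (shifted_root l A m))"
    by (rule sum.reindex_bij_betw[OF b])
  finally show ?thesis .
qed

end

lemma card_abelian_ideals:
  assumes I: "I \<subseteq> P"
  shows "card (abelian_ideal_sets H P I) = card (rel_ideals l (level l (node_set I)))"
proof -
  have "rel_ideals l (level l {i. \<alpha> i \<in> I}) = rel_ideals l (level l (node_set I))"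
  proof (rule rel_ideals_cong)
    fix x assume x: "x \<in> S"
    have e: "k \<in> node_set I \<longleftrightarrow> \<alpha> k \<in> I" if "1 \<le> k" "k \<le> l" for k using that by (simp add: node_set_def)
    have "(\<Sum>k\<in>{nat \<bar>x\<bar>..<l}. if \<alpha> k \<in> I then 0 else 2 :: int) =
        (\<Sum>k\<in>{nat \<bar>x\<bar>..<l}. if k \<in> node_set I then 0 else 2)"
      using x e by (intro sum.cong) (auto simp: signed_indices_def)
    then show "level l {i. \<alpha> i \<in> I} x = level l (node_set I) x"
      using e[of l] e[of "l - 1"] l_ge_4 by (simp add: level_def)
  qed
  then show ?thesis using bij_betw_same_card[OF bij_betw_abelian_ideals_relations[OF I]] by simp
qed

lemma card_node_set:
  assumes "I \<subseteq> P"
  shows "card (node_set I) = card I"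
proof -
  have "card (\<alpha> ` node_set I) = card (node_set I)" by (rule card_alpha_image[OF node_set_sub(1)])
  then show ?thesis unfolding I_nodes[OF assms, symmetric] by simp
qed

text \<open>Exchanging the two last nodes reduces the case where \<open>I\<close> contains only \<open>\<alpha>\<^sub>l\<close> of them, in which
  \<open>\<epsilon>\<^sub>l\<close> has negative degree, to the case where it contains only \<open>\<alpha>\<^sub>l\<^sub>-\<^sub>1\<close>.\<close>

lemma type_D_swap:
  "type_D H P (\<lambda>i. \<alpha> (if i = l then l - 1 else if i = l - 1 then l else i)) l"
proof -
  let ?t = "\<lambda>i. if i = l then l - 1 else if i = l - 1 then l else i"
  have "bij_betw ?t {1..l} {1..l}"
    using l_ge_4 by (intro bij_betw_byWitness[where f' = ?t]) auto
  then have b: "bij_betw (\<lambda>i. \<alpha> (?t i)) {1..l} P"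
    using bij_betw_trans[OF _ bij_alpha] unfolding comp_def by blast
  have sym: "dynkin_bonds H \<beta> \<gamma> = dynkin_bonds H \<gamma> \<beta>" for \<beta> \<gamma>
    by (simp add: dynkin_bonds_def mult.commute)
  have "dynkin_bonds H (\<alpha> (?t i)) (\<alpha> (?t j)) =
      (if (j = i + 1 \<and> j \<le> l - 1) \<or> (i = l - 2 \<and> j = l) then 1 else 0)"
    if ij: "i \<in> {1..l}" "j \<in> {1..l}" "i < j" for i j
  proof -
    consider "j < l - 1" | "j = l - 1" | "j = l" "i = l - 1" | "j = l" "i < l - 1"
      using ij by fastforce
    then show ?thesis
    proof cases
      case 1
      then have "?t i = i" "?t j = j" using ij by auto
      then show ?thesis using bonds[OF ij] by simp
    next
      case 2
      then have "?t i = i" "?t j = l" using ij by auto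
      moreover have "l - 1 = i + 1 \<longleftrightarrow> i = l - 2" using l_ge_4 by linarith
      ultimately show ?thesis using bonds[of i l] ij 2 by auto
    next
      case 3
      then have "?t i = l" "?t j = l - 1" using ij by auto
      then show ?thesis using bonds[of "l - 1" l] sym[of "\<alpha> l"] ij 3 l_ge_4 by auto
    next
      case 4
      then have "?t i = i" "?t j = l - 1" using ij by auto
      then show ?thesis using bonds[of i "l - 1"] ij 4 l_ge_4 by auto
    qed
  qed
  then show ?thesis unfolding type_D_def using l_ge_4 b by blast
qed

lemma card_abelian_ideals_swapped:
  assumes I: "I \<subseteq> P" and l: "l \<in> node_set I" "l - 1 \<notin> node_set I"
  shows "card (abelian_ideal_sets H P I) =
    card (rel_ideals l (level l (insert (l - 1) (node_set I - {l}))))"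
proof -
  let ?\<alpha> = "\<lambda>i. \<alpha> (if i = l then l - 1 else if i = l - 1 then l else i)"
  interpret swapped: simple_lie_algebra_type_D scale Basis br H P ?\<alpha> l
    by unfold_locales (rule type_D_swap)
  have "swapped.node_set I = insert (l - 1) (node_set I - {l})"
    unfolding swapped.node_set_def using l l_ge_4 by (auto simp: node_set_def)
  then show ?thesis using swapped.card_abelian_ideals[OF I] by simp
qed

end

section \<open>Rewriting the count in terms of components\<close>

context
  fixes l :: nat and A :: "nat set"
  assumes l: "4 \<le> l" and A: "A \<subseteq> {1..l}"
begin

lemma finite_node_subset: "finite A"
  using A finite_subset by blast

lemma card_node_subset_le: "card A \<le> l"
  using card_mono[OF _ A] by simp

lemma block_start_mem: "m \<in> block_starts A l \<Longrightarrow> 1 \<le> m \<and> m < l \<and> m \<in> A"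
  by (simp add: block_starts_def)

lemma shifted_root_block_start:
  "m \<in> block_starts A l \<Longrightarrow> shifted_root l A m = block_index A m"
  using card_below[OF l A, of m] block_start_mem[of m] by (simp add: shifted_root_def)

lemma block_index_l: "block_index A l = (if l \<in> A then l - card A + 1 else l - card A)"
proof -
  have b: "block_index A l = l - card {i \<in> A. i < l}" using card_below[OF l A, of l] l by simp
  show ?thesis
  proof (cases "l \<in> A")
    case True
    have "{i \<in> A. i < l} = A - {l}" using A by (auto simp: le_less)
    then have c: "card {i \<in> A. i < l} = card A - 1" using True finite_node_subset by simp
    have "1 \<le> card A" using True finite_node_subset by (simp add: Suc_le_eq card_gt_0_iff) blast
    then show ?thesis using b c True card_node_subset_le by simp
  next
    case False
    then have "{i \<in> A. i < l} = A" using A by (auto simp: le_less)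
    then show ?thesis using b False by simp
  qed
qed

text \<open>Here \<open>l\<close> is alone in the last block, so all nontrivial blocks are among the first \<open>l - card A - 1\<close>.\<close>

lemma graph_count_none:
  assumes "l - 1 \<notin> A" "l \<notin> A"
  shows "graph_count A l (l - card A) =
      2 ^ (l - card A - 1) + (\<Sum>m\<in>comp_roots l A. (l - card A - 1) choose (shifted_root l A m - 1))"
    and "graph_count A l (l - card A - 1) =
      2 ^ (l - card A - 2) + (\<Sum>m\<in>comp_roots l A. (l - card A - 2) choose (shifted_root l A m - 1))"
proof -
  have D: "block_index A l = l - card A" using block_index_l assms by simp
  have r: "comp_roots l A = block_starts A l" by (rule comp_roots_no_l[OF l A assms(2)])
  have l1: "block_index A l = Suc (block_index A (l - 1))"
    using block_index_Suc[of "l - 1" A] assms(1) l by simp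
  have le: "block_index A m \<le> l - card A - 1" if m: "m \<in> block_starts A l" for m
  proof -
    have "m \<noteq> l - 1" using block_start_mem[OF m] assms(1) by blast
    then have "m \<le> l - 1" using block_start_mem[OF m] by linarith
    then have "block_index A m \<le> block_index A (l - 1)" by (rule block_index_mono)
    then show ?thesis using l1 D by simp
  qed
  then have f: "{m \<in> block_starts A l. block_index A m \<le> l - card A} = block_starts A l"
    "{m \<in> block_starts A l. block_index A m \<le> l - card A - 1} = block_starts A l"
    using le by force+
  have s: "(\<Sum>m\<in>block_starts A l. k choose (block_index A m - 1)) =
      (\<Sum>m\<in>comp_roots l A. k choose (shifted_root l A m - 1))" for k
    unfolding r by (intro sum.cong refl) (simp add: shifted_root_block_start)
  show "graph_count A l (l - card A) =
      2 ^ (l - card A - 1) + (\<Sum>m\<in>comp_roots l A. (l - card A - 1) choose (shifted_root l A m - 1))"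
    unfolding graph_count_def f(1) s ..
  have "l - card A - 1 - 1 = l - card A - 2" by simp
  then show "graph_count A l (l - card A - 1) =
      2 ^ (l - card A - 2) + (\<Sum>m\<in>comp_roots l A. (l - card A - 2) choose (shifted_root l A m - 1))"
    unfolding graph_count_def f(2) s by simp
qed

text \<open>Here the last block is the last component, so it is lost when the last block is removed.\<close>

lemma graph_count_l_minus_1:
  assumes "l - 1 \<in> A" "l \<notin> A"
  shows "graph_count A l (l - card A) =
      2 ^ (l - card A - 1) + (\<Sum>m\<in>comp_roots l A. (l - card A - 1) choose (shifted_root l A m - 1))"
    and "graph_count A l (l - card A - 1) = 2 ^ (l - card A - 2) +
      (\<Sum>m\<in>comp_roots l A - {Max (comp_roots l A)}. (l - card A - 2) choose (shifted_root l A m - 1))"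
proof -
  have D: "block_index A l = l - card A" using block_index_l assms by simp
  have r: "comp_roots l A = block_starts A l" by (rule comp_roots_no_l[OF l A assms(2)])
  have "block_index A m \<le> l - card A" if m: "m \<in> block_starts A l" for m
    using block_index_mono[of m l A] block_start_mem[OF m] D by simp
  then have f: "{m \<in> block_starts A l. block_index A m \<le> l - card A} = block_starts A l" by auto
  have f': "{m \<in> block_starts A l. block_index A m \<le> l - card A - 1} =
      block_starts A l - {Max (block_starts A l)}"
    using last_block_start(3)[OF l A assms(1)] D by simp
  have s: "(\<Sum>m\<in>X. k choose (block_index A m - 1)) = (\<Sum>m\<in>X. k choose (shifted_root l A m - 1))"
    if "X \<subseteq> block_starts A l" for k X
    using that by (intro sum.cong refl) (auto simp: shifted_root_block_start)
  show "graph_count A l (l - card A) =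
      2 ^ (l - card A - 1) + (\<Sum>m\<in>comp_roots l A. (l - card A - 1) choose (shifted_root l A m - 1))"
    unfolding graph_count_def f r using s[OF order_refl] by simp
  have "l - card A - 1 - 1 = l - card A - 2" by simp
  then show "graph_count A l (l - card A - 1) = 2 ^ (l - card A - 2) +
      (\<Sum>m\<in>comp_roots l A - {Max (comp_roots l A)}. (l - card A - 2) choose (shifted_root l A m - 1))"
    unfolding graph_count_def f' r using s[of "block_starts A l - {Max (block_starts A l)}"] by auto
qed

text \<open>If both end nodes belong to \<open>A\<close> but \<open>l - 2\<close> does not, they are two components, and the
  binomial coefficient contributed by \<open>l - 1\<close> vanishes.\<close>

lemma graph_count_both:
  assumes "l - 1 \<in> A" "l \<in> A"
  shows "(if l - card A = 0 then 1 else graph_count A l (l - card A)) = 2 ^ (l - card A - 1) +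
      (\<Sum>m\<in>comp_roots l A - {Max (comp_roots l A)}. (l - card A - 1) choose (shifted_root l A m - 1))"
proof -
  have D: "block_index A l = l - card A + 1" using block_index_l assms by simp
  let ?B = "block_starts A l"
  let ?F = "\<lambda>m. (l - card A - 1) choose (shifted_root l A m - 1)"
  have f: "{m \<in> ?B. block_index A m \<le> l - card A} = ?B - {Max ?B}"
    using last_block_start(3)[OF l A assms(1)] D by simp
  have fin: "finite ?B" by (rule finite_block_starts)
  have s: "(\<Sum>m\<in>?B - {Max ?B}. (l - card A - 1) choose (block_index A m - 1)) = (\<Sum>m\<in>?B - {Max ?B}. ?F m)"
    by (intro sum.cong refl) (simp add: shifted_root_block_start)
  show ?thesis
  proof (cases "l - card A = 0")
    case True
    then have AA: "A = {1..l}" using A card_node_subset_le by (intro card_subset_eq) auto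
    have "comp_roots l A = {1}"
      unfolding comp_roots_def AA using l by (auto simp: parent_def)
    then show ?thesis using True by simp
  next
    case False
    have "(\<Sum>m\<in>comp_roots l A - {Max (comp_roots l A)}. ?F m) = (\<Sum>m\<in>?B - {Max ?B}. ?F m)"
    proof (cases "l - 2 \<in> A")
      case True
      then have "comp_roots l A = ?B"
        using A l assms by (auto simp: comp_roots_def block_starts_def parent_def)
      then show ?thesis by simp
    next
      case nA: False
      have cr: "comp_roots l A = insert l ?B"
        using A l assms nA by (auto simp: comp_roots_def block_starts_def parent_def)
      have "Max (insert l ?B) = l" using fin block_start_mem by (intro Max_eqI) force+
      moreover have "l \<notin> ?B" using block_start_mem by blast
      ultimately have "comp_roots l A - {Max (comp_roots l A)} = ?B" unfolding cr by simp
      moreover have "(\<Sum>m\<in>?B. ?F m) = ?F (Max ?B) + (\<Sum>m\<in>?B - {Max ?B}. ?F m)"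
        using fin last_block_start(1)[OF l A assms(1)] by (intro sum.remove Max_in)
      moreover have "?F (Max ?B) = 0"
      proof -
        have "shifted_root l A (Max ?B) = l - card A + 1"
          using shifted_root_block_start[OF Max_in[OF fin last_block_start(1)[OF l A assms(1)]]]
            last_block_start(2)[OF l A assms(1)] D by simp
        then show ?thesis using False by (simp add: binomial_eq_0)
      qed
      ultimately show ?thesis by simp
    qed
    then show ?thesis using False f s by (simp add: graph_count_def)
  qed
qed

end

text \<open>Replacing \<open>l\<close> by \<open>l - 1\<close> turns a component \<open>{l}\<close> into \<open>{l - 1}\<close> and does not change the smallest nodes
  of the others. The exceptional definition of \<open>l\<^sub>s\<close> compensates for the shift.\<close>

lemma graph_count_l:
  assumes l: "4 \<le> l" and A: "A \<subseteq> {1..l}" "l \<in> A" "l - 1 \<notin> A"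
  defines "A' \<equiv> insert (l - 1) (A - {l})"
  shows "graph_count A' l (l - card A) =
      2 ^ (l - card A - 1) + (\<Sum>m\<in>comp_roots l A. (l - card A - 1) choose (shifted_root l A m - 1))"
    and "graph_count A' l (l - card A - 1) = 2 ^ (l - card A - 2) +
      (\<Sum>m\<in>comp_roots l A - {Max (comp_roots l A)}. (l - card A - 2) choose (shifted_root l A m - 1))"
    and "block_index A' l = l - card A"
proof -
  have A': "A' \<subseteq> {1..l}" "l - 1 \<in> A'" "l \<notin> A'" using A l by (auto simp: A'_def)
  have fin: "finite A" using A(1) finite_subset by blast
  have "card A' = Suc (card (A - {l}))" unfolding A'_def using fin A(3) by simp
  then have c: "card A' = card A" using card_Suc_Diff1[OF fin A(2)] by (simp only:)
  let ?f = "\<lambda>m. if m = l then l - 1 else m"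
  have low: "m < l - 1 \<or> m = l" if "m \<in> comp_roots l A" for m
  proof -
    have "m \<in> A" using that by (simp add: comp_roots_def)
    then have "m \<le> l" "m \<noteq> l - 1" using A by auto
    then show ?thesis by linarith
  qed
  have mem: "i \<in> A' \<longleftrightarrow> i \<in> A" if "i < l - 1" for i using that by (auto simp: A'_def)
  have par: "parent l (l - 1) = l - 2" using l by (simp add: parent_def numeral_2_eq_2)
  have img: "?f ` comp_roots l A = comp_roots l A'"
  proof (intro equalityI subsetI)
    fix m' assume "m' \<in> ?f ` comp_roots l A"
    then obtain m where m: "m \<in> comp_roots l A" "m' = ?f m" by blast
    show "m' \<in> comp_roots l A'"
    proof (cases "m = l")
      case True
      have "l - 2 \<notin> A" using m(1) True by (simp add: comp_roots_def parent_def)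
      then have "l - 2 \<notin> A'" using mem[of "l - 2"] l by simp
      then show ?thesis using m(2) True A'(2) par by (simp add: comp_roots_def)
    next
      case False
      then have ml: "m < l - 1" using low[OF m(1)] by simp
      moreover have "parent l m < l - 1" using ml by (auto simp: parent_def)
      ultimately show ?thesis using m False mem by (simp add: comp_roots_def)
    qed
  next
    fix m' assume m': "m' \<in> comp_roots l A'"
    then have "m' \<in> A'" by (simp add: comp_roots_def)
    then have "m' \<le> l" "m' \<noteq> l" using A' by auto
    then consider "m' = l - 1" | "m' < l - 1" by linarith
    then show "m' \<in> ?f ` comp_roots l A"
    proof cases
      case 1
      then have "parent l (l - 1) \<notin> A'" using m' by (simp add: comp_roots_def)
      then have "l - 2 \<notin> A'" unfolding par .
      then have "l - 2 \<notin> A" using mem[of "l - 2"] l by simp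
      then have "l \<in> comp_roots l A" using A(2) by (simp add: comp_roots_def parent_def)
      then show ?thesis using 1 by (intro image_eqI[of _ _ l]) auto
    next
      case 2
      moreover have "parent l m' < l - 1" using 2 by (auto simp: parent_def)
      ultimately have "m' \<in> comp_roots l A" using m' mem by (simp add: comp_roots_def)
      then show ?thesis using 2 by (intro image_eqI[of _ _ m']) auto
    qed
  qed
  have inj: "inj_on ?f (comp_roots l A)"
    using low by (intro inj_onI) (fastforce split: if_splits)
  have sh: "shifted_root l A' (?f m) = shifted_root l A m" if m: "m \<in> comp_roots l A" for m
  proof (cases "m = l")
    case True
    have "i < l \<longleftrightarrow> i < l - 1" if "i \<in> A" for i using that A(3) by (cases "i = l - 1") auto
    then have e: "{i \<in> A. i < l} = {i \<in> A. i < l - 1}" by blast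
    have e': "{i \<in> A'. i < l - 1} = {i \<in> A. i < l - 1}" using mem by blast
    have "l - 1 \<noteq> l" using l by simp
    then have "shifted_root l A' (l - 1) = l - 1 - card {i \<in> A'. i < l - 1}"
      unfolding shifted_root_def by simp
    also have "\<dots> = l - card {i \<in> A. i < l} - 1" unfolding e e' by (rule diff_commute)
    also have "\<dots> = shifted_root l A l" unfolding shifted_root_def by simp
    finally show ?thesis using True by simp
  next
    case False
    then have "m < l - 1" using low[OF m] by simp
    then have "{i \<in> A'. i < m} = {i \<in> A. i < m}" using mem by auto
    then show ?thesis using False by (simp add: shifted_root_def)
  qed
  have sum: "(\<Sum>m\<in>?f ` X. k choose (shifted_root l A' m - 1)) =
      (\<Sum>m\<in>X. k choose (shifted_root l A m - 1))" if X: "X \<subseteq> comp_roots l A" for k X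
    unfolding sum.reindex[OF inj_on_subset[OF inj X]] comp_def
  proof (rule sum.cong[OF refl])
    fix m assume "m \<in> X"
    then have "shifted_root l A' (?f m) = shifted_root l A m" using X by (intro sh) blast
    then show "k choose (shifted_root l A' (?f m) - 1) = k choose (shifted_root l A m - 1)"
      by (simp only:)
  qed
  have finr: "finite (comp_roots l A)" using fin by (auto simp: comp_roots_def intro: finite_subset)
  have rem: "?f ` (comp_roots l A - {Max (comp_roots l A)}) = comp_roots l A' - {Max (comp_roots l A')}"
  proof (cases "comp_roots l A = {}")
    case True
    then show ?thesis using img by simp
  next
    case False
    let ?M = "Max (comp_roots l A)"
    have M: "?M \<in> comp_roots l A" using finr False by (rule Max_in)
    have "Max (?f ` comp_roots l A) = ?f ?M"
    proof (rule Max_eqI)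
      show "finite (?f ` comp_roots l A)" using finr by simp
      show "?f ?M \<in> ?f ` comp_roots l A" using M by blast
      fix y assume "y \<in> ?f ` comp_roots l A"
      then obtain m where m: "m \<in> comp_roots l A" "y = ?f m" by blast
      then have "m \<le> ?M" using finr by (intro Max_ge)
      then show "y \<le> ?f ?M" using low[OF m(1)] low[OF M] m(2) by auto
    qed
    then have "Max (comp_roots l A') = ?f ?M" using img by simp
    then show ?thesis using inj_on_image_set_diff[OF inj, of "comp_roots l A" "{?M}"] img M by simp
  qed
  show "graph_count A' l (l - card A) =
      2 ^ (l - card A - 1) + (\<Sum>m\<in>comp_roots l A. (l - card A - 1) choose (shifted_root l A m - 1))"
    using graph_count_l_minus_1(1)[OF l A'] sum[OF order_refl] unfolding c img by simp
  show "graph_count A' l (l - card A - 1) = 2 ^ (l - card A - 2) +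
      (\<Sum>m\<in>comp_roots l A - {Max (comp_roots l A)}. (l - card A - 2) choose (shifted_root l A m - 1))"
    using graph_count_l_minus_1(2)[OF l A'] sum[of "comp_roots l A - {Max (comp_roots l A)}"]
    unfolding c rem by simp
  show "block_index A' l = l - card A" using block_index_l[OF l A'(1)] A'(3) c by simp
qed

theorem proposition5p20:
  fixes scale :: "complex \<Rightarrow> 'g::ab_group_add \<Rightarrow> 'g"
    and Basis :: "'g set"
    and br :: "'g \<Rightarrow> 'g \<Rightarrow> 'g"
    and H :: "'g set"
    and P I :: "('g \<Rightarrow> complex) set"
    and \<alpha> :: "nat \<Rightarrow> 'g \<Rightarrow> complex"
    and C :: "nat \<Rightarrow> ('g \<Rightarrow> complex) set"
    and l r s t :: nat
  assumes "complex_lie_algebra scale Basis br"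
    and "complex_lie_algebra.simple scale br"
    and "complex_lie_algebra.cartan_subalgebra scale br H"
    and "complex_lie_algebra.root_base scale br H P"
    and "complex_lie_algebra.type_D scale Basis br H P \<alpha> l"
    and "I \<subseteq> P" and "card I = r"
    and "bij_betw C {1..s} (complex_lie_algebra.dynkin_components scale Basis br H I)"
    and "\<forall>j\<in>{1..s}. \<forall>k\<in>{1..s}. j < k \<longrightarrow> min_index \<alpha> l (C j) < min_index \<alpha> l (C k)"
    and "t = card ({\<alpha> (l - 1), \<alpha> l} \<inter> I)"
  shows
    "(\<alpha> 1 \<in> I \<and> t = 0 \<longrightarrow>
        int (card (complex_lie_algebra.abelian_ideal_sets scale br H P I)) =
          2 ^ (l - r) - 2 ^ (l - r - 2)
          + (\<Sum>j=1..s. 2 * int ((l - r - 1) choose (shifted_index \<alpha> l C s j - 1))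
                        - int ((l - r - 2) choose (shifted_index \<alpha> l C s j - 1)))) \<and>
     (\<alpha> 1 \<in> I \<and> t = 1 \<longrightarrow>
        int (card (complex_lie_algebra.abelian_ideal_sets scale br H P I)) =
          2 ^ (l - r - 1)
          + (\<Sum>j=1..s. int ((l - r - 1) choose (shifted_index \<alpha> l C s j - 1)))) \<and>
     (\<alpha> 1 \<in> I \<and> t = 2 \<longrightarrow>
        int (card (complex_lie_algebra.abelian_ideal_sets scale br H P I)) =
          2 ^ (l - r - 1)
          + (\<Sum>j=1..s - 1. int ((l - r - 1) choose (shifted_index \<alpha> l C s j - 1)))) \<and>
     (\<alpha> 1 \<notin> I \<and> t = 0 \<longrightarrow>
        int (card (complex_lie_algebra.abelian_ideal_sets scale br H P I)) =
          2 ^ (l - r)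
          + (\<Sum>j=1..s. 2 * int ((l - r - 1) choose (shifted_index \<alpha> l C s j - 1)))) \<and>
     (\<alpha> 1 \<notin> I \<and> t = 1 \<longrightarrow>
        int (card (complex_lie_algebra.abelian_ideal_sets scale br H P I)) =
          2 ^ (l - r - 1) + 2 ^ (l - r - 2)
          + (\<Sum>j=1..s. int ((l - r - 1) choose (shifted_index \<alpha> l C s j - 1)))
          + (\<Sum>j=1..s - 1. int ((l - r - 2) choose (shifted_index \<alpha> l C s j - 1)))) \<and>
     (\<alpha> 1 \<notin> I \<and> t = 2 \<longrightarrow>
        int (card (complex_lie_algebra.abelian_ideal_sets scale br H P I)) =
          2 ^ (l - r)
          + 2 * (\<Sum>j=1..s - 1. int ((l - r - 1) choose (shifted_index \<alpha> l C s j - 1))))"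
proof -
  interpret complex_lie_algebra scale Basis br by fact
  interpret simple_lie_algebra_type_D scale Basis br H P \<alpha> l
    by unfold_locales fact+
  let ?A = "node_set I"
  let ?N = "card (abelian_ideal_sets H P I)"
  let ?c = "\<lambda>k j. k choose (shifted_index \<alpha> l C s j - 1)"
  let ?g = "graph_count ?A l"
  note I = \<open>I \<subseteq> P\<close>
  have r: "card ?A = r" using card_node_set[OF I] \<open>card I = r\<close> by simp
  note A = node_set_sub(1)[of I]
  have C: "bij_betw C {1..s} (dynkin_components H I)" by fact
  have ord: "\<forall>j\<in>{1..s}. \<forall>k\<in>{1..s}. j < k \<longrightarrow> min_index \<alpha> l (C j) < min_index \<alpha> l (C k)" by fact
  have all: "(\<Sum>m\<in>comp_roots l ?A. k choose (shifted_root l ?A m - 1)) = (\<Sum>j=1..s. ?c k j)" for k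
    by (rule sum_over_components[OF I C ord, symmetric])
  have but_last: "(\<Sum>m\<in>comp_roots l ?A - {Max (comp_roots l ?A)}. k choose (shifted_root l ?A m - 1)) =
      (\<Sum>j=1..s - 1. ?c k j)" for k
    by (rule sum_over_all_but_last[OF I C ord, symmetric])
  have node: "i \<in> ?A \<longleftrightarrow> \<alpha> i \<in> I" if "1 \<le> i" "i \<le> l" for i using that by (simp add: node_set_def)
  have nodes: "1 \<in> ?A \<longleftrightarrow> \<alpha> 1 \<in> I" "l - 1 \<in> ?A \<longleftrightarrow> \<alpha> (l - 1) \<in> I" "l \<in> ?A \<longleftrightarrow> \<alpha> l \<in> I"
    using node[of 1] node[of "l - 1"] node[of l] l_ge_4 by simp_all
  have "l - 1 \<in> {1..l}" "l \<in> {1..l}" "l - 1 \<noteq> l" using l_ge_4 by simp_all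
  then have "\<alpha> (l - 1) \<noteq> \<alpha> l" using alpha_inj by blast
  then have t: "t = (if l - 1 \<in> ?A then 1 else 0) + (if l \<in> ?A then 1 else 0)"
    unfolding \<open>t = _\<close> nodes by (cases "\<alpha> (l - 1) \<in> I"; cases "\<alpha> l \<in> I") simp_all
  \<comment> \<open>an addition on the left, because the formula for \<open>t = 0\<close> contains a difference\<close>
  have case0: "?N + (2 ^ (l - r - 2) + (\<Sum>j=1..s. ?c (l - r - 2) j)) =
      2 * (2 ^ (l - r - 1) + (\<Sum>j=1..s. ?c (l - r - 1) j)) +
      (if \<alpha> 1 \<in> I then 0 else 2 ^ (l - r - 2) + (\<Sum>j=1..s. ?c (l - r - 2) j))"
    if t0: "t = 0"
  proof -
    have n: "l - 1 \<notin> ?A" "l \<notin> ?A" using t t0 by (auto split: if_splits)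
    have D: "block_index ?A l = l - r" using block_index_l[OF l_ge_4 A] n r by simp
    note gc = graph_count_none[OF l_ge_4 A n, unfolded r all]
    have "?N + ?g (l - r - 1) = 2 * ?g (l - r) + (if 1 \<in> ?A then 0 else ?g (l - r - 1))"
      using card_rel_ideals_blocks(1)[OF l_ge_4 _ n(1)] n unfolding card_abelian_ideals[OF I] D by blast
    then show ?thesis unfolding gc nodes .
  qed
  have case1: "?N = 2 ^ (l - r - 1) + (\<Sum>j=1..s. ?c (l - r - 1) j) +
      (if \<alpha> 1 \<in> I then 0 else 2 ^ (l - r - 2) + (\<Sum>j=1..s - 1. ?c (l - r - 2) j))"
    if t1: "t = 1"
  proof (cases "l \<in> ?A")
    case False
    then have n: "l - 1 \<in> ?A" using t unfolding t1 by (cases "l - 1 \<in> ?A") simp_all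
    have D: "block_index ?A l = l - r" using block_index_l[OF l_ge_4 A] False r by simp
    note gc = graph_count_l_minus_1[OF l_ge_4 A n False, unfolded r all but_last]
    have "?N = ?g (l - r) + (if 1 \<in> ?A then 0 else ?g (l - r - 1))"
      using card_rel_ideals_blocks(2)[OF l_ge_4 _ n False] n unfolding card_abelian_ideals[OF I] D by blast
    then show ?thesis unfolding gc nodes .
  next
    case True
    then have n: "l - 1 \<notin> ?A" using t unfolding t1 by (cases "l - 1 \<in> ?A") simp_all
    let ?A' = "insert (l - 1) (?A - {l})"
    have A'1: "1 \<in> ?A' \<longleftrightarrow> \<alpha> 1 \<in> I" and A'l: "l - 1 \<in> ?A'" "l \<notin> ?A'"
      using nodes(1) l_ge_4 by auto
    note gc = graph_count_l[OF l_ge_4 A True n, unfolded r all but_last]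
    have "?N = graph_count ?A' l (l - r) + (if 1 \<in> ?A' then 0 else graph_count ?A' l (l - r - 1))"
      using card_rel_ideals_blocks(2)[OF l_ge_4 _ A'l] A'l
      unfolding card_abelian_ideals_swapped[OF I True n] gc(3) by blast
    then show ?thesis unfolding gc(1,2) A'1 .
  qed
  have case2: "?N = 2 ^ (l - r - 1) + (\<Sum>j=1..s - 1. ?c (l - r - 1) j) +
      (if \<alpha> 1 \<in> I then 0 else 2 ^ (l - r - 1) + (\<Sum>j=1..s - 1. ?c (l - r - 1) j))"
    if t2: "t = 2"
  proof -
    have n: "l - 1 \<in> ?A" "l \<in> ?A"
      using t unfolding t2 by (cases "l - 1 \<in> ?A"; cases "l \<in> ?A"; simp)+
    have D: "block_index ?A l = l - r + 1" using block_index_l[OF l_ge_4 A] n r by simp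
    note gc = graph_count_both[OF l_ge_4 A n, unfolded r but_last]
    let ?G = "if l - r = 0 then 1 else ?g (l - r)"
    have "?N = ?G + (if 1 \<in> ?A then 0 else ?G)"
    proof (cases "l - r = 0")
      case True
      then have "?A = {1..l}" using A card_node_subset_le[OF l_ge_4 A] r by (intro card_subset_eq) auto
      then have "1 \<in> ?A" using l_ge_4 by simp
      then show ?thesis
        using card_rel_ideals_blocks(4)[OF l_ge_4 _ n(2)] n D True card_abelian_ideals[OF I] by simp
    next
      case False
      then show ?thesis
        using card_rel_ideals_blocks(3)[OF l_ge_4 _ n(2)] n D card_abelian_ideals[OF I] by simp
    qed
    then show ?thesis unfolding gc nodes .
  qed
  have "2 ^ (l - r) = (2 * 2 ^ (l - r - 1) :: nat)" if "t \<noteq> 2 \<or> \<alpha> 1 \<notin> I"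
  proof -
    have "l - 1 \<in> {1..l}" "l \<in> {1..l}" "1 \<in> {1..l}" using l_ge_4 by simp_all
    moreover have "l - 1 \<notin> ?A \<or> l \<notin> ?A \<or> 1 \<notin> ?A" using that t nodes(1) by auto
    ultimately have "?A \<noteq> {1..l}" by blast
    then have "card ?A < card {1..l}" using A by (intro psubset_card_mono) auto
    then have "l - r = Suc (l - r - 1)" using r by simp
    then show ?thesis by (metis power_Suc)
  qed
  then have pow: "2 ^ (l - r) = (2 * 2 ^ (l - r - 1) :: int)" if "t \<noteq> 2 \<or> \<alpha> 1 \<notin> I"
    using that by (metis of_nat_mult of_nat_numeral of_nat_power)
  show ?thesis
  proof (intro conjI impI)
    assume a: "\<alpha> 1 \<in> I \<and> t = 0"
    then have "int ?N + (2 ^ (l - r - 2) + (\<Sum>j=1..s. int (?c (l - r - 2) j))) =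
        2 * (2 ^ (l - r - 1) + (\<Sum>j=1..s. int (?c (l - r - 1) j)))"
      using arg_cong[OF case0, of int] by simp
    then show "int ?N = 2 ^ (l - r) - 2 ^ (l - r - 2)
          + (\<Sum>j=1..s. 2 * int (?c (l - r - 1) j) - int (?c (l - r - 2) j))"
      using pow a by (simp add: sum_subtractf sum_distrib_left)
  next
    assume "\<alpha> 1 \<in> I \<and> t = 1"
    then show "int ?N = 2 ^ (l - r - 1) + (\<Sum>j=1..s. int (?c (l - r - 1) j))"
      using case1 by simp
  next
    assume "\<alpha> 1 \<in> I \<and> t = 2"
    then show "int ?N = 2 ^ (l - r - 1) + (\<Sum>j=1..s - 1. int (?c (l - r - 1) j))"
      using case2 by simp
  next
    assume a: "\<alpha> 1 \<notin> I \<and> t = 0"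
    then have "int ?N = 2 * (2 ^ (l - r - 1) + (\<Sum>j=1..s. int (?c (l - r - 1) j)))"
      using arg_cong[OF case0, of int] by simp
    then show "int ?N = 2 ^ (l - r) + (\<Sum>j=1..s. 2 * int (?c (l - r - 1) j))"
      using pow a by (simp add: sum_distrib_left)
  next
    assume "\<alpha> 1 \<notin> I \<and> t = 1"
    then show "int ?N = 2 ^ (l - r - 1) + 2 ^ (l - r - 2)
          + (\<Sum>j=1..s. int (?c (l - r - 1) j)) + (\<Sum>j=1..s - 1. int (?c (l - r - 2) j))"
      using case1 by simp
  next
    assume a: "\<alpha> 1 \<notin> I \<and> t = 2"
    then have "int ?N = 2 * (2 ^ (l - r - 1) + (\<Sum>j=1..s - 1. int (?c (l - r - 1) j)))"
      using case2 by simp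
    then show "int ?N = 2 ^ (l - r) + 2 * (\<Sum>j=1..s - 1. int (?c (l - r - 1) j))"
      using pow a by simp
  qed
qed

end
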